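(* Let $\widehat M$ be an irreducible Coxeter matrix of finite type over $\widehat I$ with $m=|\widehat I|>2$ and let $\Phi:\mathrm{Br}^+(\widehat M)\to\mathrm{Br}^+(M)$ be an optimal fully supported disjoint standard homomorphism, where $M$ is of type $A_n$ or $B_n$. (a) If $\widehat M$ is not of type $B$ then $\widehat M$ and $M$ are both of type $A$ and $\Phi$ is an isomorphism. (b) If $\widehat M=B_m$ and $M=B_n$ then $m\le n$ and $$\Phi(\widehat T_i)=T_i,\quad i\in[1,m-1],\qquad\Phi(\widehat T_m)=T_{w_\circ^{[m,n]}}.$$ (c) If $\widehat M=B_m$ and $M=A_n$ then $m\le\lceil n/2\rceil$ and $\Phi$ is the composition of the homomorphism $\mathrm{Br}^+(B_m)\to\mathrm{Br}^+(B_{\lceil n/2\rceil})$, $\widehat T_i\mapsto T_i$ for $i\in[1,m-1]$, $\widehat T_m\mapsto T_{w_\circ^{[m,\lceil n/2\rceil]}}$, with the standard unfolding $\Upsilon:\mathrm{Br}^+(B_{\lceil n/2\rceil})\to\mathrm{Br}^+(A_n)$.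
   Context: $[a,b]=\{i\in\mathbb Z:a\le i\le b\}$. For a Coxeter matrix $M=(m_{ij})_{i,j\in I}$ (symmetric, $m_{ii}=1$, $m_{ij}\in\mathbb Z_{\ge2}\cup\{\infty\}$ for $i\ne j$), the Artin monoid $\mathrm{Br}^+(M)$ is generated by $T_i$, $i\in I$, subject to $T_iT_jT_i\cdots=T_jT_iT_j\cdots$ ($m_{ij}$ factors) for $i\neq j$, $m_{ij}<\infty$. $M$ is of finite type if its Coxeter group $W(M)$ is finite and irreducible if the graph on $I$ with edges $\{i,j\}$, $m_{ij}>2$, is connected. $A_n$: $I=[1,n]$, $m_{ij}=3$ if $|i-j|=1$, $2$ if $|i-j|>1$. $B_n$ ($n\ge2$): the same except $m_{n-1,n}=4$. For $w\in W(M)$, $T_w$ is the product of the $T_i$ along any reduced expression; $w_\circ^J$ is the longest element of $W_J(M)=\langle s_j:j\in J\rangle$ (if finite). Standard unfolding $\Upsilon:\mathrm{Br}^+(B_k)\to\mathrm{Br}^+(A_n)$, $k=\lceil n/2\rceil$: if $n=2k-1$, $\widehat T_i\mapsto T_iT_{2k-i}$ for $i\in[1,k-1]$ and $\widehat T_k\mapsto T_k$; if $n=2k$, $\widehat T_i\mapsto T_iT_{2k+1-i}$ for $i\in[1,k-1]$ and $\widehat T_k\mapsto T_kT_{k+1}T_k$. For a homomorphism $\Phi:\mathrm{Br}^+(\widehat M)\to\mathrm{Br}^+(M)$, $[\Phi](i)\subset I$ is the set of indices of generators occurring in $\Phi(\widehat T_i)$. $\Phi$ is: standard if $W_{[\Phi](i)}(M)$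 is finite and $\Phi(\widehat T_i)=T_{w_\circ^{[\Phi](i)}}$ for all $i\in\widehat I$; disjoint if $[\Phi](i)\cap[\Phi](j)=\emptyset$ for $i\neq j$; fully supported if $\bigcup_i[\Phi](i)=I$; optimal if for all $i\ne j$ with $\Phi(\widehat T_i)\neq\Phi(\widehat T_j)$ such that the set $B$ of $k\in\mathbb Z_{>0}$ for which the alternating products of length $k$, $\Phi(\widehat T_i)\Phi(\widehat T_j)\Phi(\widehat T_i)\cdots$ and $\Phi(\widehat T_j)\Phi(\widehat T_i)\Phi(\widehat T_j)\cdots$, coincide is non-empty, one has $\widehat m_{ij}=\min B$. *)

theory Defs
  imports "HOL-Library.Extended_Nat" "HOL-Algebra.Generated_Groups"
begin

section \<open>Coxeter matrices\<close>

text \<open>A Coxeter matrix carries its index set; entries outside the index set are irrelevant.\<close>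

record 'a coxeter =
  nodes :: "'a set"
  bond :: "'a \<Rightarrow> 'a \<Rightarrow> enat"

definition coxeter_matrix :: "'a coxeter \<Rightarrow> bool" where
  "coxeter_matrix M \<longleftrightarrow>
     (\<forall>i\<in>nodes M. bond M i i = 1) \<and>
     (\<forall>i\<in>nodes M. \<forall>j\<in>nodes M. bond M i j = bond M j i) \<and>
     (\<forall>i\<in>nodes M. \<forall>j\<in>nodes M. i \<noteq> j \<longrightarrow> 2 \<le> bond M i j)"

definition coxeter_irreducible :: "'a coxeter \<Rightarrow> bool" where
  "coxeter_irreducible M \<longleftrightarrow>
     nodes M \<noteq> {} \<and>
     (\<forall>i\<in>nodes M. \<forall>j\<in>nodes M.
        (i, j) \<in> {(a, b). a \<in> nodes M \<and> b \<in> nodes M \<and> a \<noteq> b \<and> 2 < bond M a b}\<^sup>*)"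

definition cox_A :: "nat \<Rightarrow> nat coxeter" where
  "cox_A n = \<lparr>nodes = {1..n},
     bond = (\<lambda>i j. if i = j then 1 else if j = Suc i \<or> i = Suc j then 3 else 2)\<rparr>"

definition cox_B :: "nat \<Rightarrow> nat coxeter" where
  "cox_B n = \<lparr>nodes = {1..n},
     bond = (\<lambda>i j. if i = j then 1
                   else if {i, j} = {n - 1, n} then 4
                   else if j = Suc i \<or> i = Suc j then 3 else 2)\<rparr>"

definition coxeter_iso :: "('a \<Rightarrow> 'b) \<Rightarrow> 'a coxeter \<Rightarrow> 'b coxeter \<Rightarrow> bool" where
  "coxeter_iso \<sigma> L M \<longleftrightarrow>
     bij_betw \<sigma> (nodes L) (nodes M) \<and>
     (\<forall>i\<in>nodes L. \<forall>j\<in>nodes L. bond M (\<sigma> i) (\<sigma> j) = bond L i j)"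

definition type_A :: "'a coxeter \<Rightarrow> bool" where
  "type_A M \<longleftrightarrow> (\<exists>k\<ge>1. \<exists>\<sigma>. coxeter_iso \<sigma> (cox_A k) M)"

definition type_B :: "'a coxeter \<Rightarrow> bool" where
  "type_B M \<longleftrightarrow> (\<exists>k\<ge>2. \<exists>\<sigma>. coxeter_iso \<sigma> (cox_B k) M)"


section \<open>Monoids given by generators and relations\<close>

text \<open>The least congruence on the free monoid \<^term>\<open>lists I\<close> containing the relations \<open>R\<close>.\<close>

inductive pres_cong :: "'a set \<Rightarrow> ('a list \<times> 'a list) set \<Rightarrow> 'a list \<Rightarrow> 'a list \<Rightarrow> bool"
  for I R where
  rel: "(u, v) \<in> R \<Longrightarrow> u \<in> lists I \<Longrightarrow> v \<in> lists I \<Longrightarrow> pres_cong I R u v"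
| refl: "u \<in> lists I \<Longrightarrow> pres_cong I R u u"
| sym: "pres_cong I R u v \<Longrightarrow> pres_cong I R v u"
| trans: "pres_cong I R u v \<Longrightarrow> pres_cong I R v w \<Longrightarrow> pres_cong I R u w"
| append: "pres_cong I R u v \<Longrightarrow> pres_cong I R u' v' \<Longrightarrow> pres_cong I R (u @ u') (v @ v')"

definition pres_class :: "'a set \<Rightarrow> ('a list \<times> 'a list) set \<Rightarrow> 'a list \<Rightarrow> 'a list set" where
  "pres_class I R u = {v. pres_cong I R u v}"

text \<open>Elements are congruence classes, that is, sets of words.\<close>

definition presented_monoid :: "'a set \<Rightarrow> ('a list \<times> 'a list) set \<Rightarrow> 'a list set monoid" where
  "presented_monoid I R =
     \<lparr>carrier = pres_class I R ` lists I,
      mult = (\<lambda>X Y. \<Union>u\<in>X. \<Union>v\<in>Y. pres_class I R (u @ v)),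
      one = pres_class I R []\<rparr>"

lemma pres_cong_lists: "pres_cong I R u v \<Longrightarrow> u \<in> lists I \<and> v \<in> lists I"
  by (induction rule: pres_cong.induct) auto

lemma pres_class_eq_iff:
  assumes "u \<in> lists I"
  shows "pres_class I R u = pres_class I R v \<longleftrightarrow> pres_cong I R u v"
proof
  assume "pres_class I R u = pres_class I R v"
  moreover have "u \<in> pres_class I R u"
    using assms by (simp add: pres_class_def pres_cong.refl)
  ultimately show "pres_cong I R u v"
    by (simp add: pres_class_def pres_cong.sym)
next
  assume "pres_cong I R u v"
  then show "pres_class I R u = pres_class I R v"
    unfolding pres_class_def using pres_cong.sym pres_cong.trans by blast
qed

lemma presented_monoid_mult:
  assumes "u \<in> lists I" "v \<in> lists I"
  shows "pres_class I R u \<otimes>\<^bsub>presented_monoid I R\<^esub> pres_class I R v = pres_class I R (u @ v)"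
proof -
  have "pres_class I R (u' @ v') = pres_class I R (u @ v)"
    if "u' \<in> pres_class I R u" "v' \<in> pres_class I R v" for u' v'
  proof -
    have "pres_cong I R (u @ v) (u' @ v')"
      using that by (simp add: pres_class_def pres_cong.append)
    then show ?thesis
      using assms by (metis append_in_lists_conv pres_class_eq_iff)
  qed
  moreover have "u \<in> pres_class I R u" "v \<in> pres_class I R v"
    using assms by (simp_all add: pres_class_def pres_cong.refl)
  ultimately have "(\<Union>u'\<in>pres_class I R u. \<Union>v'\<in>pres_class I R v. pres_class I R (u' @ v'))
      = pres_class I R (u @ v)"
    by blast
  then show ?thesis
    by (simp add: presented_monoid_def)
qed

lemma monoid_presented_monoid: "monoid (presented_monoid I R)"
proof -
  have c: "carrier (presented_monoid I R) = pres_class I R ` lists I"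
    and o: "\<one>\<^bsub>presented_monoid I R\<^esub> = pres_class I R []"
    by (simp_all add: presented_monoid_def)
  have m: "pres_class I R u \<otimes>\<^bsub>presented_monoid I R\<^esub> pres_class I R v = pres_class I R (u @ v)"
    if "set u \<subseteq> I" "set v \<subseteq> I" for u v
    using that by (intro presented_monoid_mult) auto
  have mem: "\<exists>u. set u \<subseteq> I \<and> x = pres_class I R u"
    if "x \<in> carrier (presented_monoid I R)" for x
    using that by (auto simp: c)
  show ?thesis
  proof (rule monoidI)
    fix x y
    assume "x \<in> carrier (presented_monoid I R)" "y \<in> carrier (presented_monoid I R)"
    then obtain u v where uv: "set u \<subseteq> I" "set v \<subseteq> I"
      "x = pres_class I R u" "y = pres_class I R v"
      using mem by metis
    then have "u @ v \<in> lists I"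
      by auto
    then show "x \<otimes>\<^bsub>presented_monoid I R\<^esub> y \<in> carrier (presented_monoid I R)"
      unfolding uv(3,4) m[OF uv(1,2)] c by (rule imageI)
  next
    show "\<one>\<^bsub>presented_monoid I R\<^esub> \<in> carrier (presented_monoid I R)"
      unfolding c o by (intro imageI) simp
  next
    fix x y z
    assume "x \<in> carrier (presented_monoid I R)" "y \<in> carrier (presented_monoid I R)"
      "z \<in> carrier (presented_monoid I R)"
    then obtain u v w where "set u \<subseteq> I" "set v \<subseteq> I" "set w \<subseteq> I"
      "x = pres_class I R u" "y = pres_class I R v" "z = pres_class I R w"
      using mem by metis
    then show "x \<otimes>\<^bsub>presented_monoid I R\<^esub> y \<otimes>\<^bsub>presented_monoid I R\<^esub> z =
        x \<otimes>\<^bsub>presented_monoid I R\<^esub> (y \<otimes>\<^bsub>presented_monoid I R\<^esub> z)"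
      by (simp add: m)
  next
    fix x
    assume "x \<in> carrier (presented_monoid I R)"
    then obtain u where "set u \<subseteq> I" "x = pres_class I R u"
      using mem by metis
    then show "\<one>\<^bsub>presented_monoid I R\<^esub> \<otimes>\<^bsub>presented_monoid I R\<^esub> x = x"
      and "x \<otimes>\<^bsub>presented_monoid I R\<^esub> \<one>\<^bsub>presented_monoid I R\<^esub> = x"
      by (simp_all add: o m)
  qed
qed

fun alt_word :: "nat \<Rightarrow> 'a \<Rightarrow> 'a \<Rightarrow> 'a list" where
  "alt_word 0 i j = []"
| "alt_word (Suc k) i j = i # alt_word k j i"

definition braid_relations :: "'a coxeter \<Rightarrow> ('a list \<times> 'a list) set" where
  "braid_relations M =
     {(alt_word k i j, alt_word k j i) | k i j.
        i \<in> nodes M \<and> j \<in> nodes M \<and> i \<noteq> j \<and> bond M i j = enat k}"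


section \<open>Artin monoids\<close>

definition artin_monoid :: "'a coxeter \<Rightarrow> 'a list set monoid" where
  "artin_monoid M = presented_monoid (nodes M) (braid_relations M)"

definition artin_gen :: "'a coxeter \<Rightarrow> 'a \<Rightarrow> 'a list set" where
  "artin_gen M i = pres_class (nodes M) (braid_relations M) [i]"

text \<open>Both sides of a braid relation contain the same letters, so the union
  below equals the set of letters of any one word representing \<open>x\<close>.\<close>

definition artin_support :: "'a list set \<Rightarrow> 'a set" where
  "artin_support x = (\<Union>u\<in>x. set u)"


section \<open>Coxeter groups\<close>

text \<open>Because of the relations \<open>s\<^sub>i s\<^sub>i = 1\<close>, presenting \<open>W(M)\<close> as a monoid
  or as a group yields the same object.\<close>

definition coxeter_relations :: "'a coxeter \<Rightarrow> ('a list \<times> 'a list) set" where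
  "coxeter_relations M = braid_relations M \<union> {([i, i], []) | i. i \<in> nodes M}"

definition coxeter_group :: "'a coxeter \<Rightarrow> 'a list set monoid" where
  "coxeter_group M = presented_monoid (nodes M) (coxeter_relations M)"

definition coxeter_gen :: "'a coxeter \<Rightarrow> 'a \<Rightarrow> 'a list set" where
  "coxeter_gen M i = pres_class (nodes M) (coxeter_relations M) [i]"

lemma coxeter_cong_rev:
  "u \<in> lists (nodes M) \<Longrightarrow> pres_cong (nodes M) (coxeter_relations M) (rev u @ u) []"
proof (induction u)
  case Nil
  then show ?case by (simp add: pres_cong.refl)
next
  case (Cons i u)
  let ?c = "pres_cong (nodes M) (coxeter_relations M)"
  have i: "i \<in> nodes M" and u: "u \<in> lists (nodes M)"
    using Cons.prems by simp_all
  have "?c [i, i] []"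
    using i by (intro pres_cong.rel) (auto simp: coxeter_relations_def)
  moreover have "?c (rev u) (rev u)" "?c u u"
    using u by (auto intro!: pres_cong.refl)
  ultimately have "?c (rev u @ [i, i] @ u) (rev u @ [] @ u)"
    by (intro pres_cong.append)
  then have "?c (rev (i # u) @ i # u) (rev u @ u)"
    by simp
  then show ?case
    using Cons.IH[OF u] by (rule pres_cong.trans)
qed

lemma group_coxeter_group: "group (coxeter_group M)"
proof -
  interpret monoid "coxeter_group M"
    unfolding coxeter_group_def by (rule monoid_presented_monoid)
  show ?thesis
  proof (rule group_l_invI)
    fix x assume "x \<in> carrier (coxeter_group M)"
    then obtain u where u: "u \<in> lists (nodes M)"
      and x: "x = pres_class (nodes M) (coxeter_relations M) u"
      by (auto simp: coxeter_group_def presented_monoid_def)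
    let ?y = "pres_class (nodes M) (coxeter_relations M) (rev u)"
    have "?y \<otimes>\<^bsub>coxeter_group M\<^esub> x = pres_class (nodes M) (coxeter_relations M) (rev u @ u)"
      using u by (auto simp: x coxeter_group_def intro!: presented_monoid_mult)
    also have "\<dots> = pres_class (nodes M) (coxeter_relations M) []"
      using coxeter_cong_rev[OF u] u by (intro pres_class_eq_iff[THEN iffD2]) auto
    also have "\<dots> = \<one>\<^bsub>coxeter_group M\<^esub>"
      by (simp add: coxeter_group_def presented_monoid_def)
    finally have "?y \<otimes>\<^bsub>coxeter_group M\<^esub> x = \<one>\<^bsub>coxeter_group M\<^esub>" .
    moreover have "?y \<in> carrier (coxeter_group M)"
      using u by (auto simp: coxeter_group_def presented_monoid_def)
    ultimately show "\<exists>y\<in>carrier (coxeter_group M). y \<otimes>\<^bsub>coxeter_group M\<^esub> x = \<one>\<^bsub>coxeter_group M\<^esub>"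
      by blast
  qed
qed

definition finite_type :: "'a coxeter \<Rightarrow> bool" where
  "finite_type M \<longleftrightarrow> finite (carrier (coxeter_group M))"

definition parabolic :: "'a coxeter \<Rightarrow> 'a set \<Rightarrow> 'a list set set" where
  "parabolic M J = generate (coxeter_group M) (coxeter_gen M ` J)"

text \<open>An element of \<^term>\<open>coxeter_group M\<close> is the set of all words representing it.\<close>

definition coxeter_length :: "'a list set \<Rightarrow> nat" where
  "coxeter_length w = (LEAST l. \<exists>u\<in>w. length u = l)"

definition reduced_word :: "'a list set \<Rightarrow> 'a list \<Rightarrow> bool" where
  "reduced_word w u \<longleftrightarrow> u \<in> w \<and> length u = coxeter_length w"

text \<open>The choice of reduced word is immaterial by Matsumoto's theorem, and an element of
  maximal length in a finite parabolic subgroup is unique.\<close>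

definition artin_elt :: "'a coxeter \<Rightarrow> 'a list set \<Rightarrow> 'a list set" where
  "artin_elt M w = pres_class (nodes M) (braid_relations M) (SOME u. reduced_word w u)"

definition longest_elt :: "'a coxeter \<Rightarrow> 'a set \<Rightarrow> 'a list set" where
  "longest_elt M J = arg_max coxeter_length (\<lambda>w. w \<in> parabolic M J)"


section \<open>Homomorphisms of Artin monoids\<close>

text \<open>\<^const>\<open>hom\<close> only asks for compatibility with multiplication.\<close>

definition monoid_hom :: "('a, 'c) monoid_scheme \<Rightarrow> ('b, 'd) monoid_scheme \<Rightarrow> ('a \<Rightarrow> 'b) set" where
  "monoid_hom G H = {f \<in> hom G H. f \<one>\<^bsub>G\<^esub> = \<one>\<^bsub>H\<^esub>}"

abbreviation artin_hom :: "'a coxeter \<Rightarrow> 'b coxeter \<Rightarrow> ('a list set \<Rightarrow> 'b list set) set" where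
  "artin_hom L M \<equiv> monoid_hom (artin_monoid L) (artin_monoid M)"

definition hom_support :: "'a coxeter \<Rightarrow> ('a list set \<Rightarrow> 'b list set) \<Rightarrow> 'a \<Rightarrow> 'b set" where
  "hom_support L \<Phi> i = artin_support (\<Phi> (artin_gen L i))"

definition standard_hom ::
    "'a coxeter \<Rightarrow> 'b coxeter \<Rightarrow> ('a list set \<Rightarrow> 'b list set) \<Rightarrow> bool" where
  "standard_hom L M \<Phi> \<longleftrightarrow>
     (\<forall>i\<in>nodes L. finite (parabolic M (hom_support L \<Phi> i)) \<and>
        \<Phi> (artin_gen L i) = artin_elt M (longest_elt M (hom_support L \<Phi> i)))"

definition disjoint_hom :: "'a coxeter \<Rightarrow> ('a list set \<Rightarrow> 'b list set) \<Rightarrow> bool" where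
  "disjoint_hom L \<Phi> \<longleftrightarrow>
     (\<forall>i\<in>nodes L. \<forall>j\<in>nodes L. i \<noteq> j \<longrightarrow> hom_support L \<Phi> i \<inter> hom_support L \<Phi> j = {})"

definition fully_supported_hom ::
    "'a coxeter \<Rightarrow> 'b coxeter \<Rightarrow> ('a list set \<Rightarrow> 'b list set) \<Rightarrow> bool" where
  "fully_supported_hom L M \<Phi> \<longleftrightarrow> (\<Union>i\<in>nodes L. hom_support L \<Phi> i) = nodes M"

fun alt_prod :: "('a, 'c) monoid_scheme \<Rightarrow> nat \<Rightarrow> 'a \<Rightarrow> 'a \<Rightarrow> 'a" where
  "alt_prod G 0 x y = \<one>\<^bsub>G\<^esub>"
| "alt_prod G (Suc k) x y = x \<otimes>\<^bsub>G\<^esub> alt_prod G k y x"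

definition braid_lengths :: "('a, 'c) monoid_scheme \<Rightarrow> 'a \<Rightarrow> 'a \<Rightarrow> nat set" where
  "braid_lengths G x y = {k. 0 < k \<and> alt_prod G k x y = alt_prod G k y x}"

definition optimal_hom ::
    "'a coxeter \<Rightarrow> 'b coxeter \<Rightarrow> ('a list set \<Rightarrow> 'b list set) \<Rightarrow> bool" where
  "optimal_hom L M \<Phi> \<longleftrightarrow>
     (\<forall>i\<in>nodes L. \<forall>j\<in>nodes L.
        let x = \<Phi> (artin_gen L i); y = \<Phi> (artin_gen L j);
            B = braid_lengths (artin_monoid M) x y
        in i \<noteq> j \<and> x \<noteq> y \<and> B \<noteq> {} \<longrightarrow> bond L i j = enat (LEAST k. k \<in> B))"

text \<open>A homomorphism out of an Artin monoid is determined on the carrier by the images of the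
  generators, so at most one \<open>\<Upsilon>\<close> (up to values outside the carrier) satisfies the following;
  \<open>(n + 1) div 2\<close> is the ceiling of \<open>n/2\<close>.\<close>

definition standard_unfolding :: "nat \<Rightarrow> (nat list set \<Rightarrow> nat list set) \<Rightarrow> bool" where
  "standard_unfolding n \<Upsilon> \<longleftrightarrow>
     (let k = (n + 1) div 2; A = artin_monoid (cox_A n);
          S = artin_gen (cox_B k); T = artin_gen (cox_A n)
      in \<Upsilon> \<in> artin_hom (cox_B k) (cox_A n) \<and>
         (if odd n
          then (\<forall>i\<in>{1..k - 1}. \<Upsilon> (S i) = T i \<otimes>\<^bsub>A\<^esub> T (2 * k - i)) \<and>
               \<Upsilon> (S k) = T k
          else (\<forall>i\<in>{1..k - 1}. \<Upsilon> (S i) = T i \<otimes>\<^bsub>A\<^esub> T (2 * k + 1 - i)) \<and>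
               \<Upsilon> (S k) = T k \<otimes>\<^bsub>A\<^esub> T (k + 1) \<otimes>\<^bsub>A\<^esub> T k))"

end

theory Submission
  imports Defs Complex_Main "HOL-Library.Sublist"
begin

text \<open>The images of the generators under a disjoint standard homomorphism are the longest elements of disjoint
  subsets \<open>J\<^sub>i\<close> of the path \<open>[1, n]\<close>. In type A such an element is a product of half twists on the blocks of strands
  cut out by \<open>J\<^sub>i\<close>. The permutation of the strands and the number of crossings of each pair of strands are
  invariants of positive braids; comparing them on both sides of a braid relation shows that \<open>J\<^sub>i\<close> and \<open>J\<^sub>j\<close> are
  adjacent somewhere if \<open>m\<^sub>i\<^sub>j > 2\<close>, that for \<open>m\<^sub>i\<^sub>j = 3\<close> all blocks are single letters and every letter of \<open>J\<^sub>i\<close> has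
  exactly one neighbour in \<open>J\<^sub>j\<close>, and it restricts the pattern around a relation of length 4 or 5. A target of type
  \<open>B\<^sub>n\<close> is first unfolded to \<open>A\<^sub>2\<^sub>n\<^sub>-\<^sub>1\<close>.

  Finiteness of the Coxeter group of the source makes the form with entries \<open>- cos (\<pi> / m\<^sub>i\<^sub>j)\<close> positive definite, so
  that in rank at least 3 all \<open>m\<^sub>i\<^sub>j\<close> are at most 5 and at most one of them exceeds 3. Reading the indices \<open>i\<close> of the sets
  \<open>J\<^sub>i\<close> along the path therefore gives a walk in the Coxeter graph which cannot turn back along an edge with
  \<open>m\<^sub>i\<^sub>j = 3\<close>. Either it never turns back and visits every vertex once (type A), or it turns back once, around the block
  of the end vertex of the exceptional edge, and is a palindrome (type B).\<close>

section \<open>Words, congruences and homomorphisms\<close>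

text \<open>\<open>artin_elt\<close> takes an arbitrary reduced word and \<open>longest_elt\<close>
  an arbitrary element of maximal length, so both choices must be shown harmless before a braid can
  be inspected. The word \<open>delta\<close> does this: braid moves bring every word over
  \<open>J\<close> to a normal form, of which \<open>delta\<close> is the longest, or to a word with
  a square. For a word as long as \<open>delta\<close> and with the same permutation a square is
  impossible, because the permutation of the strands bounds the length from below. In type B this
  bound needs care, since unfolding doubles most letters but not the last one; the crossings of
  mirror pairs supply the correction. Optimality enters in one direction: generators whose images
  commute have bond 2, so an edge of the graph makes the supports touch. Everything else comes from
  the relations that \<open>\<Phi>\<close> preserves. Rank at least 3 gives one end of an edge of
  bond above 3 a further neighbour, which rules out bond 5 and makes the walk rigid there. In (c)
  the first factor has to be constructed; its critical relation is the one of length 4 between the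
  letter \<open>m - 1\<close> and the longest element of \<open>[m, k]\<close>.\<close>

abbreviation braid_eq :: "'a coxeter \<Rightarrow> 'a list \<Rightarrow> 'a list \<Rightarrow> bool" where
  "braid_eq M \<equiv> pres_cong (nodes M) (braid_relations M)"

abbreviation cox_eq :: "'a coxeter \<Rightarrow> 'a list \<Rightarrow> 'a list \<Rightarrow> bool" where
  "cox_eq M \<equiv> pres_cong (nodes M) (coxeter_relations M)"

abbreviation artin_class :: "'a coxeter \<Rightarrow> 'a list \<Rightarrow> 'a list set" where
  "artin_class M \<equiv> pres_class (nodes M) (braid_relations M)"

abbreviation coxeter_class :: "'a coxeter \<Rightarrow> 'a list \<Rightarrow> 'a list set" where
  "coxeter_class M \<equiv> pres_class (nodes M) (coxeter_relations M)"

declare pres_cong.trans [trans]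

lemma pres_cong_ctxt:
  assumes "pres_cong I R u v" "set a \<subseteq> I" "set b \<subseteq> I"
  shows "pres_cong I R (a @ u @ b) (a @ v @ b)"
  using assms by (intro pres_cong.append pres_cong.refl) auto

lemma pres_cong_left: "pres_cong I R u v \<Longrightarrow> set a \<subseteq> I \<Longrightarrow> pres_cong I R (a @ u) (a @ v)"
  using pres_cong_ctxt[of I R u v a "[]"] by simp

lemma pres_cong_right: "pres_cong I R u v \<Longrightarrow> set b \<subseteq> I \<Longrightarrow> pres_cong I R (u @ b) (v @ b)"
  using pres_cong_ctxt[of I R u v "[]" b] by simp

lemma pres_cong_mono: "pres_cong I R u v \<Longrightarrow> R \<subseteq> R' \<Longrightarrow> pres_cong I R' u v"
  by (induction rule: pres_cong.induct) (auto intro: pres_cong.intros)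

lemma braid_imp_cox: "braid_eq M u v \<Longrightarrow> cox_eq M u v"
  by (erule pres_cong_mono) (auto simp: coxeter_relations_def)

lemma pres_cong_concat_map:
  assumes "pres_cong I R u v"
    and "\<And>i. i \<in> I \<Longrightarrow> set (h i) \<subseteq> I'"
    and "\<And>u v. (u, v) \<in> R \<Longrightarrow> set u \<subseteq> I \<Longrightarrow> set v \<subseteq> I \<Longrightarrow>
      pres_cong I' R' (concat (map h u)) (concat (map h v))"
  shows "pres_cong I' R' (concat (map h u)) (concat (map h v))"
  using assms(1)
proof (induction rule: pres_cong.induct)
  case (refl u)
  then have "concat (map h u) \<in> lists I'" using assms(2) by fastforce
  then show ?case by (rule pres_cong.refl)
qed (use assms(3) in \<open>auto intro: pres_cong.intros\<close>)

text \<open>\<open>F\<close> need not be multiplicative, so the induction carries arbitrary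
  contexts: in a concatenation the left factor is changed between \<open>a\<close> and
  \<open>u' @ b\<close>, then the right factor between \<open>a @ v\<close> and \<open>b\<close>.
  Permutations, crossing numbers, supports, lengths and reflection actions are all treated this
  way.\<close>

lemma pres_cong_invariant:
  assumes "pres_cong I R u v"
    and "\<And>a b u v. (u, v) \<in> R \<Longrightarrow> set u \<subseteq> I \<Longrightarrow> set v \<subseteq> I \<Longrightarrow> set a \<subseteq> I \<Longrightarrow> set b \<subseteq> I \<Longrightarrow>
      F (a @ u @ b) = F (a @ v @ b)"
  shows "F u = F v"
proof -
  have "\<forall>a b. set a \<subseteq> I \<longrightarrow> set b \<subseteq> I \<longrightarrow> F (a @ u @ b) = F (a @ v @ b)"
    using assms(1)
  proof (induction rule: pres_cong.induct)
    case (rel u v)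
    then show ?case using assms(2) by blast
  next
    case (append u v u' v')
    then have s: "set u \<subseteq> I" "set v \<subseteq> I" "set u' \<subseteq> I" "set v' \<subseteq> I"
      using pres_cong_lists by blast+
    show ?case
    proof (intro allI impI)
      fix a b assume ab: "set a \<subseteq> I" "set b \<subseteq> I"
      have "F (a @ u @ (u' @ b)) = F (a @ v @ (u' @ b))"
        using append.IH(1) ab s by simp
      also have "\<dots> = F ((a @ v) @ u' @ b)" by simp
      also have "\<dots> = F ((a @ v) @ v' @ b)"
        using append.IH(2)[rule_format, of "a @ v" b] ab s by auto
      finally show "F (a @ (u @ u') @ b) = F (a @ (v @ v') @ b)" by simp
    qed
  qed auto
  from this[rule_format, of "[]" "[]"] show ?thesis by simp
qed

lemma presented_one: "\<one>\<^bsub>presented_monoid I R\<^esub> = pres_class I R []"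
  by (simp add: presented_monoid_def)

lemma presented_carrier: "carrier (presented_monoid I R) = pres_class I R ` {u. set u \<subseteq> I}"
  by (auto simp: presented_monoid_def image_iff)

lemma pres_class_eqI: "pres_cong I R u v \<Longrightarrow> pres_class I R u = pres_class I R v"
  using pres_class_eq_iff pres_cong_lists by metis

lemma hom_on_words:
  assumes \<Phi>: "\<Phi> \<in> monoid_hom (presented_monoid I R) (presented_monoid I' R')"
    and h: "\<And>i. i \<in> I \<Longrightarrow> set (h i) \<subseteq> I'"
    and gen: "\<And>i. i \<in> I \<Longrightarrow> \<Phi> (pres_class I R [i]) = pres_class I' R' (h i)"
    and u: "set u \<subseteq> I"
  shows "\<Phi> (pres_class I R u) = pres_class I' R' (concat (map h u))"
  using u
proof (induction u)
  case Nil
  then show ?case using \<Phi> by (simp add: monoid_hom_def presented_one)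
next
  case (Cons i u)
  then have iu: "[i] \<in> lists I" "u \<in> lists I" by auto
  have "\<Phi> (pres_class I R ([i] @ u)) =
      \<Phi> (pres_class I R [i] \<otimes>\<^bsub>presented_monoid I R\<^esub> pres_class I R u)"
    using iu by (simp only: presented_monoid_mult)
  also have "\<dots> = \<Phi> (pres_class I R [i]) \<otimes>\<^bsub>presented_monoid I' R'\<^esub> \<Phi> (pres_class I R u)"
    using \<Phi> iu by (intro hom_mult[of \<Phi>]) (auto simp: monoid_hom_def presented_carrier)
  also have "\<dots> = pres_class I' R' (h i) \<otimes>\<^bsub>presented_monoid I' R'\<^esub> pres_class I' R' (concat (map h u))"
    using Cons gen by simp
  also have "\<dots> = pres_class I' R' (h i @ concat (map h u))"
    using Cons.prems h by (intro presented_monoid_mult) fastforce+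
  finally show ?case by simp
qed

text \<open>The union over all representatives avoids a choice: if \<open>h\<close> respects the
  relations, all classes in the union coincide.\<close>

definition word_hom :: "'b set \<Rightarrow> ('b list \<times> 'b list) set \<Rightarrow> ('a \<Rightarrow> 'b list) \<Rightarrow> 'a list set \<Rightarrow> 'b list set" where
  "word_hom I' R' h X = (\<Union>u\<in>X. pres_class I' R' (concat (map h u)))"

lemma word_hom:
  fixes h :: "'a \<Rightarrow> 'b list"
  assumes h: "\<And>i. i \<in> I \<Longrightarrow> set (h i) \<subseteq> I'"
    and rel: "\<And>u v. (u, v) \<in> R \<Longrightarrow> set u \<subseteq> I \<Longrightarrow> set v \<subseteq> I \<Longrightarrow>
      pres_cong I' R' (concat (map h u)) (concat (map h v))"
  shows word_hom_class: "\<And>u. set u \<subseteq> I \<Longrightarrow>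
      word_hom I' R' h (pres_class I R u) = pres_class I' R' (concat (map h u))"
    and word_hom_in_monoid_hom:
      "word_hom I' R' h \<in> monoid_hom (presented_monoid I R) (presented_monoid I' R')"
proof -
  have sub: "concat (map h u) \<in> lists I'" if "set u \<subseteq> I" for u
    using that h by fastforce
  show cls: "word_hom I' R' h (pres_class I R u) = pres_class I' R' (concat (map h u))"
    if u: "set u \<subseteq> I" for u
  proof -
    have "pres_class I' R' (concat (map h v)) = pres_class I' R' (concat (map h u))"
      if "v \<in> pres_class I R u" for v
    proof -
      have "pres_cong I R v u" using that by (auto simp: pres_class_def intro: pres_cong.sym)
      from pres_cong_concat_map[OF this h rel] show ?thesis by (rule pres_class_eqI) auto
    qed
    moreover have "u \<in> pres_class I R u" using u by (auto simp: pres_class_def intro: pres_cong.refl)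
    ultimately show ?thesis unfolding word_hom_def by blast
  qed
  show "word_hom I' R' h \<in> monoid_hom (presented_monoid I R) (presented_monoid I' R')"
    unfolding monoid_hom_def hom_def presented_one mem_Collect_eq Pi_def
  proof (intro conjI ballI allI impI)
    fix x assume "x \<in> carrier (presented_monoid I R)"
    then show "word_hom I' R' h x \<in> carrier (presented_monoid I' R')"
      using sub cls by (fastforce simp: presented_carrier)
  next
    fix x y assume "x \<in> carrier (presented_monoid I R)" "y \<in> carrier (presented_monoid I R)"
    then obtain u v where uv: "set u \<subseteq> I" "x = pres_class I R u" "set v \<subseteq> I" "y = pres_class I R v"
      by (auto simp: presented_carrier)
    have "x \<otimes>\<^bsub>presented_monoid I R\<^esub> y = pres_class I R (u @ v)"
      using uv by (simp add: presented_monoid_mult in_lists_conv_set subset_iff)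
    then have "word_hom I' R' h (x \<otimes>\<^bsub>presented_monoid I R\<^esub> y) = pres_class I' R' (concat (map h (u @ v)))"
      using uv by (simp add: cls)
    also have "\<dots> = pres_class I' R' (concat (map h u)) \<otimes>\<^bsub>presented_monoid I' R'\<^esub> pres_class I' R' (concat (map h v))"
      using presented_monoid_mult[OF sub[OF uv(1)] sub[OF uv(3)]] by simp
    finally show "word_hom I' R' h (x \<otimes>\<^bsub>presented_monoid I R\<^esub> y) =
        word_hom I' R' h x \<otimes>\<^bsub>presented_monoid I' R'\<^esub> word_hom I' R' h y"
      using uv cls by simp
  qed (simp add: cls)
qed

fun alt_concat :: "nat \<Rightarrow> 'a list \<Rightarrow> 'a list \<Rightarrow> 'a list" where
  "alt_concat 0 u v = []"
| "alt_concat (Suc k) u v = u @ alt_concat k v u"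

lemma concat_map_alt_word: "concat (map h (alt_word k i j)) = alt_concat k (h i) (h j)"
  by (induction k arbitrary: i j) auto

lemma set_alt_concat: "set (alt_concat k u v) \<subseteq> set u \<union> set v"
  by (induction k arbitrary: u v) fastforce+

lemma alt_prod_class:
  assumes "set u \<subseteq> I" "set v \<subseteq> I"
  shows "alt_prod (presented_monoid I R) k (pres_class I R u) (pres_class I R v) =
    pres_class I R (alt_concat k u v)"
  using assms
proof (induction k arbitrary: u v)
  case (Suc k)
  have "alt_concat k v u \<in> lists I" "u \<in> lists I" using set_alt_concat[of k v u] Suc.prems by auto
  then show ?case using Suc by (simp add: presented_monoid_mult)
qed (simp add: presented_one)

lemma set_alt_word: "set (alt_word k i j) \<subseteq> {i, j}"
  by (induction k arbitrary: i j) fastforce+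

lemma alt_word_numeral [simp]:
  "alt_word (numeral k) i j = i # alt_word (pred_numeral k) j i"
  by (simp add: numeral_eq_Suc)

lemma braid_eq_alt:
  assumes "i \<in> nodes M" "j \<in> nodes M" "i \<noteq> j" "bond M i j = enat k"
  shows "braid_eq M (alt_word k i j) (alt_word k j i)"
proof (rule pres_cong.rel)
  show "(alt_word k i j, alt_word k j i) \<in> braid_relations M"
    using assms by (auto simp: braid_relations_def)
  show "alt_word k i j \<in> lists (nodes M)" "alt_word k j i \<in> lists (nodes M)"
    using set_alt_word[of k i j] set_alt_word[of k j i] assms by auto
qed

lemma cox_eq_square: "i \<in> nodes M \<Longrightarrow> cox_eq M [i, i] []"
  by (rule pres_cong.rel) (auto simp: coxeter_relations_def)

section \<open>Strands\<close>

definition tr :: "nat \<Rightarrow> nat \<Rightarrow> nat" where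
  "tr i y = (if y = i then Suc i else if y = Suc i then i else y)"

definition crossing :: "nat \<Rightarrow> nat \<Rightarrow> nat \<Rightarrow> nat" where
  "crossing i y z = (if y = i \<and> z = Suc i \<or> y = Suc i \<and> z = i then 1 else 0)"

text \<open>A strand is named by its starting position. Letters act from left to right, and
  \<open>pos u y\<close> is the position where strand \<open>y\<close> ends.\<close>

fun pos :: "nat list \<Rightarrow> nat \<Rightarrow> nat" where
  "pos [] y = y"
| "pos (i # u) y = pos u (tr i y)"

text \<open>The recursion follows both strands, so this counts, without sign, how often the strands
  starting at \<open>y\<close> and \<open>z\<close> cross.\<close>

fun cross :: "nat list \<Rightarrow> nat \<Rightarrow> nat \<Rightarrow> nat" where
  "cross [] y z = 0"
| "cross (i # u) y z = crossing i y z + cross u (tr i y) (tr i z)"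

lemma tr_tr [simp]: "tr i (tr i y) = y"
  by (auto simp: tr_def)

lemma tr_eq_iff [simp]: "tr i y = tr i z \<longleftrightarrow> y = z"
  by (metis tr_tr)

lemma pos_append [simp]: "pos (u @ v) y = pos v (pos u y)"
  by (induction u arbitrary: y) auto

lemma cross_append [simp]: "cross (u @ v) y z = cross u y z + cross v (pos u y) (pos u z)"
  by (induction u arbitrary: y z) auto

lemma pos_eq_iff [simp]: "pos u y = pos u z \<longleftrightarrow> y = z"
  by (induction u arbitrary: y z) auto

lemma crossing_commute: "crossing i y z = crossing i z y"
  by (auto simp: crossing_def)

lemma cross_commute: "cross u y z = cross u z y"
  by (induction u arbitrary: y z) (simp_all add: crossing_commute)

lemma cross_self [simp]: "cross u y y = 0"
  by (induction u arbitrary: y) (simp_all add: crossing_def)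

text \<open>A letter exchanges neighbouring positions only, so two strands change their order
  exactly when they cross.\<close>

lemma pos_less_iff: "y \<noteq> z \<Longrightarrow> pos u y < pos u z \<longleftrightarrow> (y < z \<longleftrightarrow> even (cross u y z))"
proof (induction u arbitrary: y z)
  case (Cons i u)
  then have "pos (i # u) y < pos (i # u) z \<longleftrightarrow> (tr i y < tr i z \<longleftrightarrow> even (cross u (tr i y) (tr i z)))"
    by simp
  moreover have "tr i y < tr i z \<longleftrightarrow> (y < z \<longleftrightarrow> even (crossing i y z))"
    using Cons.prems by (auto simp: tr_def crossing_def)
  ultimately show ?case by auto
qed simp

text \<open>An absent letter \<open>i\<close> is a wall between the positions \<open>i\<close> and
  \<open>i + 1\<close>, which no strand passes.\<close>

lemma cross_no_letter:
  assumes "i \<notin> set u" "y \<le> i" "i < z"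
  shows "cross u y z = 0" "pos u y \<le> i" "i < pos u z"
proof -
  have "cross u y z = 0 \<and> pos u y \<le> i \<and> i < pos u z"
    using assms
  proof (induction u arbitrary: y z)
    case (Cons j u)
    then have "tr j y \<le> i" "i < tr j z" "crossing j y z = 0"
      by (auto simp: tr_def crossing_def)
    then show ?case using Cons by simp
  qed simp
  then show "cross u y z = 0" "pos u y \<le> i" "i < pos u z" by auto
qed

text \<open>Consider the strands that meet at the first occurrence of \<open>i\<close>. Up to there
  the wall at \<open>i\<close> is intact, so they started on opposite sides of it.\<close>

lemma cross_letter:
  assumes "i \<in> set u"
  shows "\<exists>y z. y \<le> i \<and> i < z \<and> 0 < cross u y z"
proof -
  obtain a b where u: "u = a @ i # b" "i \<notin> set a"
    using assms split_list_first by fastforce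
  have surj: "\<exists>y. pos a y = x" for x :: nat
    by (induction a arbitrary: x) (auto, metis tr_tr)
  obtain y z where yz: "pos a y = i" "pos a z = Suc i" using surj by metis
  have "y \<le> i" using cross_no_letter(3)[OF u(2), of i y] yz by (cases "y \<le> i") auto
  moreover have "i < z" using cross_no_letter(2)[OF u(2), of z "Suc i"] yz by (cases "i < z") auto
  moreover have "cross u y z > 0" using yz by (simp add: u(1) crossing_def)
  ultimately show ?thesis by blast
qed

lemma pos_range: "set u \<subseteq> {1..n} \<Longrightarrow> y \<in> {1..Suc n} \<Longrightarrow> pos u y \<in> {1..Suc n}"
proof (induction u arbitrary: y)
  case (Cons i u)
  then have "tr i y \<in> {1..Suc n}" by (auto simp: tr_def)
  with Cons show ?case by simp
qed simp

lemma pos_outside: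
  assumes "\<And>i. i \<in> set u \<Longrightarrow> y \<noteq> i \<and> y \<noteq> Suc i"
  shows "pos u y = y" "cross u y z = 0"
proof -
  have "pos u y = y \<and> cross u y z = 0"
    using assms
  proof (induction u arbitrary: z)
    case (Cons i u)
    then have "tr i y = y" "crossing i y z = 0" by (auto simp: tr_def crossing_def)
    then show ?case using Cons by simp
  qed simp
  then show "pos u y = y" "cross u y z = 0" by auto
qed

lemma tr_bij: "1 \<le> i \<Longrightarrow> i \<le> n \<Longrightarrow> bij_betw (tr i) {1..Suc n} {1..Suc n}"
  by (rule bij_betw_byWitness[where f' = "tr i"]) (auto simp: tr_def)

text \<open>Every letter makes one pair of strands cross, and the pair is counted in both
  orders.\<close>

lemma sum_cross:
  assumes "set u \<subseteq> {1..n}"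
  shows "(\<Sum>y\<in>{1..Suc n}. \<Sum>z\<in>{1..Suc n}. cross u y z) = 2 * length u"
  using assms
proof (induction u)
  case (Cons i u)
  then have i: "1 \<le> i" "i \<le> n" by auto
  let ?S = "{1..Suc n}"
  have "(\<Sum>y\<in>?S. \<Sum>z\<in>?S. crossing i y z) = (\<Sum>y\<in>?S. (if y = i then 1 else 0) + (if y = Suc i then 1 else 0))"
  proof (rule sum.cong[OF HOL.refl])
    fix y assume "y \<in> ?S"
    have "(\<Sum>z\<in>?S. crossing i y z) = (\<Sum>z\<in>?S. (if z = Suc i then (if y = i then 1 else 0) else 0)
       + (if z = i then (if y = Suc i then 1 else 0) else 0))"
      by (rule sum.cong) (auto simp: crossing_def)
    then show "(\<Sum>z\<in>?S. crossing i y z) = (if y = i then 1 else 0) + (if y = Suc i then 1 else 0)"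
      using i by (simp add: sum.distrib)
  qed
  also have "\<dots> = 2" using i by (simp add: sum.distrib)
  finally have 1: "(\<Sum>y\<in>?S. \<Sum>z\<in>?S. crossing i y z) = 2" .
  have "(\<Sum>y\<in>?S. \<Sum>z\<in>?S. cross u (tr i y) (tr i z)) = (\<Sum>y\<in>?S. \<Sum>z\<in>?S. cross u (tr i y) z)"
    by (rule sum.cong[OF HOL.refl], rule sum.reindex_bij_betw[OF tr_bij[OF i]])
  also have "\<dots> = (\<Sum>y\<in>?S. \<Sum>z\<in>?S. cross u y z)"
    by (rule sum.reindex_bij_betw[OF tr_bij[OF i], of "\<lambda>y. \<Sum>z\<in>?S. cross u y z"])
  finally show ?case using 1 Cons by (simp add: sum.distrib)
qed simp

section \<open>The Artin and Coxeter relations of types A and B\<close>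

text \<open>One family for both types, so that normal forms and longest elements are treated only
  once.\<close>

definition cox :: "bool \<Rightarrow> nat \<Rightarrow> nat coxeter" where
  "cox b n = (if b then cox_B n else cox_A n)"

lemma nodes_cox [simp]: "nodes (cox b n) = {1..n}" "nodes (cox_A n) = {1..n}" "nodes (cox_B n) = {1..n}"
  by (auto simp: cox_def cox_A_def cox_B_def)

lemma braid_commute_adj:
  assumes "i \<in> {1..n}" "j \<in> {1..n}" "i + 2 \<le> j \<or> j + 2 \<le> i"
  shows "braid_eq (cox b n) [i, j] [j, i]"
proof -
  have "{i, j} \<noteq> {n - 1, n}" using assms by (auto simp: doubleton_eq_iff)
  then have "bond (cox b n) i j = enat 2"
    using assms by (auto simp: cox_def cox_A_def cox_B_def numeral_eq_enat)
  then show ?thesis using braid_eq_alt[of i "cox b n" j 2] assms by auto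
qed

lemma braid_three:
  assumes "i \<in> {1..n}" "Suc i \<in> {1..n}" "b \<Longrightarrow> Suc i < n"
  shows "braid_eq (cox b n) [i, Suc i, i] [Suc i, i, Suc i]"
proof -
  have "b \<Longrightarrow> {i, Suc i} \<noteq> {n - 1, n}" using assms by (auto simp: doubleton_eq_iff)
  then have "bond (cox b n) i (Suc i) = enat 3"
    using assms by (auto simp: cox_def cox_A_def cox_B_def numeral_eq_enat)
  then show ?thesis using braid_eq_alt[of i "cox b n" "Suc i" 3] assms by auto
qed

lemma braid_four:
  assumes "b" "Suc i = n" "1 \<le> i"
  shows "braid_eq (cox b n) [i, Suc i, i, Suc i] [Suc i, i, Suc i, i]"
proof -
  have "bond (cox b n) i (Suc i) = enat 4"
    using assms by (auto simp: cox_def cox_A_def cox_B_def numeral_eq_enat)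
  then show ?thesis using braid_eq_alt[of i "cox b n" "Suc i" 4] assms by auto
qed

lemma braid_relations_cox_cases:
  assumes "(u, v) \<in> braid_relations (cox b n)"
    and "\<And>i j. i \<in> {1..n} \<Longrightarrow> j \<in> {1..n} \<Longrightarrow> i + 2 \<le> j \<or> j + 2 \<le> i \<Longrightarrow> P [i, j] [j, i]"
    and "\<And>i. i \<in> {1..n} \<Longrightarrow> Suc i \<in> {1..n} \<Longrightarrow> (b \<Longrightarrow> Suc i < n) \<Longrightarrow> P [i, Suc i, i] [Suc i, i, Suc i]"
    and "\<And>i. b \<Longrightarrow> Suc i = n \<Longrightarrow> 1 \<le> i \<Longrightarrow> P [i, Suc i, i, Suc i] [Suc i, i, Suc i, i]"
    and sym: "\<And>u v. P u v \<Longrightarrow> P v u"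
  shows "P u v"
proof -
  obtain k i j where uv: "u = alt_word k i j" "v = alt_word k j i" "i \<in> {1..n}" "j \<in> {1..n}" "i \<noteq> j"
    "bond (cox b n) i j = enat k"
    using assms(1) by (auto simp: braid_relations_def)
  have main: "P (alt_word k i j) (alt_word k j i)"
    if *: "i \<in> {1..n}" "j \<in> {1..n}" "i < j" "bond (cox b n) i j = enat k" for i j
  proof -
    consider "i + 2 \<le> j" | "j = Suc i" "b \<Longrightarrow> j < n" | "j = Suc i" "b" "j = n"
      using * by fastforce
    then show ?thesis
    proof cases
      case 1
      then have "{i, j} \<noteq> {n - 1, n}" using * by (auto simp: doubleton_eq_iff)
      then have "k = 2" using 1 *
        by (auto simp: cox_def cox_A_def cox_B_def numeral_eq_enat split: if_splits)
      then show ?thesis using 1 * assms(2)[of i j] by simp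
    next
      case 2
      then have "b \<Longrightarrow> {i, j} \<noteq> {n - 1, n}" using * by (auto simp: doubleton_eq_iff)
      then have "k = 3" using 2 *
        by (auto simp: cox_def cox_A_def cox_B_def numeral_eq_enat split: if_splits)
      then show ?thesis using 2 * assms(3)[of i] by simp
    next
      case 3
      then have "k = 4" using *
        by (auto simp: cox_def cox_A_def cox_B_def numeral_eq_enat split: if_splits)
      then show ?thesis using 3 * assms(4)[of i] by simp
    qed
  qed
  have "bond (cox b n) j i = bond (cox b n) i j"
    by (auto simp: cox_def cox_A_def cox_B_def insert_commute)
  then show ?thesis using main[of i j] main[of j i] uv sym by (metis linorder_neqE_nat)
qed

text \<open>In a relation of length 3 each pair among the three strands crosses once on either side;
  in a commutation the same two pairs cross.\<close>

lemma pos_cross_braid_A: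
  assumes "braid_eq (cox_A n) u v"
  shows "pos u = pos v" "cross u = cross v"
proof -
  have "(pos u, cross u) = (pos v, cross v)"
    using assms
  proof (rule pres_cong_invariant)
    fix a b u v assume "(u, v) \<in> braid_relations (cox_A n)"
    then have "(u, v) \<in> braid_relations (cox False n)" by (simp add: cox_def)
    then have "(\<forall>y. pos u y = pos v y) \<and> (\<forall>y z. cross u y z = cross v y z)"
      by (rule braid_relations_cox_cases) (auto simp: tr_def crossing_def)
    then show "(pos (a @ u @ b), cross (a @ u @ b)) = (pos (a @ v @ b), cross (a @ v @ b))"
      by (auto simp: fun_eq_iff)
  qed
  then show "pos u = pos v" "cross u = cross v" by auto
qed

section \<open>Normal forms\<close>

function path :: "bool \<Rightarrow> nat \<Rightarrow> nat set \<Rightarrow> nat \<Rightarrow> nat list" where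
  "path b n J x =
     (if x \<in> J \<and> x \<le> n
      then x # path b n J (Suc x) @ (if b \<and> x < n \<and> {x..n} \<subseteq> J then [x] else [])
      else [])"
  by auto
termination by (relation "measure (\<lambda>(b, n, J, x). Suc n - x)") auto

declare path.simps [simp del]

text \<open>\<open>path\<close> is the longest minimal coset representative for adding the letter \<open>x\<close> to the letters of \<open>J\<close>
  above \<open>x\<close>; in type B it is \<open>x \<dots> n \<dots> x\<close> if \<open>J\<close> contains all of \<open>{x..n}\<close> and \<open>x \<dots> h\<close> otherwise. Normal forms
  are products of prefixes of paths, and \<open>delta\<close> is the longest of them.\<close>

function delta :: "bool \<Rightarrow> nat \<Rightarrow> nat set \<Rightarrow> nat \<Rightarrow> nat list" where
  "delta b n J x = (if x \<le> n then delta b n J (Suc x) @ path b n J x else [])"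
  by auto
termination by (relation "measure (\<lambda>(b, n, J, x). Suc n - x)") auto

declare delta.simps [simp del]

lemma set_path: "set (path b n J x) \<subseteq> J \<inter> {x..n}"
proof (induction b n J x rule: path.induct)
  case (1 b n J x)
  show ?case
  proof (cases "x \<in> J \<and> x \<le> n")
    case True
    then have "set (path b n J (Suc x)) \<subseteq> J \<inter> {x..n}" using 1 by fastforce
    then show ?thesis using True by (subst path.simps) auto
  qed (subst path.simps, auto)
qed

lemma set_delta: "set (delta b n J x) \<subseteq> J \<inter> {x..n}"
proof (induction b n J x rule: delta.induct)
  case (1 b n J x)
  show ?case
  proof (cases "x \<le> n")
    case True
    then have "set (delta b n J (Suc x)) \<subseteq> J \<inter> {x..n}" using 1 by fastforce
    then show ?thesis using True set_path[of b n J x] by (subst delta.simps) simp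
  qed (subst delta.simps, simp)
qed

lemma braid_commute_word:
  assumes "i \<in> {1..n}" "set w \<subseteq> {1..n}" "\<And>j. j \<in> set w \<Longrightarrow> i + 2 \<le> j \<or> j + 2 \<le> i"
  shows "braid_eq (cox b n) (i # w) (w @ [i])"
  using assms(2,3)
proof (induction w)
  case Nil
  then show ?case using assms(1) by (auto intro: pres_cong.refl)
next
  case (Cons j w)
  have "braid_eq (cox b n) ([i, j] @ w) ([j, i] @ w)"
    using Cons.prems assms(1) by (intro pres_cong_right braid_commute_adj) auto
  also have "\<dots> = [j] @ i # w" by simp
  also have "braid_eq (cox b n) ([j] @ i # w) ([j] @ w @ [i])"
    using Cons by (intro pres_cong_left) auto
  finally show ?case by simp
qed

lemma path_full_Cons:
  assumes "{x..n} \<subseteq> J" "x < n"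
  shows "path True n J x = x # path True n J (Suc x) @ [x]"
  using assms by (subst path.simps) auto

lemma path_top: "n \<in> J \<Longrightarrow> path b n J n = [n]"
  by (subst path.simps) (simp add: path.simps[of b n J "Suc n"])

text \<open>As a signed permutation the full path negates coordinate \<open>x\<close>, which the
  letters above \<open>x\<close> do not touch. The commutation is needed in the monoid, so it is
  derived from the braid relations by induction on \<open>n - x\<close>.\<close>

lemma path_commute:
  assumes "J \<subseteq> {1..n}" "{x..n} \<subseteq> J" "x < i" "i \<le> n" "1 \<le> x"
  shows "braid_eq (cox True n) (path True n J x @ [i]) (i # path True n J x)"
proof -
  have "\<forall>x. n = x + d \<longrightarrow> 1 \<le> x \<longrightarrow> {x..n} \<subseteq> J \<longrightarrow> x < i \<longrightarrow>
      braid_eq (cox True n) (path True n J x @ [i]) (i # path True n J x)" for d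
  proof (induction d)
    case (Suc d)
    show ?case
    proof (intro allI impI)
      fix x assume x: "n = x + Suc d" "1 \<le> x" "{x..n} \<subseteq> J" "x < i"
      let ?P = "path True n J"
      let ?c = "braid_eq (cox True n)"
      have J: "{Suc x..n} \<subseteq> J" "{Suc (Suc x)..n} \<subseteq> J" using x by auto
      have eq: "?P x = x # ?P (Suc x) @ [x]" using x by (intro path_full_Cons) auto
      have P1: "set (?P (Suc x)) \<subseteq> {1..n}" using set_path[of True n J "Suc x"] by auto
      have i: "i \<in> {1..n}" "x \<in> {1..n}" using assms(4) x by auto
      show "?c (?P x @ [i]) (i # ?P x)"
      proof (cases "i = Suc x")
        case False
        then have ix: "i \<ge> x + 2" using x by auto
        have "?c ((x # ?P (Suc x)) @ [x, i]) ((x # ?P (Suc x)) @ [i, x])"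
          using i ix P1 by (intro pres_cong_left braid_commute_adj) auto
        also have "\<dots> = [x] @ (?P (Suc x) @ [i]) @ [x]" by simp
  also have "?c ([x] @ (?P (Suc x) @ [i]) @ [x]) ([x] @ (i # ?P (Suc x)) @ [x])"
          using Suc.IH[rule_format, of "Suc x"] x ix i J by (intro pres_cong_ctxt) auto
        also have "\<dots> = [x, i] @ ?P (Suc x) @ [x]" by simp
  also have "?c ([x, i] @ ?P (Suc x) @ [x]) ([i, x] @ ?P (Suc x) @ [x])"
          using i ix P1 by (intro pres_cong_right braid_commute_adj) auto
        finally show ?thesis by (simp add: eq)
      next
        case True
        show ?thesis
        proof (cases "i = n")
          case True
          then have "?P (Suc x) = [i]" using \<open>i = Suc x\<close> J by (auto intro!: path_top)
          then show ?thesis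
            using braid_four[of True x n] \<open>i = Suc x\<close> True x(2) unfolding eq by simp
        next
          case False
          then have lt: "Suc x < n" using i True by auto
          let ?Q = "?P (Suc (Suc x))"
          have eq': "?P (Suc x) = i # ?Q @ [i]" using lt J True by (subst path_full_Cons) auto
          have Q: "set ?Q \<subseteq> {Suc (Suc x)..n}" using set_path[of True n J "Suc (Suc x)"] by auto
          then have Q': "set ?Q \<subseteq> {1..n}" by auto
          \<comment> \<open>The letters of \<open>?Q\<close> are at least \<open>x + 2\<close>, so
            \<open>x\<close> passes through; then the relation of length 3 between \<open>x\<close>
            and \<open>i = x + 1\<close> applies on either side of \<open>?Q\<close>.\<close>
          have c: "?c (x # ?Q) (?Q @ [x])"
            using Q' Q i by (intro braid_commute_word) auto
          have b3: "?c [x, i, x] [i, x, i]" using braid_three[of x n True] lt True x by auto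
          have "?c ((x # i # ?Q) @ [i, x, i]) ((x # i # ?Q) @ [x, i, x])"
            using Q' i pres_cong.sym[OF b3] by (intro pres_cong_left) auto
          also have "\<dots> = [x, i] @ (?Q @ [x]) @ [i, x]" by simp
  also have "?c ([x, i] @ (?Q @ [x]) @ [i, x]) ([x, i] @ (x # ?Q) @ [i, x])"
            using Q' i pres_cong.sym[OF c] by (intro pres_cong_ctxt) auto
          also have "\<dots> = [x, i, x] @ ?Q @ [i, x]" by simp
  also have "?c ([x, i, x] @ ?Q @ [i, x]) ([i, x, i] @ ?Q @ [i, x])"
            using Q' i b3 by (intro pres_cong_right) auto
          finally show ?thesis by (simp add: eq eq')
        qed
      qed
    qed
  qed (use assms(4) in auto)
  from this[of "n - x"] show ?thesis using assms by auto
qed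

text \<open>Deodhar's lemma for the coset representatives given by prefixes: multiplying by a letter
  lengthens the prefix, shortens it, or amounts to a letter above \<open>x\<close> acting from the
  left. The shortening case shows up as a repeated last letter, since nothing cancels in the
  monoid.\<close>

lemma path_prefix_step:
  assumes "J \<subseteq> {1..n}" "1 \<le> x" "prefix p (path b n J x)" "i \<in> J" "x \<le> i"
  shows "prefix (p @ [i]) (path b n J x) \<or> (\<exists>a. p = a @ [i]) \<or>
    (\<exists>i'\<in>J. x < i' \<and> braid_eq (cox b n) (p @ [i]) (i' # p))"
  using assms
proof (induction b n J x arbitrary: p rule: path.induct)
  case (1 b n J x)
  let ?P = "path b n J"
  let ?c = "braid_eq (cox b n)"
  have i: "i \<in> {1..n}" using 1 by auto
  show ?case
  proof (cases "p = []")
    case True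
    show ?thesis
    proof (cases "i = x")
      case True
      then have "prefix [i] (?P x)" using 1 i by (subst path.simps) auto
      then show ?thesis using \<open>p = []\<close> by simp
    next
      case False
      moreover have "?c [i] [i]" using i by (intro pres_cong.refl) auto
      ultimately show ?thesis using \<open>p = []\<close> 1(6) 1(5) by auto
    qed
  next
    case False
    then have x: "x \<in> J" "x \<le> n" using 1(4) by (auto simp: path.simps[of b n J x] split: if_splits)
    define t where "t = (if b \<and> x < n \<and> {x..n} \<subseteq> J then [x] else [])"
    have Px: "?P x = x # ?P (Suc x) @ t" using x unfolding t_def by (subst path.simps) auto
    have P1: "set (?P (Suc x)) \<subseteq> {1..n}" "set (?P (Suc x)) \<subseteq> {Suc x..n}"
      using set_path[of b n J "Suc x"] by auto
    obtain p' where p: "p = x # p'" "prefix p' (?P (Suc x) @ t)"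
      using False 1(4) by (auto simp: Px prefix_Cons)
    consider "p' = ?P (Suc x) @ [x]" "t = [x]" | "prefix p' (?P (Suc x))"
      using p(2) unfolding t_def by (auto split: if_splits simp: prefix_append prefix_Cons)
    then show ?thesis
    proof cases
      case 1
      then have full: "b" "{x..n} \<subseteq> J" "x < n" unfolding t_def by (auto split: if_splits)
      show ?thesis
      proof (cases "i = x")
        case False
        have "?c (?P x @ [i]) (i # ?P x)"
          using path_commute[of J n x i] False "1.prems" full i by (cases b) auto
        moreover have "x < i" using False "1.prems" by simp
        ultimately show ?thesis using 1 p Px "1.prems"(4) by metis
      qed (use 1 p in auto)
    next
      case 2
      have p'1: "set p' \<subseteq> {1..n}" "set p' \<subseteq> {Suc x..n}"
        using set_mono_prefix[OF 2] P1 by auto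
      show ?thesis
      proof (cases "i = x")
        case False
        from "1.IH"[OF _ _ _ 2] x False "1.prems"
        consider "prefix (p' @ [i]) (?P (Suc x))" | a where "p' = a @ [i]"
          | i' where "i' \<in> J" "Suc x < i'" "?c (p' @ [i]) (i' # p')"
          by fastforce
        then show ?thesis
        proof cases
          case 1
          then show ?thesis by (auto simp: p Px prefix_append)
        next
          case 2
          then show ?thesis by (auto simp: p)
        next
          case 3
          have i': "i' \<in> {1..n}" using 3 "1.prems" by auto
          have "?c ([x] @ p' @ [i]) ([x] @ i' # p')" using 3 x "1.prems" by (intro pres_cong_left) auto
          also have "\<dots> = [x, i'] @ p'" by simp
  also have "?c ([x, i'] @ p') ([i', x] @ p')"
            using 3 x i' p'1 "1.prems" by (intro pres_cong_right braid_commute_adj) auto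
          finally have "?c (p @ [i]) (i' # p)" by (simp add: p)
          then show ?thesis using 3 by auto
        qed
      next
        case True
        show ?thesis
        proof (cases "p' = []")
          case True
          then show ?thesis using \<open>i = x\<close> p by auto
        next
          case False
          then have Sx: "Suc x \<in> J" "Suc x \<le> n"
            using 2 by (auto simp: path.simps[of b n J "Suc x"] split: if_splits)
          define s where "s = (if b \<and> Suc x < n \<and> {Suc x..n} \<subseteq> J then [Suc x] else [])"
          have PSx: "?P (Suc x) = Suc x # ?P (Suc (Suc x)) @ s"
            using Sx unfolding s_def by (subst path.simps) auto
          obtain p'' where p'': "p' = Suc x # p''" "prefix p'' (?P (Suc (Suc x)) @ s)"
            using False 2 by (auto simp: PSx prefix_Cons)
          show ?thesis
          proof (cases "b \<and> p' = ?P (Suc x) \<and> {x..n} \<subseteq> J")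
            case True
            \<comment> \<open>Here \<open>p\<close> lacks only the final letter \<open>x\<close> of
              a full path, so appending \<open>x\<close> completes it.\<close>
            then have "t = [x]" using Sx unfolding t_def by auto
            then have "p @ [i] = ?P x" unfolding Px p using True \<open>i = x\<close> by (metis append_Cons append_assoc)
            then show ?thesis by simp
          next
            case nfull: False
            \<comment> \<open>The relation of length 4 could matter only for
              \<open>x + 1 = n\<close>, and then \<open>p\<close> would be the exceptional prefix
              just treated.\<close>
            have nb: "b \<Longrightarrow> Suc x < n"
            proof (rule ccontr)
              assume b: "b" "\<not> Suc x < n"
              then have "Suc x = n" using Sx by auto
              then have "?P (Suc x) = [Suc x]" using Sx path_top by auto
              then have "p' = ?P (Suc x)" using p'' 2 by (auto simp: prefix_Cons)
              moreover have "{x..n} \<subseteq> J" using x Sx \<open>Suc x = n\<close> by (auto simp: le_Suc_eq)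
              ultimately show False using nfull b by auto
            qed
            \<comment> \<open>If \<open>p''\<close> contained the second letter \<open>x + 1\<close>
              of a full path, \<open>p\<close> would again be exceptional. So its letters are at
              least \<open>x + 2\<close> and commute with \<open>x\<close>.\<close>
            have "prefix p'' (?P (Suc (Suc x)))"
            proof (cases "s = []")
              case False
              then have "p'' \<noteq> ?P (Suc (Suc x)) @ s"
                using nfull x Sx PSx p'' unfolding s_def
                by (auto split: if_splits simp: atLeastAtMost_insertL[symmetric, of x])
              then show ?thesis using p'' False unfolding s_def
                by (auto split: if_splits simp: prefix_append prefix_Cons)
            qed (use p'' in auto)
            then have Q: "set p'' \<subseteq> {Suc (Suc x)..n}" "set p'' \<subseteq> {1..n}"
              using set_mono_prefix[of p'' "?P (Suc (Suc x))"] set_path[of b n J "Suc (Suc x)"] by auto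
            have c: "?c (x # p'') (p'' @ [x])"
              using Q x "1.prems" by (intro braid_commute_word) auto
            have "?c ([x, Suc x] @ p'' @ [x]) ([x, Suc x] @ x # p'')"
              using pres_cong.sym[OF c] x Sx "1.prems" by (intro pres_cong_left) auto
            also have "\<dots> = [x, Suc x, x] @ p''" by simp
  also have "?c ([x, Suc x, x] @ p'') ([Suc x, x, Suc x] @ p'')"
              using braid_three[of x n b] nb Q x Sx "1.prems" by (intro pres_cong_right) auto
            finally have "?c (p @ [i]) (Suc x # p)" using True by (simp add: p p'')
            then show ?thesis using Sx by auto
          qed
        qed
      qed
    qed
  qed
qed

inductive nf :: "bool \<Rightarrow> nat \<Rightarrow> nat set \<Rightarrow> nat \<Rightarrow> nat list \<Rightarrow> bool" for b n J where
  nf_Nil: "nf b n J (Suc n) []"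
| nf_append: "nf b n J (Suc x) v \<Longrightarrow> x \<le> n \<Longrightarrow> 1 \<le> x \<Longrightarrow> prefix p (path b n J x) \<Longrightarrow> nf b n J x (v @ p)"

text \<open>Squares cannot be removed in the monoid, so the rewriting admits them as an alternative
  outcome; they cancel only in the Coxeter group.\<close>

definition has_square :: "'a list \<Rightarrow> bool" where
  "has_square w \<longleftrightarrow> (\<exists>a j c. w = a @ [j, j] @ c)"

lemma has_square_append: "has_square u \<or> has_square v \<Longrightarrow> has_square (u @ v)"
  unfolding has_square_def by (metis append.assoc)

lemma set_nf: "nf b n J x v \<Longrightarrow> set v \<subseteq> J \<inter> {x..n}"
proof (induction rule: nf.induct)
  case (nf_append x v p)
  then show ?case using set_mono_prefix[of p "path b n J x"] set_path[of b n J x] by auto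
qed simp

text \<open>A prefix of full length is the whole path. The uniqueness clause later pins down the
  element of maximal length.\<close>

lemma nf_length:
  "nf b n J x v \<Longrightarrow> length v \<le> length (delta b n J x) \<and>
    (length v = length (delta b n J x) \<longrightarrow> v = delta b n J x)"
proof (induction rule: nf.induct)
  case nf_Nil
  then show ?case by (simp add: delta.simps)
next
  case (nf_append x v p)
  have "length p \<le> length (path b n J x)" using nf_append by (simp add: prefix_length_le)
  moreover have "length p = length (path b n J x) \<Longrightarrow> p = path b n J x"
    using nf_append by (auto simp: prefix_def)
  ultimately show ?case using nf_append by (subst (1 2 3) delta.simps) auto
qed

text \<open>In the third case of \<open>path_prefix_step\<close> the letter passes to the left of
  \<open>p\<close>, where the induction hypothesis absorbs it into the factor over the letters above
  \<open>x\<close>.\<close>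

lemma nf_step:
  assumes "nf b n J x v" "J \<subseteq> {1..n}" "i \<in> J" "x \<le> i"
  shows "\<exists>w. braid_eq (cox b n) (v @ [i]) w \<and> (nf b n J x w \<or> has_square w)"
  using assms
proof (induction arbitrary: i rule: nf.induct)
  case nf_Nil
  then show ?case by auto
next
  case (nf_append x v p)
  let ?c = "braid_eq (cox b n)"
  have v: "set v \<subseteq> {1..n}" using set_nf[OF nf_append(1)] by auto
  have p: "set p \<subseteq> {1..n}" using set_mono_prefix[OF nf_append(4)] set_path[of b n J x] nf_append by auto
  have i: "i \<in> {1..n}" using nf_append by auto
  have refl: "?c ((v @ p) @ [i]) ((v @ p) @ [i])" using v p i by (intro pres_cong.refl) auto
  from path_prefix_step[OF nf_append(6,3,4) nf_append(7,8)]
  consider "prefix (p @ [i]) (path b n J x)" | a where "p = a @ [i]"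
    | i' where "i' \<in> J" "x < i'" "?c (p @ [i]) (i' # p)" by blast
  then show ?case
  proof cases
    case 1
    then have "nf b n J x (v @ p @ [i])" using nf_append by (intro nf.nf_append) auto
    then show ?thesis using refl by auto
  next
    case (2 a)
    then have "(v @ p) @ [i] = (v @ a) @ [i, i] @ []" by simp
    then have "has_square ((v @ p) @ [i])" unfolding has_square_def by blast
    then show ?thesis using refl by blast
  next
    case (3 i')
    obtain w where w: "?c (v @ [i']) w" "nf b n J (Suc x) w \<or> has_square w"
      using nf_append.IH[of i'] nf_append.prems 3 by auto
    have "?c (v @ p @ [i]) (v @ i' # p)" using 3 v by (intro pres_cong_left) auto
    also have "\<dots> = (v @ [i']) @ p" by simp
  also have "?c ((v @ [i']) @ p) (w @ p)" using w p by (intro pres_cong_right) auto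
    finally have "?c ((v @ p) @ [i]) (w @ p)" by simp
    moreover have "nf b n J x (w @ p) \<or> has_square (w @ p)"
      using w nf_append has_square_append by (auto intro: nf.nf_append)
    ultimately show ?thesis by blast
  qed
qed

lemma nf_Nil_ex: "1 \<le> x \<Longrightarrow> x \<le> Suc n \<Longrightarrow> nf b n J x []"
proof (induction "Suc n - x" arbitrary: x)
  case 0
  then have "x = Suc n" by simp
  then show ?case by (simp add: nf_Nil)
next
  case (Suc d)
  then have "nf b n J (Suc x) []" by simp
  from nf.nf_append[OF this, of "[]"] Suc show ?case by simp
qed

lemma word_nf:
  assumes "J \<subseteq> {1..n}" "set u \<subseteq> J"
  shows "\<exists>w. braid_eq (cox b n) u w \<and> (nf b n J 1 w \<or> has_square w)"
  using assms(2)
proof (induction u rule: rev_induct)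
  case Nil
  then show ?case using nf_Nil_ex[of 1 n b J] pres_cong.refl[of "[]"] by auto
next
  case (snoc i u)
  let ?c = "braid_eq (cox b n)"
  have i: "set [i] \<subseteq> {1..n}" using snoc assms by auto
  obtain w where w: "?c u w" "nf b n J 1 w \<or> has_square w" using snoc by auto
  have c: "?c (u @ [i]) (w @ [i])" using pres_cong_right[OF w(1)] i by simp
  show ?case
  proof (cases "nf b n J 1 w")
    case True
    then obtain w' where "?c (w @ [i]) w'" "nf b n J 1 w' \<or> has_square w'"
      using nf_step[OF True assms(1), of i] snoc.prems i by auto
    then show ?thesis using c pres_cong.trans by blast
  next
    case False
    then have "has_square (w @ [i])" using w has_square_append by blast
    then show ?thesis using c by blast
  qed
qed

lemma braid_eq_set:
  assumes "braid_eq (cox b n) u v"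
  shows "set u = set v" "length u = length v"
proof -
  have "(set u, length u) = (set v, length v)"
    using assms
  proof (rule pres_cong_invariant)
    fix a c u v assume "(u, v) \<in> braid_relations (cox b n)"
    then have "set u = set v \<and> length u = length v"
      by (rule braid_relations_cox_cases) auto
    then show "(set (a @ u @ c), length (a @ u @ c)) = (set (a @ v @ c), length (a @ v @ c))" by simp
  qed
  then show "set u = set v" "length u = length v" by auto
qed

lemma square_cox_shorter:
  assumes "has_square w" "set w \<subseteq> nodes M"
  shows "\<exists>w'. cox_eq M w w' \<and> length w' < length w \<and> set w' \<subseteq> set w"
proof -
  obtain a j c where w: "w = a @ [j, j] @ c" using assms by (auto simp: has_square_def)
  have "cox_eq M (a @ [j, j] @ c) (a @ [] @ c)"
    using assms w by (intro pres_cong_ctxt cox_eq_square) auto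
  then show ?thesis using w by (intro exI[of _ "a @ c"]) auto
qed

text \<open>Cancelling a square shortens the word, hence the induction on its length.\<close>

lemma cox_nf:
  assumes "J \<subseteq> {1..n}" "set u \<subseteq> J"
  shows "\<exists>w. cox_eq (cox b n) u w \<and> nf b n J 1 w"
  using assms(2)
proof (induction u rule: length_induct)
  case (1 u)
  obtain w where w: "braid_eq (cox b n) u w" "nf b n J 1 w \<or> has_square w"
    using word_nf[OF assms(1) 1(2)] by blast
  then have uw: "cox_eq (cox b n) u w" by (intro braid_imp_cox)
  show ?case
  proof (cases "nf b n J 1 w")
    case False
    then have "has_square w" using w by auto
    moreover have sub: "set w \<subseteq> nodes (cox b n)" "set w \<subseteq> J" "length w = length u"
      using braid_eq_set[OF w(1)] 1(2) assms(1) by auto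
    ultimately obtain w' where w': "cox_eq (cox b n) w w'" "length w' < length w" "set w' \<subseteq> set w"
      using square_cox_shorter[of w "cox b n"] sub by auto
    then obtain z where "cox_eq (cox b n) w' z" "nf b n J 1 z"
      using 1(1) sub w' by (metis order_trans)
    then show ?thesis using uw w'(1) pres_cong.trans by metis
  qed (use uw in auto)
qed

section \<open>Crossings of the words delta\<close>

text \<open>\<open>y\<close> and \<open>z\<close> are strands, the elements of \<open>J\<close> are
  letters; the relation says that no wall separates the two strands, that is, they lie in the same
  block.\<close>

definition sim :: "nat set \<Rightarrow> nat \<Rightarrow> nat \<Rightarrow> bool" where
  "sim J y z \<longleftrightarrow> {min y z..<max y z} \<subseteq> J"

text \<open>The last strand in the block of \<open>y\<close>: its number is that of the first
  missing letter, the wall that ends the block.\<close>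

definition hi :: "nat set \<Rightarrow> nat \<Rightarrow> nat" where
  "hi J y = (LEAST z. y \<le> z \<and> z \<notin> J)"

lemma hi_props:
  assumes "finite J"
  shows "y \<le> hi J y" "hi J y \<notin> J" "{y..<hi J y} \<subseteq> J"
proof -
  have "\<exists>z. y \<le> z \<and> z \<notin> J"
  proof (rule ccontr)
    assume "\<not> ?thesis"
    then have "{y..} \<subseteq> J" by auto
    then show False using assms infinite_Ici finite_subset by blast
  qed
  then have "y \<le> hi J y \<and> hi J y \<notin> J" unfolding hi_def by (rule LeastI_ex)
  then show "y \<le> hi J y" "hi J y \<notin> J" by auto
  show "{y..<hi J y} \<subseteq> J" unfolding hi_def using not_less_Least by fastforce
qed

lemma hi_eqI: "y \<le> z \<Longrightarrow> z \<notin> J \<Longrightarrow> {y..<z} \<subseteq> J \<Longrightarrow> hi J y = z"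
  unfolding hi_def by (rule Least_equality) (auto simp: subset_eq not_less[symmetric])

lemma sim_commute: "sim J y z \<longleftrightarrow> sim J z y"
  by (simp add: sim_def min.commute max.commute)

lemma sim_self [simp]: "sim J y y"
  by (simp add: sim_def)

lemma sim_le: "y \<le> z \<Longrightarrow> sim J y z \<longleftrightarrow> {y..<z} \<subseteq> J"
  by (simp add: sim_def min_def max_def)

text \<open>A new lowest letter joins strand \<open>x\<close> to the block \<open>x + 1..h\<close>;
  the new pairs are those on which \<open>up_cross x h\<close> is 1.\<close>

lemma sim_insert_low:
  assumes "J \<subseteq> {x<..}" "{Suc x..<h} \<subseteq> J" "h \<notin> J" "x < h" "y \<noteq> z"
  shows "sim (insert x J) y z \<longleftrightarrow> sim J y z \<or> y = x \<and> x < z \<and> z \<le> h \<or> z = x \<and> x < y \<and> y \<le> h"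
proof -
  have *: "sim (insert x J) y z \<longleftrightarrow> sim J y z \<or> y = x \<and> z \<le> h" if "y < z" for y z
  proof
    assume "sim (insert x J) y z"
    then have s: "{y..<z} \<subseteq> insert x J" using that by (simp add: sim_le)
    show "sim J y z \<or> y = x \<and> z \<le> h"
    proof (cases "x \<in> {y..<z}")
      case True
      then have "y = x" using s assms(1) by (metis atLeastLessThan_iff greaterThan_iff insertE
            leD le_less order_refl subsetD that)
      moreover have "z \<le> h"
      proof (rule ccontr)
        assume "\<not> z \<le> h"
        then have "h \<in> {y..<z}" using True assms(4) by auto
        then show False using s assms(3,4) by auto
      qed
      ultimately show ?thesis by simp
    next
      case False
      then show ?thesis using s that by (auto simp: sim_le)
    qed
  next
    assume "sim J y z \<or> y = x \<and> z \<le> h"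
    moreover have "{x..<z} \<subseteq> insert x J" if "z \<le> h"
    proof
      fix i assume "i \<in> {x..<z}"
      then have "i = x \<or> i \<in> {Suc x..<h}" using that by auto
      then show "i \<in> insert x J" using assms(2) by blast
    qed
    ultimately show "sim (insert x J) y z" using that by (auto simp: sim_le)
  qed
  show ?thesis using *[of y z] *[of z y] assms(5) by (cases "y < z") (auto simp: sim_commute)
qed

lemma sim_insert_high:
  assumes "J \<subseteq> {..<e}" "{Suc g..<e} \<subseteq> J" "g \<notin> J" "g < e" "y \<noteq> z"
  shows "sim (insert e J) y z \<longleftrightarrow> sim J y z \<or> y = Suc e \<and> g < z \<and> z \<le> e \<or> z = Suc e \<and> g < y \<and> y \<le> e"
proof -
  have *: "sim (insert e J) y z \<longleftrightarrow> sim J y z \<or> z = Suc e \<and> g < y" if "y < z" for y z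
  proof
    assume "sim (insert e J) y z"
    then have s: "{y..<z} \<subseteq> insert e J" using that by (simp add: sim_le)
    show "sim J y z \<or> z = Suc e \<and> g < y"
    proof (cases "e \<in> {y..<z}")
      case True
      have "\<not> Suc e < z"
      proof
        assume "Suc e < z"
        then have "Suc e \<in> {y..<z}" using True by auto
        then have "Suc e \<in> insert e J" using s by blast
        then show False using assms(1) by auto
      qed
      then have "z = Suc e" using True by auto
      moreover have "g < y"
      proof (rule ccontr)
        assume "\<not> g < y"
        then have "g \<in> {y..<z}" using True assms(4) by auto
        then show False using s assms(3,4) by auto
      qed
      ultimately show ?thesis by simp
    next
      case False
      then show ?thesis using s that by (auto simp: sim_le)
    qed
  next
    assume "sim J y z \<or> z = Suc e \<and> g < y"
    moreover have "{y..<Suc e} \<subseteq> insert e J" if "g < y"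
    proof
      fix i assume "i \<in> {y..<Suc e}"
      then have "i = e \<or> i \<in> {Suc g..<e}" using that by auto
      then show "i \<in> insert e J" using assms(2) by blast
    qed
    ultimately show "sim (insert e J) y z" using that by (auto simp: sim_le)
  qed
  show ?thesis using *[of y z] *[of z y] assms(5) by (cases "y < z") (auto simp: sim_commute)
qed

lemma path_upt:
  assumes "J \<subseteq> {1..n}" "x \<le> Suc n" "b \<Longrightarrow> \<not> {x..n} \<subseteq> J"
  shows "path b n J x = [x..<hi J x]"
  using assms
proof (induction b n J x rule: path.induct)
  case (1 b n J x)
  have f: "finite J" using 1 finite_subset by blast
  show ?case
  proof (cases "x \<in> J \<and> x \<le> n")
    case True
    have "hi J x = hi J (Suc x)"
      using hi_props[OF f, of "Suc x"] True
      by (intro hi_eqI) (auto simp: subset_eq, metis Suc_leI atLeastLessThan_iff le_neq_implies_less)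
    moreover have "b \<Longrightarrow> \<not> {Suc x..n} \<subseteq> J"
      using 1(4) True by (auto simp: atLeastAtMost_insertL[symmetric, of x])
    then have "path b n J (Suc x) = [Suc x..<hi J (Suc x)]" using 1 True by auto
    moreover have "x < hi J (Suc x)" using hi_props(1)[OF f, of "Suc x"] by simp
    ultimately show ?thesis using True 1(4) by (subst path.simps) (auto simp: upt_conv_Cons)
  next
    case False
    then have "x \<notin> J" using 1 by auto
    moreover have "hi J x = x" using \<open>x \<notin> J\<close> by (intro hi_eqI) auto
    ultimately show ?thesis by (subst path.simps) simp
  qed
qed

text \<open>The crossing numbers of the ascending word \<open>x, ..., h - 1\<close>, which carries
  strand \<open>x\<close> past all strands up to \<open>h\<close>.\<close>

definition up_cross :: "nat \<Rightarrow> nat \<Rightarrow> nat \<Rightarrow> nat \<Rightarrow> nat" where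
  "up_cross x h y z = (if y = x \<and> x < z \<and> z \<le> h \<or> z = x \<and> x < y \<and> y \<le> h then 1 else 0)"

lemma cross_upt: "x \<le> h \<Longrightarrow> cross [x..<h] y z = up_cross x h y z"
proof (induction "h - x" arbitrary: x y z)
  case 0
  then show ?case by (simp add: up_cross_def)
next
  case (Suc d)
  have xh: "x < h" using Suc(2) by simp
  have "cross [Suc x..<h] (tr x y) (tr x z) = up_cross (Suc x) h (tr x y) (tr x z)"
    using Suc(2) by (intro Suc(1)) auto
  then have "cross [x..<h] y z = crossing x y z + up_cross (Suc x) h (tr x y) (tr x z)"
    using xh by (simp add: upt_conv_Cons)
  also have "\<dots> = up_cross x h y z"
    using xh by (cases "y = x"; cases "z = x") (auto simp: up_cross_def crossing_def tr_def)
  finally show ?case .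
qed

text \<open>The word for the letters above \<open>x\<close> fixes strand \<open>x\<close> and
  permutes the strands \<open>x + 1..h\<close> among themselves. The path appended for
  \<open>x\<close> therefore adds one crossing of strand \<open>x\<close> with each of these, and
  they are exactly the pairs that the letter \<open>x\<close> adds to \<open>sim\<close>.\<close>

lemma cross_delta_A:
  assumes J: "J \<subseteq> {1..n}" and yz: "y \<noteq> z" and x: "1 \<le> x" "x \<le> Suc n"
  shows "cross (delta False n J x) y z = (if sim (J \<inter> {x..}) y z then 1 else 0)"
  using x
proof (induction "Suc n - x" arbitrary: x)
  case 0
  then have "J \<inter> {x..} = {}" using J by auto
  moreover have "\<not> sim {} y z" using yz by (auto simp: sim_def)
  ultimately show ?case using 0 by (simp add: delta.simps[of False n J x])
next
  case (Suc d)
  have f: "finite J" using J finite_subset by blast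
  let ?h = "hi J x"
  let ?D = "delta False n J (Suc x)"
  have "x \<le> n" using Suc(2) by simp
  then have D: "delta False n J x = ?D @ [x..<?h]"
    using J by (subst delta.simps) (simp add: path_upt)
  have sD: "set ?D \<subseteq> J \<inter> {Suc x..n}" by (rule set_delta)
  have sD': "Suc x \<le> i" if "i \<in> set ?D" for i using subsetD[OF sD that] by simp
  have xD: "x \<notin> set ?D" using sD'[of x] by auto
  have "pos ?D x = x"
  proof (rule pos_outside)
    fix i assume "i \<in> set ?D"
    then show "x \<noteq> i \<and> x \<noteq> Suc i" using sD'[of i] by auto
  qed
  then have px: "pos ?D w = x \<longleftrightarrow> w = x" for w
    using pos_eq_iff[of ?D w x] by simp
  have less: "x < pos ?D w \<longleftrightarrow> x < w" for w
    using cross_no_letter(3)[OF xD, of x w] cross_no_letter(2)[OF xD, of w "Suc x"]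
    by (cases "x < w") auto
  have h: "?h \<notin> set ?D" using hi_props(2)[OF f, of x] sD by auto
  have le: "pos ?D w \<le> ?h \<longleftrightarrow> w \<le> ?h" for w
    using cross_no_letter(2)[OF h, of w "Suc ?h"] cross_no_letter(3)[OF h, of ?h w]
    by (cases "w \<le> ?h") auto
  have up: "up_cross x ?h (pos ?D y) (pos ?D z) = up_cross x ?h y z"
    by (simp add: up_cross_def px less le)
  have IH: "cross ?D y z = (if sim (J \<inter> {Suc x..}) y z then 1 else 0)"
    using Suc(2) by (intro Suc(1)) auto
  have eq: "cross (delta False n J x) y z = cross ?D y z + up_cross x ?h y z"
    using hi_props(1)[OF f, of x] by (simp add: D cross_upt up)
  have "x \<le> t \<longleftrightarrow> t = x \<or> Suc x \<le> t" for t by arith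
  then have at: "{x..} = insert x {Suc x..}" by (simp add: set_eq_iff)
  show ?case
  proof (cases "x \<in> J")
    case True
    then have ins: "J \<inter> {x..} = insert x (J \<inter> {Suc x..})" unfolding at by simp
    have "x \<noteq> ?h" using hi_props(2)[OF f, of x] True by metis
    then have xh: "x < ?h" using hi_props(1)[OF f, of x] by simp
    have sub: "{Suc x..<?h} \<subseteq> J \<inter> {Suc x..}" using hi_props(3)[OF f, of x] by auto
    have s: "sim (J \<inter> {x..}) y z \<longleftrightarrow> sim (J \<inter> {Suc x..}) y z \<or> y = x \<and> x < z \<and> z \<le> ?h \<or> z = x \<and> x < y \<and> y \<le> ?h"
      unfolding ins using hi_props(2)[OF f, of x] by (intro sim_insert_low sub xh yz) auto
    have "\<not> sim (J \<inter> {Suc x..}) y z" if "y = x \<and> x < z \<or> z = x \<and> x < y"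
    proof
      assume "sim (J \<inter> {Suc x..}) y z"
      moreover have "x \<in> {min y z..<max y z}" using that by auto
      ultimately show False unfolding sim_def by (metis IntD2 atLeast_iff not_less_eq_eq order_refl subsetD)
    qed
    then show ?thesis using IH s unfolding eq up_cross_def
      by (cases "sim (J \<inter> {Suc x..}) y z") auto
  next
    case False
    then have "J \<inter> {x..} = J \<inter> {Suc x..}" unfolding at by simp
    moreover have "?h = x" using False by (intro hi_eqI) auto
    ultimately have "cross ?D y z = (if sim (J \<inter> {x..}) y z then 1 else 0)" "up_cross x ?h y z = 0"
      using IH by (simp_all add: up_cross_def)
    then show ?thesis unfolding eq by simp
  qed
qed

text \<open>The final position is one more than the number of strands ending further left. These are
  the \<open>p - 1\<close> strands below the block and the \<open>q - y\<close> strands of the block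
  that start above \<open>y\<close>.\<close>

lemma cross_eq_sim_pos:
  assumes u: "set u \<subseteq> {1..n}" and J: "J \<subseteq> {1..n}"
    and c: "\<And>y z. y \<in> {1..Suc n} \<Longrightarrow> z \<in> {1..Suc n} \<Longrightarrow> y \<noteq> z \<Longrightarrow> cross u y z = (if sim J y z then 1 else 0)"
    and pq: "1 \<le> p" "p \<le> y" "y \<le> q" "{p..<q} \<subseteq> J" "p - 1 \<notin> J" "q \<notin> J" "q \<le> Suc n"
  shows "pos u y = p + q - y"
proof -
  let ?S = "{1..Suc n}"
  have y: "y \<in> ?S" using pq by auto
  have img: "pos u ` ?S = ?S"
  proof (rule endo_inj_surj)
    show "pos u ` ?S \<subseteq> ?S" using pos_range[OF u] by blast
  qed (simp_all add: inj_on_def)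
  have less: "pos u z < pos u y \<longleftrightarrow> z \<in> {1..<p} \<union> {y<..q}" if z: "z \<in> ?S" for z
  proof (cases "z = y")
    case False
    then have l: "pos u z < pos u y \<longleftrightarrow> (z < y \<longleftrightarrow> \<not> sim J z y)"
      using pos_less_iff[of z y u] c[OF z y] by auto
    show ?thesis
    proof (cases "z < y")
      case True
      then have "sim J z y \<longleftrightarrow> p \<le> z"
      proof -
        have "sim J z y" if "p \<le> z" using that True pq by (auto simp: sim_le)
        moreover have "\<not> sim J z y" if "z < p"
        proof
          assume "sim J z y"
          moreover have "p - 1 \<in> {z..<y}" using that True pq by auto
          ultimately have "p - 1 \<in> J" using True by (auto simp: sim_le)
          then show False using pq by simp
        qed
        ultimately show ?thesis by (meson not_le)
      qed
      then show ?thesis using l True z by auto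
    next
      case F: False
      then have zy: "y < z" using False by simp
      then have "sim J z y \<longleftrightarrow> z \<le> q"
      proof -
        have "sim J y z" if "z \<le> q" using that zy pq by (auto simp: sim_le)
        moreover have "\<not> sim J y z" if "q < z"
        proof
          assume "sim J y z"
          then have "q \<in> J" using that zy pq by (auto simp: sim_le)
          then show False using pq by simp
        qed
        ultimately show ?thesis by (metis sim_commute not_le)
      qed
      then show ?thesis using l F zy pq by auto
    qed
  qed (use pq in auto)
  have "pos u ` {z \<in> ?S. pos u z < pos u y} = {w \<in> ?S. w < pos u y}"
  proof -
    have "pos u ` {z \<in> ?S. pos u z \<in> T} = pos u ` ?S \<inter> T" for T by auto
    from this[of "{..<pos u y}"] show ?thesis unfolding img by (simp add: Int_def)
  qed
  moreover have "card (pos u ` {z \<in> ?S. pos u z < pos u y}) = card {z \<in> ?S. pos u z < pos u y}"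
    by (rule card_image) (simp add: inj_on_def)
  ultimately have "card {z \<in> ?S. pos u z < pos u y} = card {w \<in> ?S. w < pos u y}" by simp
  moreover have "{z \<in> ?S. pos u z < pos u y} = {1..<p} \<union> {y<..q}"
    using less pq by auto
  moreover have "card ({1..<p} \<union> {y<..q}) = (p - 1) + (q - y)"
    using pq by (subst card_Un_disjoint) auto
  moreover have "{w \<in> ?S. w < pos u y} = {1..<pos u y}"
    using pos_range[OF u y] by auto
  ultimately show ?thesis using pos_range[OF u y] pq by auto
qed

section \<open>Unfolding\<close>

text \<open>The images of the generators under the standard unfolding. The last case is meant for
  \<open>2 * i = n + 1\<close>, the middle letter for odd \<open>n\<close>.\<close>

definition unf :: "nat \<Rightarrow> nat \<Rightarrow> nat list" where
  "unf n i = (if 2 * i < n then [i, n + 1 - i] else if 2 * i = n then [i, Suc i, i] else [i])"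

abbreviation unfold :: "nat \<Rightarrow> nat list \<Rightarrow> nat list" where
  "unfold n u \<equiv> concat (map (unf n) u)"

text \<open>The closure under the mirror, which acts on letters by \<open>i -> n + 1 - i\<close> and
  on strands by \<open>y -> n + 2 - y\<close>.\<close>

definition folded :: "nat \<Rightarrow> nat set \<Rightarrow> nat set" where
  "folded n J = (\<Union>i\<in>J. {i, n + 1 - i})"

lemma set_unf: "1 \<le> i \<Longrightarrow> 2 * i \<le> Suc n \<Longrightarrow> set (unf n i) = {i, n + 1 - i}"
proof -
  assume "1 \<le> i" "2 * i \<le> Suc n"
  then consider "2 * i < n" | "n = 2 * i" | "Suc n = 2 * i" by linarith
  then show ?thesis by cases (auto simp: unf_def)
qed

lemma half_le_iff: "i \<le> Suc n div 2 \<longleftrightarrow> 2 * i \<le> Suc n"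
  by linarith

lemma set_unfold:
  assumes "set u \<subseteq> {1..(n + 1) div 2}"
  shows "set (unfold n u) = folded n (set u)"
proof -
  have "set (unf n i) = {i, n + 1 - i}" if "i \<in> set u" for i
  proof -
    have "i \<in> {1..(n + 1) div 2}" using that assms by blast
    then show ?thesis by (intro set_unf) (simp_all add: half_le_iff)
  qed
  then show ?thesis by (simp add: folded_def)
qed

lemma folded_subset:
  assumes "J \<subseteq> {1..(n + 1) div 2}"
  shows "folded n J \<subseteq> {1..n}"
proof
  fix i assume "i \<in> folded n J"
  then obtain j where "j \<in> J" "i = j \<or> i = n + 1 - j" unfolding folded_def by blast
  moreover from this have "1 \<le> j" "j \<le> (n + 1) div 2" using assms by auto
  ultimately show "i \<in> {1..n}" by (cases n) auto
qed

lemma folded_mem_iff: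
  assumes "J \<subseteq> {1..(n + 1) div 2}" "1 \<le> i" "i \<le> (n + 1) div 2"
  shows "i \<in> folded n J \<longleftrightarrow> i \<in> J" "n + 1 - i \<in> folded n J \<longleftrightarrow> i \<in> J"
proof -
  have "j = i" if "j \<in> J" "i = n + 1 - j \<or> n + 1 - i = j \<or> n + 1 - i = n + 1 - j" for j
  proof -
    have "j \<in> {1..(n + 1) div 2}" using that(1) assms(1) by blast
    then have "2 * j \<le> n + 1" "2 * i \<le> n + 1" using assms by (simp_all add: half_le_iff)
    then show ?thesis using that(2) by linarith
  qed
  then show "i \<in> folded n J \<longleftrightarrow> i \<in> J" "n + 1 - i \<in> folded n J \<longleftrightarrow> i \<in> J"
    unfolding folded_def UN_iff insert_iff empty_iff by metis+
qed

text \<open>Since \<open>2 * h \<le> n + 1\<close>, every letter unfolds to two distinct mirror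
  letters. The word combines an ascending run with its mirror image on disjoint strands, and the
  second summand, evaluated at the mirror strands \<open>y'\<close> and \<open>z'\<close>, counts
  the latter.\<close>

lemma cross_unfold_upt:
  assumes "1 \<le> x" "x \<le> h" "2 * h \<le> n + 1" "y + y' = n + 2" "z + z' = n + 2"
  shows "cross (unfold n [x..<h]) y z = up_cross x h y z + up_cross x h y' z'"
  using assms
proof (induction "h - x" arbitrary: x y z y' z')
  case 0
  then show ?case by (simp add: up_cross_def)
next
  case (Suc d)
  have xh: "x < h" using Suc(2) by simp
  define e where "e = n + 1 - x"
  have x2: "2 * x < n" "x + e = n + 1" "x + 2 \<le> e" "h < e" using xh Suc.prems unfolding e_def by linarith+
  let ?t = "\<lambda>w. tr e (tr x w)"
  have t: "?t w = (if w = x then Suc x else if w = Suc x then x else if w = e then Suc e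
      else if w = Suc e then e else w)" for w
    using x2(3) by (simp add: tr_def)
  have bar: "?t w + ?t w' = n + 2" if "w + w' = n + 2" for w w'
  proof -
    consider "w = x" | "w = Suc x" | "w = e" | "w = Suc e" | "w \<noteq> x" "w \<noteq> Suc x" "w \<noteq> e" "w \<noteq> Suc e" by blast
    then show ?thesis
    proof cases
      case 5
      then have "w' \<noteq> x" "w' \<noteq> Suc x" "w' \<noteq> e" "w' \<noteq> Suc e" using x2 that by linarith+
      then show ?thesis using 5 that by (simp add: t)
    next
      case 1
      then have "w' = Suc e" using x2 that by linarith
      then show ?thesis using 1 x2 by (simp add: t)
    next
      case 2
      then have "w' = e" using x2 that by linarith
      then show ?thesis using 2 x2 by (simp add: t)
    next
      case 3
      then have "w' = Suc x" using x2 that by linarith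
      then show ?thesis using 3 x2 by (simp add: t)
    next
      case 4
      then have "w' = x" using x2 that by linarith
      then show ?thesis using 4 x2 by (simp add: t)
    qed
  qed
  have IH: "cross (unfold n [Suc x..<h]) (?t y) (?t z) =
      up_cross (Suc x) h (?t y) (?t z) + up_cross (Suc x) h (?t y') (?t z')"
    using Suc(2) Suc.prems xh by (intro Suc(1) bar) auto
  have u: "unf n x = [x, e]" using x2(1) by (simp add: unf_def e_def)
  have c: "crossing e (tr x y) (tr x z) = crossing x y' z'"
  proof -
    have "y = e \<longleftrightarrow> y' = Suc x" "y = Suc e \<longleftrightarrow> y' = x" "z = e \<longleftrightarrow> z' = Suc x" "z = Suc e \<longleftrightarrow> z' = x"
      using Suc.prems x2 by linarith+
    moreover have "tr x w = e \<longleftrightarrow> w = e" "tr x w = Suc e \<longleftrightarrow> w = Suc e" for w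
      using x2 by (auto simp: tr_def)
    ultimately show ?thesis unfolding crossing_def by auto
  qed
  have L: "crossing x y z + up_cross (Suc x) h (?t y) (?t z) = up_cross x h y z" for y z
  proof -
    have le: "?t w \<le> h \<longleftrightarrow> w \<le> h" "?t w = Suc x \<longleftrightarrow> w = x" "Suc x < ?t w \<longleftrightarrow> Suc x < w" for w
      unfolding t using xh x2 by auto
    show ?thesis using xh unfolding up_cross_def le crossing_def by auto
  qed
  have "cross (unfold n [x..<h]) y z = crossing x y z + crossing e (tr x y) (tr x z) + cross (unfold n [Suc x..<h]) (?t y) (?t z)"
    using xh by (simp add: upt_conv_Cons u)
  then show ?case using L[of y z] L[of y' z'] c IH by simp
qed

text \<open>The unfolded full path exchanges the two outer strands \<open>x\<close> and
  \<open>e + 1\<close> of a symmetric block and brings the inner ones back to their places, so every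
  pair containing an outer strand crosses once. In the induction the word for \<open>x + 1\<close>
  is enclosed by the letters \<open>x\<close> and \<open>e\<close> on both sides.\<close>

lemma cross_unfold_full:
  assumes "k = (n + 1) div 2" "J \<subseteq> {1..k}" "1 \<le> x" "x \<le> k" "{x..k} \<subseteq> J" "x + e = n + 1"
  shows "pos (unfold n (path True k J x)) y =
      (if y = x then Suc e else if y = Suc e then x else y)"
    and "y \<noteq> z \<Longrightarrow> cross (unfold n (path True k J x)) y z =
      (if x \<le> y \<and> y \<le> Suc e \<and> x \<le> z \<and> z \<le> Suc e \<and> (y = x \<or> y = Suc e \<or> z = x \<or> z = Suc e)
       then 1 else 0)"
proof -
  let ?u = "\<lambda>x. unfold n (path True k J x)"
  let ?p = "\<lambda>x e y. if y = x then Suc e else if y = Suc e then x else y"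
  let ?B = "\<lambda>x e y z. x \<le> y \<and> y \<le> Suc e \<and> x \<le> z \<and> z \<le> Suc e \<and>
     (y = x \<or> y = Suc e \<or> z = x \<or> z = Suc e)"
  have "(\<forall>y. pos (?u x) y = ?p x e y) \<and>
    (\<forall>y z. y \<noteq> z \<longrightarrow> cross (?u x) y z = (if ?B x e y z then 1 else 0))"
    using assms(3-6)
  proof (induction "k - x" arbitrary: x e)
    case 0
    then have x: "x = k" "k \<in> J" by auto
    have "?u k = unf n k" using x by (simp add: path_top)
    moreover have "(\<forall>y. pos (unf n k) y = ?p k e y) \<and>
      (\<forall>y z. y \<noteq> z \<longrightarrow> cross (unf n k) y z = (if ?B k e y z then 1 else 0))"
    proof (cases "2 * k = n")
      case True
      then have "e = Suc k" "unf n k = [k, Suc k, k]" using 0 x by (auto simp: unf_def)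
      then show ?thesis by (auto simp: tr_def crossing_def)
    next
      case False
      then have "n + 1 = 2 * k" using assms(1) by auto
      then have "e = k" "unf n k = [k]" using 0 x by (auto simp: unf_def)
      then show ?thesis by (auto simp: tr_def crossing_def)
    qed
    ultimately show ?case unfolding x(1) by simp
  next
    case (Suc d)
    have xk: "x < k" using Suc(2) by simp
    have x2: "2 * x < n" "x + 2 \<le> e" using xk assms(1) Suc.prems by linarith+
    let ?t = "\<lambda>w. tr e (tr x w)"
    have t: "?t w = (if w = x then Suc x else if w = Suc x then x else if w = e then Suc e
        else if w = Suc e then e else w)" for w
      using x2(2) by (simp add: tr_def)
    have sub: "{Suc x..k} \<subseteq> J" using Suc.prems by auto
    have IH': "(\<forall>y. pos (?u (Suc x)) y = ?p (Suc x) (e - 1) y) \<and>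
      (\<forall>y z. y \<noteq> z \<longrightarrow> cross (?u (Suc x)) y z = (if ?B (Suc x) (e - 1) y z then 1 else 0))"
      using Suc(2) xk sub Suc.prems x2 by (intro Suc(1)) auto
    have e1: "Suc (e - 1) = e" using x2 by simp
    have IH: "pos (?u (Suc x)) y = (if y = Suc x then e else if y = e then Suc x else y)"
      "y \<noteq> z \<Longrightarrow> cross (?u (Suc x)) y z =
        (if Suc x \<le> y \<and> y \<le> e \<and> Suc x \<le> z \<and> z \<le> e \<and> (y = Suc x \<or> y = e \<or> z = Suc x \<or> z = e) then 1 else 0)" for y z
      using IH' unfolding e1 by blast+
    have u: "unf n x = [x, e]" using x2 Suc.prems(4) by (auto simp: unf_def)
    have ux: "?u x = [x, e] @ ?u (Suc x) @ [x, e]"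
      using path_full_Cons[OF Suc.prems(3) xk] u by simp
    have pu: "pos (?u (Suc x)) (?t w) = (if w = x then e else if w = Suc e then Suc x else ?t w)" for w
      unfolding IH(1) t using x2 by auto
    have "pos (?u x) y = ?p x e y" for y
    proof -
      have "pos (?u x) y = ?t (if y = x then e else if y = Suc e then Suc x else ?t y)"
        unfolding ux by (simp add: pu)
      also have "\<dots> = ?p x e y" unfolding t using x2(2) by auto
      finally show ?thesis .
    qed
    moreover have "cross (?u x) y z = (if ?B x e y z then 1 else 0)" if "y \<noteq> z" for y z
    proof -
      have yz: "?t y \<noteq> ?t z" using that by simp
      have ce: "crossing e (tr x y) (tr x z) = crossing e y z" for y z
        using x2(2) by (auto simp: crossing_def tr_def)
      have eq: "cross (?u x) y z = crossing x y z + crossing e y z + cross (?u (Suc x)) (?t y) (?t z)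
        + (crossing x (pos (?u (Suc x)) (?t y)) (pos (?u (Suc x)) (?t z)) +
           crossing e (pos (?u (Suc x)) (?t y)) (pos (?u (Suc x)) (?t z)))"
        unfolding ux by (simp add: ce)
      let ?q = "\<lambda>w. if w = x then e else if w = Suc e then Suc x else ?t w"
      have in1: "Suc x \<le> ?t w \<and> ?t w \<le> e \<longleftrightarrow> w = x \<or> w = Suc e \<or> Suc (Suc x) \<le> w \<and> w < e" for w
        unfolding t using x2(2) by auto
      have in2: "?t w = Suc x \<longleftrightarrow> w = x" "?t w = e \<longleftrightarrow> w = Suc e" for w
        unfolding t using x2(2) by auto
      have q: "?q w = x \<longleftrightarrow> w = Suc x" "?q w = Suc x \<longleftrightarrow> w = Suc e" "?q w = e \<longleftrightarrow> w = x" "?q w = Suc e \<longleftrightarrow> w = e" for w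
        unfolding t using x2(2) by auto
      have "cross (?u (Suc x)) (?t y) (?t z) =
          (if (Suc x \<le> ?t y \<and> ?t y \<le> e) \<and> (Suc x \<le> ?t z \<and> ?t z \<le> e) \<and>
             (?t y = Suc x \<or> ?t y = e \<or> ?t z = Suc x \<or> ?t z = e) then 1 else 0)"
        using IH(2)[OF yz] by simp
      then have "cross (?u x) y z = crossing x y z + crossing e y z
        + (if (y = x \<or> y = Suc e \<or> Suc (Suc x) \<le> y \<and> y < e) \<and> (z = x \<or> z = Suc e \<or> Suc (Suc x) \<le> z \<and> z < e) \<and>
             (y = x \<or> y = Suc e \<or> z = x \<or> z = Suc e) then 1 else 0)
        + ((if y = Suc x \<and> z = Suc e \<or> y = Suc e \<and> z = Suc x then 1 else 0) +
           (if y = x \<and> z = e \<or> y = e \<and> z = x then 1 else 0))"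
        unfolding eq pu crossing_def[of _ "?q y" "?q z"] q unfolding in1 in2 by simp
      also have "\<dots> = (if ?B x e y z then 1 else 0)"
        using x2(2) that unfolding crossing_def
        by (cases "y = x"; cases "y = Suc x"; cases "y = e"; cases "y = Suc e") auto
      finally show ?thesis .
    qed
    ultimately show ?case by blast
  qed
  then show "pos (?u x) y = ?p x e y"
    "y \<noteq> z \<Longrightarrow> cross (?u x) y z = (if ?B x e y z then 1 else 0)" by blast+
qed

lemma pos_le_iff: "i \<notin> set u \<Longrightarrow> pos u w \<le> i \<longleftrightarrow> w \<le> i"
  using cross_no_letter(2)[of i u w "Suc i"] cross_no_letter(3)[of i u i w]
  by (cases "w \<le> i") auto

lemma sim_interval:
  assumes "y \<noteq> z"
  shows "sim {a..<b} y z \<longleftrightarrow> a \<le> y \<and> y \<le> b \<and> a \<le> z \<and> z \<le> b"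
proof (cases "y < z")
  case True
  then show ?thesis by (simp add: sim_le) linarith
next
  case False
  then have "z < y" using assms by simp
  then have "sim {a..<b} z y \<longleftrightarrow> a \<le> y \<and> y \<le> b \<and> a \<le> z \<and> z \<le> b" by (simp add: sim_le) linarith
  then show ?thesis by (simp add: sim_commute)
qed

lemma folded_mono: "A \<subseteq> B \<Longrightarrow> folded n A \<subseteq> folded n B"
  unfolding folded_def by blast

text \<open>The argument of type A at both ends at once. If all letters from \<open>x\<close> to the
  middle lie in \<open>J\<close>, the two ends belong to one symmetric block; otherwise there are
  two separate mirror blocks.\<close>

lemma cross_delta_B:
  assumes k: "k = (n + 1) div 2" and J: "J \<subseteq> {1..k}"
    and yz: "y \<noteq> z" "1 \<le> y" "y \<le> Suc n" "1 \<le> z" "z \<le> Suc n" and x: "1 \<le> x" "x \<le> Suc k"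
  shows "cross (unfold n (delta True k J x)) y z = (if sim (folded n (J \<inter> {x..})) y z then 1 else 0)"
  using x
proof (induction "Suc k - x" arbitrary: x)
  case 0
  then have "J \<inter> {x..} = {}" using J by auto
  moreover have "\<not> sim {} y z" using yz by (auto simp: sim_def)
  ultimately show ?case using 0 by (simp add: delta.simps[of True k J x] folded_def)
next
  case (Suc d)
  have xk: "x \<le> k" using Suc(2) by simp
  have f: "finite J" using J finite_subset by blast
  let ?P = "delta True k J (Suc x)"
  let ?D = "unfold n ?P"
  let ?K = "folded n (J \<inter> {Suc x..})"
  have D: "unfold n (delta True k J x) = ?D @ unfold n (path True k J x)"
    using xk by (subst delta.simps) simp
  have IH: "cross ?D y z = (if sim ?K y z then 1 else 0)"
    using Suc(2) by (intro Suc(1)) auto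
  have "x \<le> t \<longleftrightarrow> t = x \<or> Suc x \<le> t" for t by arith
  then have at: "{x..} = insert x {Suc x..}" by (simp add: set_eq_iff)
  define e where "e = n + 1 - x"
  have xe: "x + e = n + 1" "x \<le> e" using xk k unfolding e_def by linarith+
  show ?case
  proof (cases "x \<in> J")
    case False
    then have "J \<inter> {x..} = J \<inter> {Suc x..}" unfolding at by simp
    moreover have "path True k J x = []" using False by (subst path.simps) simp
    ultimately show ?thesis using IH unfolding D by simp
  next
    case True
    have sP: "set ?P \<subseteq> J \<inter> {Suc x..k}" by (rule set_delta)
    then have "set ?P \<subseteq> {1..(n + 1) div 2}" using k by auto
    then have sD: "set ?D = folded n (set ?P)" by (rule set_unfold)
    have K: "Suc x \<le> i \<and> i < e" if i: "i \<in> ?K" for i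
    proof -
      obtain j where "j \<in> J \<inter> {Suc x..}" "i \<in> {j, n + 1 - j}"
        using i unfolding folded_def by blast
      then have j: "j \<in> J" "Suc x \<le> j" "i = j \<or> i = n + 1 - j" by simp_all
      have "2 * j \<le> Suc n" using subsetD[OF J j(1)] k by (simp add: half_le_iff)
      then show ?thesis using j(2,3) xe by linarith
    qed
    have DK: "set ?D \<subseteq> ?K" unfolding sD using sP by (intro folded_mono) auto
    have xD: "x \<notin> set ?D" "e \<notin> set ?D" using K[of x] K[of e] DK by auto
    have "pos ?D x = x" "pos ?D (Suc e) = Suc e"
      using K DK xD xe by (intro pos_outside; force)+
    then have px: "pos ?D w = x \<longleftrightarrow> w = x" "pos ?D w = Suc e \<longleftrightarrow> w = Suc e" for w
      by (metis pos_eq_iff)+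
    have less: "pos ?D w \<le> x \<longleftrightarrow> w \<le> x" "pos ?D w \<le> e \<longleftrightarrow> w \<le> e" for w
      by (rule pos_le_iff[OF xD(1)], rule pos_le_iff[OF xD(2)])
    have kn: "k \<le> e" "2 * k \<le> n + 1" using k xe xk by linarith+
    have fK: "folded n (J \<inter> {x..}) = insert x (insert e ?K)"
      using True unfolding at folded_def e_def by auto
    show ?thesis
    proof (cases "{x..k} \<subseteq> J")
      case full: True
      have ge: "x \<le> pos ?D w \<longleftrightarrow> x \<le> w" for w using less(1)[of w] px(1)[of w] by linarith
      have le: "pos ?D w \<le> Suc e \<longleftrightarrow> w \<le> Suc e" for w using less(2)[of w] px(2)[of w] by linarith
      have eq: "cross (unfold n (delta True k J x)) y z = cross ?D y z +
        (if x \<le> y \<and> y \<le> Suc e \<and> x \<le> z \<and> z \<le> Suc e \<and> (y = x \<or> y = Suc e \<or> z = x \<or> z = Suc e) then 1 else 0)"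
        using cross_unfold_full(2)[OF k J Suc.prems(1) xk full xe(1), of "pos ?D y" "pos ?D z"] yz(1)
        unfolding D by (simp add: ge le px)
      have inK: "i \<in> ?K" if "Suc x \<le> i" "i < e" for i
      proof (cases "i \<le> k")
        case True
        then have "i \<in> J \<inter> {Suc x..}" using full that by auto
        then show ?thesis unfolding folded_def by blast
      next
        case False
        have n: "n + 1 \<le> 2 * k + 1" using k by linarith
        have "n + 1 - i \<le> k" "Suc x \<le> n + 1 - i" "i = n + 1 - (n + 1 - i)" using False that xe n by linarith+
        moreover from this have "n + 1 - i \<in> J \<inter> {Suc x..}" using full by auto
        ultimately show ?thesis unfolding folded_def by blast
      qed
      have Keq: "?K = {Suc x..<e}" using K inK by (intro equalityI subsetI) simp_all
      have s1: "sim ?K y z \<longleftrightarrow> Suc x \<le> y \<and> y \<le> e \<and> Suc x \<le> z \<and> z \<le> e"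
        unfolding Keq by (rule sim_interval[OF yz(1)])
      have "x \<le> t \<and> t < Suc e \<longleftrightarrow> t = x \<or> t = e \<or> Suc x \<le> t \<and> t < e" for t using xe(2) by linarith
      then have "insert x (insert e ?K) = {x..<Suc e}" unfolding Keq by (simp add: set_eq_iff)
      then have s2: "sim (folded n (J \<inter> {x..})) y z \<longleftrightarrow> x \<le> y \<and> y \<le> Suc e \<and> x \<le> z \<and> z \<le> Suc e"
        unfolding fK by (simp add: sim_interval[OF yz(1)])
      show ?thesis
      proof (cases "y = x \<or> y = Suc e \<or> z = x \<or> z = Suc e")
        case True
        then have "\<not> sim ?K y z" unfolding s1 by linarith
        then show ?thesis using True unfolding eq IH s2 by simp
      next
        case False
        then have "sim ?K y z \<longleftrightarrow> sim (folded n (J \<inter> {x..})) y z" unfolding s1 s2 by linarith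
        then show ?thesis using False unfolding eq IH by simp
      qed
    next
      case nfull: False
      define h where "h = hi J x"
      have h: "x \<le> h" "h \<notin> J" "{x..<h} \<subseteq> J" unfolding h_def using hi_props[OF f] by auto
      have hk: "h \<le> k"
      proof (rule ccontr)
        assume "\<not> h \<le> k"
        then have "{x..k} \<subseteq> {x..<h}" by auto
        then show False using h(3) nfull by blast
      qed
      have xh: "x < h" using h True by (metis le_neq_implies_less)
      \<comment> \<open>The mirror of the wall \<open>h\<close>: the lower block has the strands
        \<open>x..h\<close>, the upper one the strands \<open>g + 1..e + 1\<close>.\<close>
      define g where "g = n + 1 - h"
      have gh: "g + h = n + 1" "g < e" using hk k xe xh unfolding g_def by linarith+
      have J': "J \<inter> {Suc x..} \<subseteq> {1..(n + 1) div 2}" using J k by auto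
      have hK: "h \<notin> ?K" "g \<notin> ?K"
        using folded_mem_iff[OF J', of h] h(2) xh hk k Suc.prems(1) unfolding g_def by auto
      then have hD: "h \<notin> set ?D" "g \<notin> set ?D" using DK by auto
      have path: "path True k J x = [x..<h]"
        unfolding h_def using path_upt[OF J] xk nfull by simp
      have lt: "pos ?D w \<le> h \<longleftrightarrow> w \<le> h" "pos ?D w \<le> g \<longleftrightarrow> w \<le> g" for w
        by (rule pos_le_iff[OF hD(1)], rule pos_le_iff[OF hD(2)])
      have "set ?D \<subseteq> {1..n}" using DK folded_subset[OF J'] by blast
      then have r: "1 \<le> pos ?D w \<and> pos ?D w \<le> Suc n" if "1 \<le> w" "w \<le> Suc n" for w
        using pos_range[of ?D n w] that by simp
      have low: "up_cross x h (pos ?D y) (pos ?D z) = up_cross x h y z"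
        unfolding up_cross_def by (simp add: px lt less not_le[symmetric])
      have up: "up_cross x h (n + 2 - w) (n + 2 - w') =
        (if w = Suc e \<and> g < w' \<and> w' \<le> e \<or> w' = Suc e \<and> g < w \<and> w \<le> e then 1 else 0)"
        if "w \<le> Suc n" "w' \<le> Suc n" for w w'
      proof -
        have "n + 2 - v = x \<longleftrightarrow> v = Suc e" "x < n + 2 - v \<longleftrightarrow> v \<le> e" "n + 2 - v \<le> h \<longleftrightarrow> g < v" if "v \<le> Suc n" for v
          using that xe(1) gh(1) by linarith+
        then show ?thesis unfolding up_cross_def using that by simp
      qed
      have high: "up_cross x h (n + 2 - pos ?D y) (n + 2 - pos ?D z) = up_cross x h (n + 2 - y) (n + 2 - z)"
        unfolding up[OF yz(3) yz(5)] up[OF conjunct2[OF r[OF yz(2,3)]] conjunct2[OF r[OF yz(4,5)]]]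
        by (simp add: px lt less not_le[symmetric])
      have eq: "cross (unfold n (delta True k J x)) y z = cross ?D y z + up_cross x h y z + up_cross x h (n + 2 - y) (n + 2 - z)"
      proof -
        have "2 * h \<le> n + 1" using hk kn by linarith
        then have "cross (unfold n [x..<h]) (pos ?D y) (pos ?D z) =
           up_cross x h (pos ?D y) (pos ?D z) + up_cross x h (n + 2 - pos ?D y) (n + 2 - pos ?D z)"
          using r[of y] r[of z] yz xh Suc.prems(1) by (intro cross_unfold_upt) auto
        then show ?thesis unfolding D path low high by simp
      qed
      have s1: "sim (insert e ?K) y z \<longleftrightarrow> sim ?K y z \<or> y = Suc e \<and> g < z \<and> z \<le> e \<or> z = Suc e \<and> g < y \<and> y \<le> e"
      proof (rule sim_insert_high)
        show "{Suc g..<e} \<subseteq> ?K"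
        proof
          fix i assume i: "i \<in> {Suc g..<e}"
          then have "g < i" "i < e" by auto
          then have "x < n + 1 - i" "n + 1 - i < h" "i = n + 1 - (n + 1 - i)" using gh xe by linarith+
          moreover from this have "n + 1 - i \<in> J \<inter> {Suc x..}" using h(3) by auto
          ultimately show "i \<in> ?K" unfolding folded_def by blast
        qed
      qed (use K hK gh yz in auto)
      have s2: "sim (insert x (insert e ?K)) y z \<longleftrightarrow> sim (insert e ?K) y z \<or> y = x \<and> x < z \<and> z \<le> h \<or> z = x \<and> x < y \<and> y \<le> h"
      proof (rule sim_insert_low)
        show "insert e ?K \<subseteq> {x<..}" using K xh hk kn by (auto simp: Suc_le_eq)
        show "{Suc x..<h} \<subseteq> insert e ?K"
        proof
          fix i assume "i \<in> {Suc x..<h}"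
          then have "i \<in> J \<inter> {Suc x..}" using h(3) by auto
          then show "i \<in> insert e ?K" unfolding folded_def by blast
        qed
        show "h \<notin> insert e ?K" using hK hk xe k xk xh by auto
      qed (use xh yz in auto)
      \<comment> \<open>By \<open>n1\<close>, \<open>n2\<close> and \<open>n3\<close> no two of the
        three summands in \<open>eq\<close> are nonzero on the same pair, so the sum stays 0 or
        1.\<close>
      have n1: "\<not> sim ?K y z" if "y = x \<and> x < z \<or> z = x \<and> x < y"
      proof
        assume "sim ?K y z"
        moreover have "x \<in> {min y z..<max y z}" using that by auto
        ultimately show False using K[of x] unfolding sim_def by auto
      qed
      have n2: "\<not> sim ?K y z" if "y = Suc e \<and> z \<le> e \<or> z = Suc e \<and> y \<le> e"
      proof
        assume "sim ?K y z"
        moreover have "e \<in> {min y z..<max y z}" using that by auto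
        ultimately show False using K[of e] unfolding sim_def by auto
      qed
      have n3: "\<not> (y = x \<and> z \<le> h \<and> (z = Suc e \<or> y = Suc e))" "\<not> (z = x \<and> y \<le> h \<and> (y = Suc e \<or> z = Suc e))"
        using hk kn xe by auto
      show ?thesis
        unfolding eq IH fK s2 s1 up[OF yz(3) yz(5)] unfolding up_cross_def
        using n1 n2 n3 by (cases "sim ?K y z") auto
    qed
  qed
qed

section \<open>Braid relations under unfolding\<close>

lemma braid_double_three:
  fixes M :: "'a coxeter"
  assumes nodes: "i \<in> nodes M" "j \<in> nodes M" "p \<in> nodes M" "q \<in> nodes M"
    and comm: "braid_eq M [i, p] [p, i]" "braid_eq M [i, q] [q, i]" "braid_eq M [j, p] [p, j]" "braid_eq M [j, q] [q, j]"
    and three: "braid_eq M [i, j, i] [j, i, j]" "braid_eq M [p, q, p] [q, p, q]"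
  shows "braid_eq M [i, p, j, q, i, p] [j, q, i, p, j, q]"
proof -
  have "braid_eq M [i, p, j, q, i, p] [i, j, p, q, i, p]"
    using pres_cong_ctxt[OF pres_cong.sym[OF comm(3)], of "[i]" "[q, i, p]"] nodes by simp
  also have "braid_eq M [i, j, p, q, i, p] [i, j, p, i, q, p]"
    using pres_cong_ctxt[OF pres_cong.sym[OF comm(2)], of "[i, j, p]" "[p]"] nodes by simp
  also have "braid_eq M [i, j, p, i, q, p] [i, j, i, p, q, p]"
    using pres_cong_ctxt[OF pres_cong.sym[OF comm(1)], of "[i, j]" "[q, p]"] nodes by simp
  also have "braid_eq M [i, j, i, p, q, p] [j, i, j, p, q, p]"
    using pres_cong_ctxt[OF three(1), of "[]" "[p, q, p]"] nodes by simp
  also have "braid_eq M [j, i, j, p, q, p] [j, i, j, q, p, q]"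
    using pres_cong_ctxt[OF three(2), of "[j, i, j]" "[]"] nodes by simp
  also have "braid_eq M [j, i, j, q, p, q] [j, i, q, j, p, q]"
    using pres_cong_ctxt[OF comm(4), of "[j, i]" "[p, q]"] nodes by simp
  also have "braid_eq M [j, i, q, j, p, q] [j, q, i, j, p, q]"
    using pres_cong_ctxt[OF comm(2), of "[j]" "[j, p, q]"] nodes by simp
  also have "braid_eq M [j, q, i, j, p, q] [j, q, i, p, j, q]"
    using pres_cong_ctxt[OF comm(3), of "[j, q, i]" "[q]"] nodes by simp
  finally show ?thesis .
qed

text \<open>The relation of length 4, unfolded for odd \<open>n\<close>. In type \<open>A_3\<close>
  both sides are words for the half twist on four strands.\<close>

lemma braid_unfold_odd:
  fixes M :: "'a coxeter"
  assumes nodes: "i \<in> nodes M" "k \<in> nodes M" "p \<in> nodes M"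
    and comm: "braid_eq M [i, p] [p, i]"
    and three: "braid_eq M [i, k, i] [k, i, k]" "braid_eq M [k, p, k] [p, k, p]"
  shows "braid_eq M [i, p, k, i, p, k] [k, i, p, k, i, p]"
proof -
  have "braid_eq M [i, p, k, i, p, k] [p, i, k, i, p, k]"
    using pres_cong_ctxt[OF comm, of "[]" "[k, i, p, k]"] nodes by simp
  also have "braid_eq M [p, i, k, i, p, k] [p, k, i, k, p, k]"
    using pres_cong_ctxt[OF three(1), of "[p]" "[p, k]"] nodes by simp
  also have "braid_eq M [p, k, i, k, p, k] [p, k, i, p, k, p]"
    using pres_cong_ctxt[OF three(2), of "[p, k, i]" "[]"] nodes by simp
  also have "braid_eq M [p, k, i, p, k, p] [p, k, p, i, k, p]"
    using pres_cong_ctxt[OF comm, of "[p, k]" "[k, p]"] nodes by simp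
  also have "braid_eq M [p, k, p, i, k, p] [k, p, k, i, k, p]"
    using pres_cong_ctxt[OF pres_cong.sym[OF three(2)], of "[]" "[i, k, p]"] nodes by simp
  also have "braid_eq M [k, p, k, i, k, p] [k, p, i, k, i, p]"
    using pres_cong_ctxt[OF pres_cong.sym[OF three(1)], of "[k, p]" "[p]"] nodes by simp
  also have "braid_eq M [k, p, i, k, i, p] [k, i, p, k, i, p]"
    using pres_cong_ctxt[OF pres_cong.sym[OF comm], of "[k]" "[k, i, p]"] nodes by simp
  finally show ?thesis .
qed

text \<open>The relation of length 4, unfolded for even \<open>n\<close>, where the last generator
  becomes \<open>k, w, k\<close>. In type \<open>A_4\<close> both sides are words for the half twist
  on five strands.\<close>

lemma braid_unfold_even:
  fixes M :: "'a coxeter"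
  assumes nodes: "i \<in> nodes M" "k \<in> nodes M" "w \<in> nodes M" "p \<in> nodes M"
    and comm: "braid_eq M [i, p] [p, i]" "braid_eq M [i, w] [w, i]" "braid_eq M [k, p] [p, k]"
    and three: "braid_eq M [i, k, i] [k, i, k]" "braid_eq M [k, w, k] [w, k, w]" "braid_eq M [w, p, w] [p, w, p]"
  shows "braid_eq M [i, p, k, w, k, i, p, k, w, k] [k, w, k, i, p, k, w, k, i, p]"
proof -
  have "braid_eq M [i, p, k, w, k, i, p, k, w, k] [p, i, k, w, k, i, p, k, w, k]"
    using pres_cong_ctxt[OF comm(1), of "[]" "[k, w, k, i, p, k, w, k]"] nodes by simp
  also have "braid_eq M [p, i, k, w, k, i, p, k, w, k] [p, i, k, w, k, i, k, p, w, k]"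
    using pres_cong_ctxt[OF pres_cong.sym[OF comm(3)], of "[p, i, k, w, k, i]" "[w, k]"] nodes by simp
  also have "braid_eq M [p, i, k, w, k, i, k, p, w, k] [p, i, k, w, i, k, i, p, w, k]"
    using pres_cong_ctxt[OF pres_cong.sym[OF three(1)], of "[p, i, k, w]" "[p, w, k]"] nodes by simp
  also have "braid_eq M [p, i, k, w, i, k, i, p, w, k] [p, i, k, i, w, k, i, p, w, k]"
    using pres_cong_ctxt[OF pres_cong.sym[OF comm(2)], of "[p, i, k]" "[k, i, p, w, k]"] nodes by simp
  also have "braid_eq M [p, i, k, i, w, k, i, p, w, k] [p, i, k, i, w, k, p, i, w, k]"
    using pres_cong_ctxt[OF comm(1), of "[p, i, k, i, w, k]" "[w, k]"] nodes by simp
  also have "braid_eq M [p, i, k, i, w, k, p, i, w, k] [p, i, k, i, w, k, p, w, i, k]"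
    using pres_cong_ctxt[OF comm(2), of "[p, i, k, i, w, k, p]" "[k]"] nodes by simp
  also have "braid_eq M [p, i, k, i, w, k, p, w, i, k] [p, k, i, k, w, k, p, w, i, k]"
    using pres_cong_ctxt[OF three(1), of "[p]" "[w, k, p, w, i, k]"] nodes by simp
  also have "braid_eq M [p, k, i, k, w, k, p, w, i, k] [k, p, i, k, w, k, p, w, i, k]"
    using pres_cong_ctxt[OF pres_cong.sym[OF comm(3)], of "[]" "[i, k, w, k, p, w, i, k]"] nodes by simp
  also have "braid_eq M [k, p, i, k, w, k, p, w, i, k] [k, i, p, k, w, k, p, w, i, k]"
    using pres_cong_ctxt[OF pres_cong.sym[OF comm(1)], of "[k]" "[k, w, k, p, w, i, k]"] nodes by simp
  also have "braid_eq M [k, i, p, k, w, k, p, w, i, k] [k, i, p, w, k, w, p, w, i, k]"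
    using pres_cong_ctxt[OF three(2), of "[k, i, p]" "[p, w, i, k]"] nodes by simp
  also have "braid_eq M [k, i, p, w, k, w, p, w, i, k] [k, i, p, w, k, p, w, p, i, k]"
    using pres_cong_ctxt[OF three(3), of "[k, i, p, w, k]" "[i, k]"] nodes by simp
  also have "braid_eq M [k, i, p, w, k, p, w, p, i, k] [k, i, p, w, p, k, w, p, i, k]"
    using pres_cong_ctxt[OF comm(3), of "[k, i, p, w]" "[w, p, i, k]"] nodes by simp
  also have "braid_eq M [k, i, p, w, p, k, w, p, i, k] [k, i, p, w, p, k, w, i, p, k]"
    using pres_cong_ctxt[OF pres_cong.sym[OF comm(1)], of "[k, i, p, w, p, k, w]" "[k]"] nodes by simp
  also have "braid_eq M [k, i, p, w, p, k, w, i, p, k] [k, i, p, w, p, k, w, i, k, p]"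
    using pres_cong_ctxt[OF pres_cong.sym[OF comm(3)], of "[k, i, p, w, p, k, w, i]" "[]"] nodes by simp
  also have "braid_eq M [k, i, p, w, p, k, w, i, k, p] [k, i, w, p, w, k, w, i, k, p]"
    using pres_cong_ctxt[OF pres_cong.sym[OF three(3)], of "[k, i]" "[k, w, i, k, p]"] nodes by simp
  also have "braid_eq M [k, i, w, p, w, k, w, i, k, p] [k, w, i, p, w, k, w, i, k, p]"
    using pres_cong_ctxt[OF comm(2), of "[k]" "[p, w, k, w, i, k, p]"] nodes by simp
  also have "braid_eq M [k, w, i, p, w, k, w, i, k, p] [k, w, p, i, w, k, w, i, k, p]"
    using pres_cong_ctxt[OF comm(1), of "[k, w]" "[w, k, w, i, k, p]"] nodes by simp
  also have "braid_eq M [k, w, p, i, w, k, w, i, k, p] [k, w, p, i, k, w, k, i, k, p]"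
    using pres_cong_ctxt[OF pres_cong.sym[OF three(2)], of "[k, w, p, i]" "[i, k, p]"] nodes by simp
  also have "braid_eq M [k, w, p, i, k, w, k, i, k, p] [k, w, p, i, k, w, i, k, i, p]"
    using pres_cong_ctxt[OF pres_cong.sym[OF three(1)], of "[k, w, p, i, k, w]" "[p]"] nodes by simp
  also have "braid_eq M [k, w, p, i, k, w, i, k, i, p] [k, w, p, i, k, i, w, k, i, p]"
    using pres_cong_ctxt[OF pres_cong.sym[OF comm(2)], of "[k, w, p, i, k]" "[k, i, p]"] nodes by simp
  also have "braid_eq M [k, w, p, i, k, i, w, k, i, p] [k, w, p, k, i, k, w, k, i, p]"
    using pres_cong_ctxt[OF three(1), of "[k, w, p]" "[w, k, i, p]"] nodes by simp
  also have "braid_eq M [k, w, p, k, i, k, w, k, i, p] [k, w, k, p, i, k, w, k, i, p]"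
    using pres_cong_ctxt[OF pres_cong.sym[OF comm(3)], of "[k, w]" "[i, k, w, k, i, p]"] nodes by simp
  also have "braid_eq M [k, w, k, p, i, k, w, k, i, p] [k, w, k, i, p, k, w, k, i, p]"
    using pres_cong_ctxt[OF pres_cong.sym[OF comm(1)], of "[k, w, k]" "[k, w, k, i, p]"] nodes by simp
  finally show ?thesis .
qed


lemma braid_commute_words:
  assumes "set u \<subseteq> {1..n}" "set v \<subseteq> {1..n}" "\<And>i j. i \<in> set u \<Longrightarrow> j \<in> set v \<Longrightarrow> i + 2 \<le> j \<or> j + 2 \<le> i"
  shows "braid_eq (cox b n) (u @ v) (v @ u)"
  using assms
proof (induction u)
  case Nil
  then show ?case by (auto intro: pres_cong.refl)
next
  case (Cons i u)
  have "braid_eq (cox b n) ([i] @ u @ v) ([i] @ v @ u)"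
    using Cons by (intro pres_cong_left) auto
  also have "[i] @ v @ u = (i # v) @ u" by simp
  also have "braid_eq (cox b n) ((i # v) @ u) ((v @ [i]) @ u)"
    using Cons.prems by (intro pres_cong_right braid_commute_word) auto
  finally show ?case by simp
qed

text \<open>This makes the standard unfolding a homomorphism. The parity of \<open>n\<close> matters
  only for the relation of length 4, which involves the middle of the path.\<close>

lemma unfold_braid:
  assumes k: "k = (n + 1) div 2" and uv: "braid_eq (cox_B k) u v"
  shows "braid_eq (cox_A n) (unfold n u) (unfold n v)"
proof -
  have A: "cox_A n = cox False n" by (simp add: cox_def)
  have c: "braid_eq (cox False n) [i, j] [j, i]" if "1 \<le> i" "i + 2 \<le> j" "j \<le> n" for i j
    using that by (intro braid_commute_adj) auto
  have t: "braid_eq (cox False n) [i, j, i] [j, i, j]" if "1 \<le> i" "j = Suc i" "j \<le> n" for i j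
    using that braid_three[of i n False] by auto
  have far: "braid_eq (cox False n) (unf n i @ unf n j) (unf n j @ unf n i)"
    if "1 \<le> i" "i + 2 \<le> j" "j \<le> k" for i j
  proof (rule braid_commute_words)
    have "2 * i \<le> Suc n" "2 * j \<le> Suc n" using that k by (simp_all add: half_le_iff)
    then have s: "set (unf n i) = {i, n + 1 - i}" "set (unf n j) = {j, n + 1 - j}"
      using that by (simp_all add: set_unf)
    show "set (unf n i) \<subseteq> {1..n}" "set (unf n j) \<subseteq> {1..n}"
      unfolding s using that k by auto
    show "x + 2 \<le> y \<or> y + 2 \<le> x" if "x \<in> set (unf n i)" "y \<in> set (unf n j)" for x y
      using that \<open>i + 2 \<le> j\<close> \<open>2 * j \<le> Suc n\<close> unfolding s by auto
  qed
  have "pres_cong {1..n} (braid_relations (cox False n)) (unfold n u) (unfold n v)"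
    using uv[unfolded nodes_cox]
  proof (rule pres_cong_concat_map)
    fix i assume "i \<in> {1..k}"
    then have "1 \<le> i" "2 * i \<le> Suc n" using k by (simp_all add: half_le_iff)
    then show "set (unf n i) \<subseteq> {1..n}" by (subst set_unf) auto
  next
    fix u v assume "(u, v) \<in> braid_relations (cox_B k)"
    then have "(u, v) \<in> braid_relations (cox True k)" by (simp add: cox_def)
    then have "braid_eq (cox False n) (unfold n u) (unfold n v)"
    proof (rule braid_relations_cox_cases)
      fix i j assume "i \<in> {1..k}" "j \<in> {1..k}" "i + 2 \<le> j \<or> j + 2 \<le> i"
      then show "braid_eq (cox False n) (unfold n [i, j]) (unfold n [j, i])"
        using far[of i j] far[of j i] by (auto intro: pres_cong.sym)
    next
      fix i assume i: "i \<in> {1..k}" "True \<Longrightarrow> Suc i < k"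
      define p where "p = n + 1 - i"
      define q where "q = n - i"
      have *: "1 \<le> i" "2 * i + 3 \<le> n" "p = Suc q" "i + 3 \<le> q" "p \<le> n"
        using i k unfolding p_def q_def by auto
      then have u: "unf n i = [i, p]" "unf n (Suc i) = [Suc i, q]"
        by (auto simp: unf_def p_def q_def)
      have "braid_eq (cox False n) [i, p, Suc i, q, i, p] [Suc i, q, i, p, Suc i, q]"
        using * c[of i p] c[of i q] c[of "Suc i" p] c[of "Suc i" q] t[of i "Suc i"] pres_cong.sym[OF t[of q p]]
        by (intro braid_double_three) auto
      then show "braid_eq (cox False n) (unfold n [i, Suc i, i]) (unfold n [Suc i, i, Suc i])"
        by (simp add: u)
    next
      fix i assume i: "Suc i = k" "1 \<le> i"
      show "braid_eq (cox False n) (unfold n [i, Suc i, i, Suc i]) (unfold n [Suc i, i, Suc i, i])"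
      proof (cases "n = 2 * k")
        case True
        then have n: "n = 2 * i + 2" using i by simp
        then have u: "unf n i = [i, i + 3]" "unf n (Suc i) = [i + 1, i + 2, i + 1]"
          by (auto simp: unf_def)
        have "braid_eq (cox False n) [i, i + 3, i + 1, i + 2, i + 1, i, i + 3, i + 1, i + 2, i + 1]
          [i + 1, i + 2, i + 1, i, i + 3, i + 1, i + 2, i + 1, i, i + 3]"
          using i n c[of i "i + 3"] c[of i "i + 2"] c[of "i + 1" "i + 3"]
            t[of i "i + 1"] t[of "i + 1" "i + 2"] t[of "i + 2" "i + 3"]
          by (intro braid_unfold_even) auto
        then show ?thesis by (simp add: u)
      next
        case False
        then have n: "n = 2 * i + 1" using i k by linarith
        then have u: "unf n i = [i, i + 2]" "unf n (Suc i) = [i + 1]"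
          by (auto simp: unf_def)
        have "braid_eq (cox False n) [i, i + 2, i + 1, i, i + 2, i + 1] [i + 1, i, i + 2, i + 1, i, i + 2]"
          using i n c[of i "i + 2"] t[of i "i + 1"] t[of "i + 1" "i + 2"]
          by (intro braid_unfold_odd) auto
        then show ?thesis by (simp add: u)
      qed
    qed (rule pres_cong.sym)
    then show "pres_cong {1..n} (braid_relations (cox False n)) (unfold n u) (unfold n v)" by simp
  qed
  then show ?thesis by (simp add: A)
qed

section \<open>Longest elements\<close>

lemma pos_bij: "set u \<subseteq> {1..n} \<Longrightarrow> bij_betw (pos u) {1..Suc n} {1..Suc n}"
proof -
  assume u: "set u \<subseteq> {1..n}"
  have "pos u ` {1..Suc n} = {1..Suc n}"
  proof (rule endo_inj_surj)
    show "pos u ` {1..Suc n} \<subseteq> {1..Suc n}" using pos_range[OF u] by blast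
  qed (simp_all add: inj_on_def)
  then show ?thesis by (simp add: bij_betw_def inj_on_def)
qed

lemma pos_rank:
  assumes u: "set u \<subseteq> {1..n}" and y: "y \<in> {1..Suc n}"
  shows "pos u y = Suc (card {z \<in> {1..Suc n}. pos u z < pos u y})"
proof -
  let ?S = "{1..Suc n}"
  have img: "pos u ` ?S = ?S" using pos_bij[OF u] by (simp add: bij_betw_def)
  have "pos u ` {z \<in> ?S. pos u z < pos u y} = {w \<in> ?S. w < pos u y}"
  proof -
    have "pos u ` {z \<in> ?S. pos u z \<in> T} = pos u ` ?S \<inter> T" for T by auto
    from this[of "{..<pos u y}"] show ?thesis unfolding img by (simp add: Int_def)
  qed
  moreover have "card (pos u ` {z \<in> ?S. pos u z < pos u y}) = card {z \<in> ?S. pos u z < pos u y}"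
    by (rule card_image) (simp add: inj_on_def)
  moreover have "pos u y \<in> ?S" by (rule pos_range[OF u y])
  then have "{w \<in> ?S. w < pos u y} = {1..<pos u y}" by auto
  ultimately have "card {z \<in> ?S. pos u z < pos u y} = pos u y - 1" by simp
  moreover have "1 \<le> pos u y" using \<open>pos u y \<in> ?S\<close> by simp
  ultimately show ?thesis by linarith
qed

lemma cross_outside:
  assumes "set u \<subseteq> {1..n}" "y \<notin> {1..Suc n}"
  shows "pos u y = y" "cross u y z = 0"
proof -
  have *: "y \<noteq> i \<and> y \<noteq> Suc i" if "i \<in> set u" for i
  proof -
    have "i \<in> {1..n}" using that assms(1) by blast
    then show ?thesis using assms(2) by auto
  qed
  show "pos u y = y" "cross u y z = 0" by (rule pos_outside, erule *)+
qed

text \<open>The parity of the crossing number decides the final order of two strands, and the final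
  position of a strand is its rank in this order.\<close>

lemma pos_eq_if_cross_eq:
  assumes u: "set u \<subseteq> {1..n}" and v: "set v \<subseteq> {1..n}"
    and c: "\<And>y z. y \<in> {1..Suc n} \<Longrightarrow> z \<in> {1..Suc n} \<Longrightarrow> y \<noteq> z \<Longrightarrow> cross u y z = cross v y z"
  shows "pos u = pos v"
proof
  fix y show "pos u y = pos v y"
  proof (cases "y \<in> {1..Suc n}")
    case True
    have "pos u z < pos u y \<longleftrightarrow> pos v z < pos v y" if "z \<in> {1..Suc n}" for z
    proof (cases "z = y")
      case False
      then show ?thesis using c[OF that True False] by (simp add: pos_less_iff)
    qed simp
    then have "{z \<in> {1..Suc n}. pos u z < pos u y} = {z \<in> {1..Suc n}. pos v z < pos v y}" by blast
    then show ?thesis using pos_rank[OF u True] pos_rank[OF v True] by simp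
  next
    case False
    then show ?thesis using cross_outside(1)[OF u False] cross_outside(1)[OF v False] by simp
  qed
qed

text \<open>The permutation fixes the parity of every crossing number, so a pair crossing at most
  once crosses as rarely as the permutation allows.\<close>

lemma cross_le_if_pos_eq:
  assumes "pos u = pos v" "cross u y z \<le> 1"
  shows "cross u y z \<le> cross v y z"
proof (cases "y = z")
  case False
  have "even (cross u y z) \<longleftrightarrow> even (cross v y z)"
    using pos_less_iff[OF False, of u] pos_less_iff[OF False, of v] assms(1) by auto
  then show ?thesis using assms(2) by (cases "cross u y z = 0") (auto simp: le_Suc_eq odd_pos Suc_leI)
qed simp

text \<open>In type B a word acts on \<open>2 * k\<close> strands symmetrically about the middle; \<open>strand_word\<close>
  and \<open>strand_set\<close> treat both types at once.\<close>

definition strand_word :: "bool \<Rightarrow> nat \<Rightarrow> nat list \<Rightarrow> nat list" where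
  "strand_word b k u = (if b then unfold (2 * k - 1) u else u)"

definition strand_set :: "bool \<Rightarrow> nat \<Rightarrow> nat set \<Rightarrow> nat set" where
  "strand_set b k J = (if b then folded (2 * k - 1) J else J)"

text \<open>The rank of the type A diagram in use; the strands themselves are numbered
  \<open>1..Suc (strands b k)\<close>.\<close>

definition strands :: "bool \<Rightarrow> nat \<Rightarrow> nat" where
  "strands b k = (if b then 2 * k - 1 else k)"

lemma half_odd: "1 \<le> k \<Longrightarrow> (2 * k - 1 + 1) div 2 = (k::nat)"
  by simp

lemma set_strand_word:
  assumes "1 \<le> k" "set u \<subseteq> {1..k}"
  shows "set (strand_word b k u) = strand_set b k (set u)"
proof (cases b)
  case True
  have "set u \<subseteq> {1..(2 * k - 1 + 1) div 2}" using assms half_odd by metis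
  then show ?thesis using True set_unfold[of u "2 * k - 1"] by (simp add: strand_word_def strand_set_def)
qed (simp add: strand_word_def strand_set_def)

lemma strand_set_subset:
  assumes "1 \<le> k" "J \<subseteq> {1..k}"
  shows "strand_set b k J \<subseteq> {1..strands b k}"
proof (cases b)
  case True
  have "J \<subseteq> {1..(2 * k - 1 + 1) div 2}" using assms half_odd by metis
  then show ?thesis using True folded_subset[of J "2 * k - 1"] by (simp add: strands_def strand_set_def)
qed (use assms in \<open>simp add: strands_def strand_set_def\<close>)

lemma strand_set_mem_iff:
  assumes "1 \<le> k" "J \<subseteq> {1..k}" "i \<in> {1..k}"
  shows "i \<in> strand_set b k J \<longleftrightarrow> i \<in> J"
proof (cases b)
  case True
  have "J \<subseteq> {1..(2 * k - 1 + 1) div 2}" "i \<le> (2 * k - 1 + 1) div 2" using assms half_odd[OF assms(1)] by simp_all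
  then show ?thesis using True folded_mem_iff(1)[of J "2 * k - 1" i] assms(3) by (simp add: strand_set_def)
qed (simp add: strand_set_def)

lemma cross_strand_delta:
  assumes k: "1 \<le> k" and J: "J \<subseteq> {1..k}"
    and yz: "y \<in> {1..Suc (strands b k)}" "z \<in> {1..Suc (strands b k)}" "y \<noteq> z"
  shows "cross (strand_word b k (delta b k J 1)) y z = (if sim (strand_set b k J) y z then 1 else 0)"
proof -
  have J1: "J \<inter> {1..} = J" using J by auto
  show ?thesis
  proof (cases b)
    case True
    then show ?thesis
      using cross_delta_B[of k "2 * k - 1" J y z 1] half_odd[OF k] J yz k unfolding J1
      by (simp add: strand_word_def strand_set_def strands_def)
  next
    case False
    then show ?thesis
      using cross_delta_A[OF J yz(3), of 1] unfolding J1
      by (simp add: strand_word_def strand_set_def)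
  qed
qed

lemma strand_word_append [simp]: "strand_word b k (u @ v) = strand_word b k u @ strand_word b k v"
  by (simp add: strand_word_def)

lemma unf_odd: "1 \<le> k \<Longrightarrow> i \<le> k \<Longrightarrow> unf (2 * k - Suc 0) i = (if i = k then [k] else [i, 2 * k - i])"
  by (cases "i = k") (auto simp: unf_def)

text \<open>Unlike the crossing numbers, the permutation of the strands survives the cancellation of
  squares and so is an invariant of Coxeter group elements.\<close>

lemma pos_strand_cox:
  assumes k: "1 \<le> k" and uv: "cox_eq (cox b k) u v"
  shows "pos (strand_word b k u) = pos (strand_word b k v)"
  using uv
proof (rule pres_cong_invariant)
  fix a c u v assume uv: "(u, v) \<in> coxeter_relations (cox b k)" "set u \<subseteq> nodes (cox b k)" "set v \<subseteq> nodes (cox b k)"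
  have "pos (strand_word b k u) = pos (strand_word b k v)"
  proof (cases "(u, v) \<in> braid_relations (cox b k)")
    case True
    then have B: "braid_eq (cox b k) u v" using uv by (intro pres_cong.rel) auto
    show ?thesis
    proof (cases b)
      case True
      then have "braid_eq (cox_B k) u v" using B by (simp add: cox_def)
      then have "braid_eq (cox_A (2 * k - 1)) (unfold (2 * k - 1) u) (unfold (2 * k - 1) v)"
        using half_odd[OF k] by (intro unfold_braid[of k]) simp_all
      then show ?thesis using True pos_cross_braid_A(1) by (simp add: strand_word_def)
    next
      case False
      then have "braid_eq (cox_A k) u v" using B by (simp add: cox_def)
      then show ?thesis using False pos_cross_braid_A(1) by (simp add: strand_word_def)
    qed
  next
    case False
    then obtain i where i: "u = [i, i]" "v = []" "i \<in> {1..k}"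
      using uv(1) by (auto simp: coxeter_relations_def)
    have "pos (strand_word b k [i, i]) y = y" for y
    proof (cases "b \<and> i < k")
      case True
      define e where "e = 2 * k - i"
      have e: "i + 2 \<le> e" using True unfolding e_def by linarith
      have "strand_word b k [i, i] = [i, e, i, e]"
        using True k by (simp add: strand_word_def unf_odd e_def)
      then show ?thesis using e by (simp add: tr_def)
    next
      case False
      then have "strand_word b k [i, i] = [i, i]" using i k by (auto simp: strand_word_def unf_odd)
      then show ?thesis by simp
    qed
    then show ?thesis using i by (simp add: fun_eq_iff strand_word_def)
  qed
  then show "pos (strand_word b k (a @ u @ c)) = pos (strand_word b k (a @ v @ c))"
    by (simp add: fun_eq_iff)
qed

text \<open>A letter below \<open>k\<close> unfolds to two letters and makes no mirror pair cross.
  The letter \<open>k\<close> unfolds to one letter and makes one mirror pair cross, counted in both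
  orders. So each letter contributes 4 to the left side.\<close>

lemma sum_cross_mirror:
  assumes k: "1 \<le> k" and u: "set u \<subseteq> {1..k}"
  shows "(\<Sum>y\<in>{1..2 * k}. cross (unfold (2 * k - 1) u) y (2 * k + 1 - y)) + 2 * length (unfold (2 * k - 1) u)
    = 4 * length u"
  using u
proof (induction u)
  case (Cons i u)
  let ?S = "{1..2 * k}"
  let ?U = "unfold (2 * k - 1)"
  let ?w = "unf (2 * k - 1) i"
  have i: "1 \<le> i" "i \<le> k" using Cons.prems by auto
  have n: "Suc (2 * k - 1) = 2 * k" using k by simp
  have sw: "set ?w \<subseteq> {1..2 * k - 1}" using i k by (auto simp: unf_odd)
  have bar: "pos ?w (2 * k + 1 - y) = 2 * k + 1 - pos ?w y" if "y \<in> ?S" for y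
  proof (cases "i = k")
    case True
    then show ?thesis using that k by (auto simp: unf_odd tr_def)
  next
    case False
    define e where "e = 2 * k - i"
    have e: "i + e = 2 * k" "i + 2 \<le> e" using False i unfolding e_def by linarith+
    have w: "?w = [i, e]" using False i k by (simp add: unf_odd e_def)
    have t: "tr e (tr i w) = (if w = i then Suc i else if w = Suc i then i else if w = e then Suc e
      else if w = Suc e then e else w)" for w
      using e(2) by (simp add: tr_def)
    define y' where "y' = 2 * k + 1 - y"
    have y': "y + y' = 2 * k + 1" using that unfolding y'_def by simp
    have iff: "y' = i \<longleftrightarrow> y = Suc e" "y' = Suc i \<longleftrightarrow> y = e" "y' = e \<longleftrightarrow> y = Suc i" "y' = Suc e \<longleftrightarrow> y = i"
      using y' e by linarith+
    have "tr e (tr i y') + tr e (tr i y) = 2 * k + 1"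
      unfolding t[of y'] iff t[of y] using e y' by auto
    moreover have "2 * k + 1 - y = y'" by (simp add: y'_def)
    ultimately show ?thesis unfolding w by simp
  qed
  have c: "(\<Sum>y\<in>?S. cross ?w y (2 * k + 1 - y)) = (if i = k then 2 else 0)"
  proof (cases "i = k")
    case True
    then have w: "?w = [k]" using k by (simp add: unf_odd)
    have "(\<Sum>y\<in>?S. cross ?w y (2 * k + 1 - y)) = (\<Sum>y\<in>?S. (if y = k then 1 else 0) + (if y = Suc k then 1 else 0))"
    proof (rule sum.cong[OF HOL.refl])
      fix y assume "y \<in> ?S"
      then have "crossing k y (2 * k + 1 - y) = (if y = k then 1 else 0) + (if y = Suc k then 1 else 0)"
        unfolding crossing_def by auto
      then show "cross ?w y (2 * k + 1 - y) = (if y = k then 1 else 0) + (if y = Suc k then 1 else 0)"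
        unfolding w by simp
    qed
    then show ?thesis using True k by (simp add: sum.distrib)
  next
    case False
    then have w: "?w = [i, 2 * k - i]" using i k by (simp add: unf_odd)
    have "cross ?w y (2 * k + 1 - y) = 0" if "y \<in> ?S" for y
      unfolding w using that i False by (auto simp: crossing_def tr_def)
    then show ?thesis using False by simp
  qed
  have "(\<Sum>y\<in>?S. cross (?U u) (pos ?w y) (2 * k + 1 - pos ?w y)) = (\<Sum>y\<in>?S. cross (?U u) y (2 * k + 1 - y))"
    using sum.reindex_bij_betw[OF pos_bij[OF sw], of "\<lambda>y. cross (?U u) y (2 * k + 1 - y)"] unfolding n .
  moreover have "(\<Sum>y\<in>?S. cross (?U u) (pos ?w y) (pos ?w (2 * k + 1 - y))) =
      (\<Sum>y\<in>?S. cross (?U u) (pos ?w y) (2 * k + 1 - pos ?w y))"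
    by (rule sum.cong) (simp_all only: bar)
  ultimately have "(\<Sum>y\<in>?S. cross (?U (i # u)) y (2 * k + 1 - y)) =
      (if i = k then 2 else 0) + (\<Sum>y\<in>?S. cross (?U u) y (2 * k + 1 - y))"
    using c by (simp add: sum.distrib)
  moreover have "2 * length (?U (i # u)) = (if i = k then 2 else 4) + 2 * length (?U u)"
    using i k by (simp add: unf_odd)
  ultimately show ?case using Cons by (simp split: if_splits)
qed simp

text \<open>Crossing numbers that are at most 1 are minimal for the permutation, and four times the
  length is a sum of crossing numbers that contains every pair. Equal lengths therefore force
  equality for every pair.\<close>

lemma length_le_if_pos_eq:
  assumes k: "1 \<le> k" and u: "set u \<subseteq> {1..k}" and v: "set v \<subseteq> {1..k}"
    and pos: "pos (strand_word b k u) = pos (strand_word b k v)"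
    and c: "\<And>y z. y \<in> {1..Suc (strands b k)} \<Longrightarrow> z \<in> {1..Suc (strands b k)} \<Longrightarrow> cross (strand_word b k u) y z \<le> 1"
  shows "length u \<le> length v"
    and "length u = length v \<Longrightarrow> y \<in> {1..Suc (strands b k)} \<Longrightarrow> z \<in> {1..Suc (strands b k)} \<Longrightarrow>
      cross (strand_word b k u) y z = cross (strand_word b k v) y z"
proof -
  let ?S = "{1..Suc (strands b k)}"
  let ?c = "\<lambda>u y z. cross (strand_word b k u) y z"
  let ?s = "\<lambda>u. \<Sum>p\<in>?S \<times> ?S. ?c u (fst p) (snd p)"
  \<comment> \<open>The mirror count corrects the crossing sum to a multiple of the length of the
    type B word. In type A the plain sum is taken twice, so that \<open>tot\<close> has one form for
    both types.\<close>
  define m where "m u = (if b then \<Sum>y\<in>?S. ?c u y (2 * k + 1 - y) else ?s u)" for u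
  have le: "?c u y z \<le> ?c v y z" if "y \<in> ?S" "z \<in> ?S" for y z
    by (rule cross_le_if_pos_eq[OF pos c[OF that]])
  have sl: "?s w = 2 * length (strand_word b k w)" if "set w \<subseteq> {1..k}" for w
  proof -
    have "set (strand_word b k w) \<subseteq> {1..strands b k}"
      using set_strand_word[OF k that] strand_set_subset[OF k that] by simp
    from sum_cross[OF this] show ?thesis by (simp only: sum.cartesian_product split_def)
  qed
  have tot: "?s w + m w = 4 * length w" if w: "set w \<subseteq> {1..k}" for w
  proof (cases b)
    case True
    then have "Suc (strands b k) = 2 * k" using k by (simp add: strands_def)
    then have "m w + 2 * length (strand_word b k w) = 4 * length w"
      using sum_cross_mirror[OF k w] True by (simp add: m_def strand_word_def)
    then show ?thesis using sl[OF w] by simp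
  next
    case False
    then show ?thesis using sl[OF w] by (simp add: m_def strand_word_def)
  qed
  have s: "?s u \<le> ?s v" using le by (intro sum_mono) auto
  have m: "m u \<le> m v"
  proof (cases b)
    case True
    then have "2 * k + 1 - y \<in> ?S" if "y \<in> ?S" for y using that k by (auto simp: strands_def)
    then have "(\<Sum>y\<in>?S. ?c u y (2 * k + 1 - y)) \<le> (\<Sum>y\<in>?S. ?c v y (2 * k + 1 - y))"
      by (intro sum_mono le)
    then show ?thesis using True by (simp only: m_def if_True)
  next
    case False
    then show ?thesis using s by (simp only: m_def if_False)
  qed
  show "length u \<le> length v" using s m tot[OF u] tot[OF v] by linarith
  assume "length u = length v" "y \<in> ?S" "z \<in> ?S"
  then have "?s u = ?s v" using s m tot[OF u] tot[OF v] by linarith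
  then have "?c u (fst (y, z)) (snd (y, z)) = ?c v (fst (y, z)) (snd (y, z))"
    by (rule sum_mono_inv) (use le \<open>y \<in> ?S\<close> \<open>z \<in> ?S\<close> in auto)
  then show "?c u y z = ?c v y z" by simp
qed

text \<open>All crossing numbers of \<open>delta\<close> are at most 1, so it is shortest for its
  permutation. An equally long competitor has the same crossing numbers; each of its letters makes
  some strands on opposite sides of it cross, and such a pair is related by \<open>sim\<close> only
  if the letter belongs to \<open>J\<close>.\<close>

lemma delta_reduced:
  assumes k: "1 \<le> k" and J: "J \<subseteq> {1..k}" and v: "set v \<subseteq> {1..k}"
    and pos: "pos (strand_word b k (delta b k J 1)) = pos (strand_word b k v)"
  shows "length (delta b k J 1) \<le> length v"
    and "length v = length (delta b k J 1) \<Longrightarrow> set v \<subseteq> J"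
proof -
  let ?d = "delta b k J 1"
  let ?S = "{1..Suc (strands b k)}"
  have d: "set ?d \<subseteq> {1..k}" using set_delta[of b k J 1] by auto
  have c: "cross (strand_word b k ?d) y z \<le> 1" if "y \<in> ?S" "z \<in> ?S" for y z
    using cross_strand_delta[OF k J that] by (cases "y = z") auto
  show "length ?d \<le> length v" using length_le_if_pos_eq(1)[OF k d v pos c] by blast
  assume l: "length v = length ?d"
  show "set v \<subseteq> J"
  proof
    fix i assume i: "i \<in> set v"
    have sv: "set (strand_word b k v) \<subseteq> {1..strands b k}"
      using set_strand_word[OF k v] strand_set_subset[OF k v] by simp
    have "i \<in> {1..k}" using i v by blast
    then have "i \<in> set (strand_word b k v)"
      using set_strand_word[OF k v] strand_set_mem_iff[OF k v] i by simp
    then obtain y z where yz: "y \<le> i" "i < z" "0 < cross (strand_word b k v) y z"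
      using cross_letter by blast
    have S: "y \<in> ?S" "z \<in> ?S"
      using cross_outside(2)[OF sv, of y z] cross_outside(2)[OF sv, of z y] yz(3)
      by (auto simp: cross_commute[of _ y z])
    have "cross (strand_word b k ?d) y z = cross (strand_word b k v) y z"
      using length_le_if_pos_eq(2)[OF k d v pos c] l S by simp
    then have "sim (strand_set b k J) y z"
      using cross_strand_delta[OF k J S] yz by (auto split: if_splits)
    then have "i \<in> strand_set b k J" using yz by (auto simp: sim_le)
    then show "i \<in> J" using strand_set_mem_iff[OF k J \<open>i \<in> {1..k}\<close>] by simp
  qed
qed

text \<open>The instance of Matsumoto's theorem on which everything rests. A normal form of this
  length is \<open>delta\<close> itself; a square would yield a shorter word with the same
  permutation.\<close>

lemma braid_eq_delta:
  assumes k: "1 \<le> k" and J: "J \<subseteq> {1..k}" and v: "set v \<subseteq> {1..k}"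
    and pos: "pos (strand_word b k (delta b k J 1)) = pos (strand_word b k v)"
    and l: "length v = length (delta b k J 1)"
  shows "braid_eq (cox b k) v (delta b k J 1)"
proof -
  have vJ: "set v \<subseteq> J" by (rule delta_reduced(2)[OF k J v pos l])
  obtain z where z: "braid_eq (cox b k) v z" "nf b k J 1 z \<or> has_square z"
    using word_nf[OF J vJ] by blast
  have zs: "set z = set v" "length z = length v" using braid_eq_set[OF z(1)] by auto
  show ?thesis
  proof (cases "nf b k J 1 z")
    case True
    then have "z = delta b k J 1" using nf_length[OF True] zs l by simp
    then show ?thesis using z(1) by simp
  next
    case False
    then obtain z' where z': "cox_eq (cox b k) z z'" "length z' < length z" "set z' \<subseteq> set z"
      using square_cox_shorter[of z "cox b k"] z(2) zs v by auto
    have "cox_eq (cox b k) v z'" using braid_imp_cox[OF z(1)] z'(1) by (rule pres_cong.trans)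
    then have "pos (strand_word b k (delta b k J 1)) = pos (strand_word b k z')"
      using pos pos_strand_cox[OF k] by metis
    moreover have "set z' \<subseteq> {1..k}" using z'(3) zs v by blast
    ultimately have "length (delta b k J 1) \<le> length z'"
      using delta_reduced(1)[OF k J] by blast
    then show ?thesis using z'(2) zs l by simp
  qed
qed

text \<open>The generators are involutions, so inverses contribute nothing beyond words over
  \<open>J\<close>.\<close>

lemma parabolic_words:
  assumes J: "J \<subseteq> nodes M"
  shows "parabolic M J = coxeter_class M ` {u. set u \<subseteq> J}"
proof
  interpret G: group "coxeter_group M" by (rule group_coxeter_group)
  have one: "\<one>\<^bsub>coxeter_group M\<^esub> = coxeter_class M []"
    by (simp add: coxeter_group_def presented_one)
  have mult: "coxeter_class M u \<otimes>\<^bsub>coxeter_group M\<^esub> coxeter_class M v = coxeter_class M (u @ v)"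
    if "set u \<subseteq> nodes M" "set v \<subseteq> nodes M" for u v
    unfolding coxeter_group_def using that by (intro presented_monoid_mult) auto
  have carr: "coxeter_class M u \<in> carrier (coxeter_group M)" if "set u \<subseteq> nodes M" for u
    unfolding coxeter_group_def presented_carrier using that by blast
  show "coxeter_class M ` {u. set u \<subseteq> J} \<subseteq> parabolic M J"
  proof
    fix x assume "x \<in> coxeter_class M ` {u. set u \<subseteq> J}"
    then obtain u where "set u \<subseteq> J" "x = coxeter_class M u" by blast
    then show "x \<in> parabolic M J"
    proof (induction u arbitrary: x)
      case Nil
      then show ?case unfolding parabolic_def using generate.one[of "coxeter_group M"] by (simp add: one)
    next
      case (Cons i u)
      have "coxeter_class M [i] \<in> parabolic M J"
        unfolding parabolic_def using Cons.prems(1)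
        by (intro generate.incl) (auto simp: coxeter_gen_def)
      moreover have "coxeter_class M u \<in> parabolic M J" using Cons by simp
      ultimately have "coxeter_class M [i] \<otimes>\<^bsub>coxeter_group M\<^esub> coxeter_class M u \<in> parabolic M J"
        unfolding parabolic_def by (rule generate.eng)
      moreover have "set [i] \<subseteq> nodes M" "set u \<subseteq> nodes M" using Cons.prems J by auto
      ultimately show ?case using mult[of "[i]" u] Cons.prems by simp
    qed
  qed
  show "parabolic M J \<subseteq> coxeter_class M ` {u. set u \<subseteq> J}"
  proof
    fix x assume "x \<in> parabolic M J"
    then show "x \<in> coxeter_class M ` {u. set u \<subseteq> J}"
      unfolding parabolic_def
    proof (induction rule: generate.induct)
      case one
      show ?case using \<open>\<one>\<^bsub>coxeter_group M\<^esub> = coxeter_class M []\<close> by (intro image_eqI[of _ _ "[]"]) auto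
    next
      case (incl h)
      then show ?case by (auto simp: coxeter_gen_def)
    next
      case (inv h)
      then obtain i where i: "i \<in> J" "h = coxeter_class M [i]" by (auto simp: coxeter_gen_def)
      then have "h \<otimes>\<^bsub>coxeter_group M\<^esub> h = \<one>\<^bsub>coxeter_group M\<^esub>"
        using mult[of "[i]" "[i]"] J pres_class_eqI[OF cox_eq_square[of i M]] by (auto simp: one)
      then have "inv\<^bsub>coxeter_group M\<^esub> h = h"
        using i J carr[of "[i]"] by (intro G.inv_equality) auto
      then show ?case using i by auto
    next
      case (eng h1 h2)
      then obtain u v where "set u \<subseteq> J" "h1 = coxeter_class M u" "set v \<subseteq> J" "h2 = coxeter_class M v" by blast
      then show ?case using mult[of u v] J by (intro image_eqI[of _ _ "u @ v"]) auto
    qed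
  qed
qed

text \<open>Independence of the choices made by \<open>arg_max\<close> and \<open>SOME\<close>.
  Normal forms bound the length in the parabolic subgroup by that of \<open>delta\<close>, the class
  of \<open>delta\<close> alone attains the bound, and each of its reduced words is braid equivalent
  to \<open>delta\<close>.\<close>

lemma artin_elt_longest:
  assumes k: "1 \<le> k" and J: "J \<subseteq> {1..k}"
  shows "artin_elt (cox b k) (longest_elt (cox b k) J) = artin_class (cox b k) (delta b k J 1)"
proof -
  let ?M = "cox b k"
  let ?d = "delta b k J 1"
  let ?cl = "coxeter_class ?M"
  have d: "set ?d \<subseteq> J" "set ?d \<subseteq> {1..k}" using set_delta[of b k J 1] by auto
  have par: "parabolic ?M J = ?cl ` {u. set u \<subseteq> J}" using J by (intro parabolic_words) simp
  have len: "coxeter_length w \<le> length u" if "u \<in> w" for u and w :: "nat list set"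
    unfolding coxeter_length_def using that by (intro Least_le) blast
  have red: "\<exists>u\<in>w. length u = coxeter_length w" if "u \<in> w" for u and w :: "nat list set"
    unfolding coxeter_length_def using that by (intro LeastI_ex[of "\<lambda>l. \<exists>u\<in>w. length u = l"]) blast
  have self: "u \<in> ?cl u" if "set u \<subseteq> {1..k}" for u
    using that unfolding pres_class_def by (auto intro: pres_cong.refl)
  have low: "length ?d \<le> length u" "length u = length ?d \<Longrightarrow> braid_eq ?M u ?d" if "u \<in> ?cl ?d" for u
  proof -
    have c: "cox_eq ?M ?d u" using that by (simp add: pres_class_def)
    then have u: "set u \<subseteq> {1..k}" using pres_cong_lists[OF c] by auto
    note p = pos_strand_cox[OF k c]
    show "length ?d \<le> length u" by (rule delta_reduced(1)[OF k J u p])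
    show "braid_eq ?M u ?d" if "length u = length ?d" by (rule braid_eq_delta[OF k J u p that])
  qed
  have nfw: "\<exists>v. w = ?cl v \<and> nf b k J 1 v \<and> v \<in> w" if w: "w \<in> parabolic ?M J" for w
  proof -
    obtain u where u: "set u \<subseteq> J" "w = ?cl u" using w par by blast
    obtain v where v: "cox_eq ?M u v" "nf b k J 1 v" using cox_nf[OF J u(1)] by blast
    have "?cl u = ?cl v" by (rule pres_class_eqI[OF v(1)])
    moreover have "v \<in> ?cl u" using v(1) by (simp add: pres_class_def)
    ultimately show ?thesis using u v by auto
  qed
  \<comment> \<open>\<open>arg_max\<close> is only meaningful once the lengths are known to be
    bounded.\<close>
  have bound: "\<forall>w. w \<in> parabolic ?M J \<longrightarrow> coxeter_length w < Suc (length ?d)"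
  proof (intro allI impI)
    fix w assume "w \<in> parabolic ?M J"
    then obtain v where v: "nf b k J 1 v" "v \<in> w" using nfw by blast
    then show "coxeter_length w < Suc (length ?d)"
      using len[OF v(2)] nf_length[OF v(1)] by linarith
  qed
  have dp: "?cl ?d \<in> parabolic ?M J" using d par by blast
  obtain r where "r \<in> ?cl ?d" "length r = coxeter_length (?cl ?d)" using red[OF self[OF d(2)]] by blast
  then have ld: "length ?d \<le> coxeter_length (?cl ?d)" using low(1) by metis
  define w where "w = longest_elt ?M J"
  have w: "w \<in> parabolic ?M J" unfolding w_def longest_elt_def by (rule arg_max_natI[OF dp bound])
  have lw: "length ?d \<le> coxeter_length w"
    using ld arg_max_nat_le[of "\<lambda>w. w \<in> parabolic ?M J", OF dp bound] unfolding w_def longest_elt_def by linarith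
  obtain v where v: "w = ?cl v" "nf b k J 1 v" "v \<in> w" using nfw[OF w] by blast
  have "v = ?d" using nf_length[OF v(2)] len[OF v(3)] lw by linarith
  then have wd: "w = ?cl ?d" using v by simp
  define u where "u = (SOME u. reduced_word w u)"
  have "\<exists>u. reduced_word w u" using red[OF v(3)] by (auto simp: reduced_word_def)
  then have "reduced_word w u" unfolding u_def by (rule someI_ex)
  then have u: "u \<in> ?cl ?d" "length u = coxeter_length w" by (simp_all add: reduced_word_def wd)
  have "length u = length ?d" using low(1)[OF u(1)] u(2) len[OF self[OF d(2)]] wd by simp
  then have "braid_eq ?M u ?d" by (rule low(2)[OF u(1)])
  then show ?thesis unfolding artin_elt_def w_def[symmetric] u_def[symmetric] by (rule pres_class_eqI)
qed

text \<open>Crossing numbers determine both the permutation and the length, which is all that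
  \<open>braid_eq_delta\<close> asks for.\<close>

lemma braid_eq_delta_A:
  assumes n: "1 \<le> n" and J: "J \<subseteq> {1..n}" and u: "set u \<subseteq> {1..n}"
    and c: "\<And>y z. y \<in> {1..Suc n} \<Longrightarrow> z \<in> {1..Suc n} \<Longrightarrow> y \<noteq> z \<Longrightarrow> cross u y z = (if sim J y z then 1 else 0)"
  shows "braid_eq (cox_A n) u (delta False n J 1)"
proof -
  let ?d = "delta False n J 1"
  have d: "set ?d \<subseteq> {1..n}" using set_delta[of False n J 1] by auto
  have eq: "cross ?d y z = cross u y z" if "y \<in> {1..Suc n}" "z \<in> {1..Suc n}" for y z
  proof (cases "y = z")
    case False
    then show ?thesis using cross_strand_delta[of n J y False z] n J that c[OF that False]
      by (simp add: strands_def strand_word_def strand_set_def)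
  qed simp
  have pos: "pos ?d = pos u" by (rule pos_eq_if_cross_eq[OF d u eq])
  have "(\<Sum>y\<in>{1..Suc n}. \<Sum>z\<in>{1..Suc n}. cross ?d y z) = (\<Sum>y\<in>{1..Suc n}. \<Sum>z\<in>{1..Suc n}. cross u y z)"
    by (intro sum.cong HOL.refl eq)
  then have "length u = length ?d" unfolding sum_cross[OF d] sum_cross[OF u] by simp
  then have "braid_eq (cox False n) u ?d"
    using n J u pos by (intro braid_eq_delta) (simp_all add: strand_word_def)
  then show ?thesis by (simp add: cox_def)
qed

section \<open>Positive definiteness of the form of a finite Coxeter group\<close>

text \<open>The Gram matrix of the simple roots. Vectors are functions on the index type, and
  \<open>pairing\<close> ignores their values outside \<open>nodes L\<close>.\<close>

definition cox_form :: "'a coxeter \<Rightarrow> 'a \<Rightarrow> 'a \<Rightarrow> real" where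
  "cox_form L i j = (if i = j then 1 else case bond L i j of enat k \<Rightarrow> - cos (pi / real k) | \<infinity> \<Rightarrow> - 1)"

definition pairing :: "'a coxeter \<Rightarrow> 'a \<Rightarrow> ('a \<Rightarrow> real) \<Rightarrow> real" where
  "pairing L i v = (\<Sum>j\<in>nodes L. cox_form L i j * v j)"

definition unit_at :: "'a \<Rightarrow> 'a \<Rightarrow> real" where
  "unit_at i = (\<lambda>t. if t = i then 1 else 0)"

text \<open>A generator of the Tits representation, in coordinates with respect to the simple
  roots.\<close>

definition reflect :: "'a coxeter \<Rightarrow> 'a \<Rightarrow> ('a \<Rightarrow> real) \<Rightarrow> 'a \<Rightarrow> real" where
  "reflect L i v = (\<lambda>t. v t - 2 * pairing L i v * unit_at i t)"

fun act :: "'a coxeter \<Rightarrow> 'a list \<Rightarrow> ('a \<Rightarrow> real) \<Rightarrow> 'a \<Rightarrow> real" where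
  "act L [] v = v"
| "act L (i # u) v = reflect L i (act L u v)"

lemma act_append: "act L (u @ v) x = act L u (act L v x)"
  by (induction u) auto

lemma pairing_linear: "pairing L i (\<lambda>t. v t + a * w t) = pairing L i v + a * pairing L i w"
  unfolding pairing_def by (simp add: algebra_simps sum.distrib sum_distrib_left)

lemma pairing_unit: "finite (nodes L) \<Longrightarrow> j \<in> nodes L \<Longrightarrow> pairing L i (unit_at j) = cox_form L i j"
proof -
  assume "finite (nodes L)" "j \<in> nodes L"
  moreover have "pairing L i (unit_at j) = (\<Sum>t\<in>nodes L. if t = j then cox_form L i t else 0)"
    unfolding pairing_def by (rule sum.cong) (auto simp: unit_at_def)
  ultimately show ?thesis by simp
qed

lemma reflect_linear: "reflect L i (\<lambda>t. v t + a * w t) = (\<lambda>t. reflect L i v t + a * reflect L i w t)"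
  unfolding reflect_def pairing_linear by (auto simp: algebra_simps)

lemma act_linear: "act L u (\<lambda>t. v t + a * w t) = (\<lambda>t. act L u v t + a * act L u w t)"
  by (induction u) (simp_all add: reflect_linear)

lemma pairing_reflect:
  "finite (nodes L) \<Longrightarrow> i \<in> nodes L \<Longrightarrow> pairing L i (reflect L i v) = - pairing L i v"
  using pairing_linear[of L i v "- 2 * pairing L i v" "unit_at i"] pairing_unit[of L i i]
  by (simp add: reflect_def cox_form_def)

lemma reflect_reflect: "finite (nodes L) \<Longrightarrow> i \<in> nodes L \<Longrightarrow> reflect L i (reflect L i v) = v"
  by (subst reflect_def) (simp add: pairing_reflect, simp add: reflect_def)

text \<open>The solution \<open>s\<close> of \<open>s (t + 1) = 2 * cos \<theta> * s t - s (t - 1)\<close> with \<open>s 0 = a\<close> and \<open>s (- 1) = b\<close>;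
  it governs the coordinates of a vector under alternating reflections.\<close>

definition cheb :: "real \<Rightarrow> real \<Rightarrow> real \<Rightarrow> real \<Rightarrow> real" where
  "cheb \<theta> t a b = (sin ((t + 1) * \<theta>) * a - sin (t * \<theta>) * b) / sin \<theta>"

lemma cheb_step: "sin \<theta> \<noteq> 0 \<Longrightarrow> 2 * cos \<theta> * cheb \<theta> t a b - cheb \<theta> (t - 1) a b = cheb \<theta> (t + 1) a b"
proof -
  have *: "2 * cos \<theta> * sin (s * \<theta>) - sin ((s - 1) * \<theta>) = sin ((s + 1) * \<theta>)" for s
    by (simp add: algebra_simps sin_add sin_diff)
  have "2 * cos \<theta> * (sin ((t + 1) * \<theta>) * a - sin (t * \<theta>) * b) - (sin ((t - 1 + 1) * \<theta>) * a - sin ((t - 1) * \<theta>) * b)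
    = (2 * cos \<theta> * sin ((t + 1) * \<theta>) - sin (((t + 1) - 1) * \<theta>)) * a - (2 * cos \<theta> * sin (t * \<theta>) - sin ((t - 1) * \<theta>)) * b"
    by (simp add: algebra_simps)
  also have "\<dots> = sin ((t + 1 + 1) * \<theta>) * a - sin ((t + 1) * \<theta>) * b"
    unfolding * ..
  finally show ?thesis unfolding cheb_def by (simp add: diff_divide_distrib[symmetric])
qed

text \<open>Only the component in the plane of the two roots moves, and the form is nondegenerate
  there. Under alternating reflections its coordinates follow the recursion of \<open>cheb\<close>
  with angle \<open>pi / k\<close>, so after \<open>k\<close> steps both orders reach the same
  point.\<close>

lemma act_braid:
  assumes fin: "finite (nodes L)" and ij: "i \<in> nodes L" "j \<in> nodes L" "i \<noteq> j"
    and bond: "bond L i j = enat k" "bond L j i = enat k" and k: "2 \<le> k"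
  shows "act L (alt_word k i j) v = act L (alt_word k j i) v"
proof -
  define \<theta> where "\<theta> = pi / real k"
  define c where "c = cos \<theta>"
  have "\<theta> \<le> pi / 2" unfolding \<theta>_def by (rule divide_left_mono) (use k in auto)
  moreover have "0 < \<theta>" using k unfolding \<theta>_def by simp
  ultimately have s: "sin \<theta> > 0" using pi_gt_zero by (intro sin_gt_zero) linarith+
  have "1 - c\<^sup>2 = (sin \<theta>)\<^sup>2" unfolding c_def by (simp add: sin_squared_eq)
  then have c2: "1 - c\<^sup>2 \<noteq> 0" using s by simp
  have Bij: "cox_form L i j = - c" "cox_form L j i = - c" "cox_form L i i = 1" "cox_form L j j = 1"
    using bond ij by (auto simp: cox_form_def c_def \<theta>_def)
  define p where "p = pairing L i v"
  define q where "q = pairing L j v"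
  \<comment> \<open>\<open>X\<close> and \<open>Y\<close> are the coordinates of the orthogonal
    projection of \<open>v\<close> to this plane. They solve \<open>p = X - c * Y\<close>,
    \<open>q = Y - c * X\<close>, a system with determinant \<open>1 - c^2\<close>.\<close>
  define X where "X = (p + c * q) / (1 - c\<^sup>2)"
  define Y where "Y = (q + c * p) / (1 - c\<^sup>2)"
  have X: "p = X - c * Y" "q = Y - c * X"
  proof -
    have "X - c * Y = ((p + c * q) - c * (q + c * p)) / (1 - c\<^sup>2)" unfolding X_def Y_def by (simp add: diff_divide_distrib)
    also have "(p + c * q) - c * (q + c * p) = p * (1 - c\<^sup>2)" by (simp add: algebra_simps power2_eq_square)
    finally show "p = X - c * Y" using c2 by simp
    have "Y - c * X = ((q + c * p) - c * (p + c * q)) / (1 - c\<^sup>2)" unfolding X_def Y_def by (simp add: diff_divide_distrib)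
    also have "(q + c * p) - c * (p + c * q) = q * (1 - c\<^sup>2)" by (simp add: algebra_simps power2_eq_square)
    finally show "q = Y - c * X" using c2 by simp
  qed
  \<comment> \<open>\<open>v\<close> with its plane coordinates \<open>X\<close>, \<open>Y\<close>
    replaced by \<open>x\<close>, \<open>y\<close>; the orthogonal component is kept.\<close>
  define W where "W x y = (\<lambda>t. (v t + (x - X) * unit_at i t) + (y - Y) * unit_at j t)" for x y
  have pW: "pairing L i (W x y) = x - c * y" "pairing L j (W x y) = y - c * x" for x y
    unfolding W_def pairing_linear pairing_unit[OF fin ij(1)] pairing_unit[OF fin ij(2)] Bij
    using X by (simp_all add: p_def[symmetric] q_def[symmetric] algebra_simps)
  have rW: "reflect L i (W x y) = W (2 * c * y - x) y" "reflect L j (W x y) = W x (2 * c * x - y)" for x y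
    unfolding reflect_def pW by (auto simp: W_def algebra_simps)
  have step: "2 * c * cheb \<theta> t a b - cheb \<theta> (t - 1) a b = cheb \<theta> (t + 1) a b" for t a b
    unfolding c_def using s by (intro cheb_step) auto
  have main: "act L (alt_word l i j) (W x y) =
      (if even l then W (cheb \<theta> l x y) (cheb \<theta> (real l - 1) x y) else W (cheb \<theta> l y x) (cheb \<theta> (real l - 1) y x)) \<and>
    act L (alt_word l j i) (W x y) =
      (if even l then W (cheb \<theta> (real l - 1) y x) (cheb \<theta> l y x) else W (cheb \<theta> (real l - 1) x y) (cheb \<theta> l x y))"
    for l x y
  proof (induction l)
    case 0
    then show ?case using s by (simp add: cheb_def)
  next
    case (Suc l)
    have "real (Suc l) - 1 = real l" "real (Suc l) = real l + 1" by simp_all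
    then show ?case using Suc step[of "real l", unfolded add.commute[of "real l" 1]] by (cases "even l") (simp_all add: rW)
  qed
  have kt: "real k * \<theta> = pi" using k by (simp add: \<theta>_def)
  have e: "(real k + 1) * \<theta> = pi + \<theta>" "(real k - 1 + 1) * \<theta> = pi" "(real k - 1) * \<theta> = pi - \<theta>"
    using kt by (simp_all add: distrib_right left_diff_distrib)
  \<comment> \<open>So in both orders the coordinates become \<open>-X\<close>, \<open>-Y\<close>
    for even \<open>k\<close> and \<open>-Y\<close>, \<open>-X\<close> for odd
    \<open>k\<close>.\<close>
  have "cheb \<theta> (real k) a b = - a" "cheb \<theta> (real k - 1) a b = - b" for a b
    using s unfolding cheb_def e kt by simp_all
  moreover have "v = W X Y" by (simp add: W_def)
  ultimately show ?thesis using main[of k X Y] by (cases "even k") auto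
qed

lemma act_cox_eq:
  assumes cm: "coxeter_matrix L" and fin: "finite (nodes L)" and uv: "cox_eq L u v"
  shows "act L u = act L v"
  using uv
proof (rule pres_cong_invariant)
  fix a b u v assume uv: "(u, v) \<in> coxeter_relations L"
  have "act L u = act L v"
  proof (cases "(u, v) \<in> braid_relations L")
    case True
    then obtain k i j where *: "u = alt_word k i j" "v = alt_word k j i" "i \<in> nodes L" "j \<in> nodes L" "i \<noteq> j"
      "bond L i j = enat k"
      by (auto simp: braid_relations_def)
    then have "bond L j i = enat k" "2 \<le> bond L i j" using cm unfolding coxeter_matrix_def by metis+
    moreover from this have "2 \<le> k" using * by simp
    ultimately have "2 \<le> k" "bond L j i = enat k" by simp_all
    then show ?thesis using * act_braid[OF fin] \<open>bond L j i = enat k\<close> by (metis ext)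
  next
    case False
    then show ?thesis using uv reflect_reflect[OF fin] by (auto simp: coxeter_relations_def fun_eq_iff)
  qed
  then show "act L (a @ u @ b) = act L (a @ v @ b)" by (intro ext) (simp add: act_append)
qed

lemma irreducible_closed:
  assumes irr: "coxeter_irreducible L" and A: "A \<subseteq> nodes L" "x \<in> A"
    and cl: "\<And>x y. x \<in> A \<Longrightarrow> y \<in> nodes L \<Longrightarrow> x \<noteq> y \<Longrightarrow> 2 < bond L x y \<Longrightarrow> y \<in> A"
  shows "A = nodes L"
proof
  show "nodes L \<subseteq> A"
  proof
    fix y assume "y \<in> nodes L"
    then have "(x, y) \<in> {(a, b). a \<in> nodes L \<and> b \<in> nodes L \<and> a \<noteq> b \<and> 2 < bond L a b}\<^sup>*"
      using irr A unfolding coxeter_irreducible_def by blast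
    then show "y \<in> A"
    proof (induction rule: rtrancl_induct)
      case (step y z)
      then show ?case using cl by blast
    qed (rule A(2))
  qed
qed (rule A(1))

lemma three_le_iff: "3 \<le> (b :: enat) \<longleftrightarrow> 2 < b"
  by (cases b) (auto simp: numeral_eq_enat)

lemma cox_form_le:
  assumes "i \<noteq> j" "enat m \<le> bond L i j" "2 \<le> m"
  shows "cox_form L i j \<le> - cos (pi / real m)"
proof (cases "bond L i j")
  case (enat k)
  then have mk: "m \<le> k" using assms(2) by simp
  have "pi / real k \<le> pi / real m" using mk assms(3) by (intro divide_left_mono) auto
  moreover have "pi / real m \<le> pi / 1" using assms(3) by (intro divide_left_mono) auto
  ultimately have "cos (pi / real m) \<le> cos (pi / real k)" by (intro cos_monotone_0_pi_le) auto
  then show ?thesis using enat assms(1) by (simp add: cox_form_def)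
next
  case infinity
  then show ?thesis using assms(1) by (simp add: cox_form_def)
qed

text \<open>Since \<open>s\<^sub>i\<close> is orthogonal for the averaged inner product \<open>ip\<close>, one gets
  \<open>ip e\<^sub>i w = ip e\<^sub>i e\<^sub>i * B(e\<^sub>i, w)\<close>; by symmetry and irreducibility \<open>ip e\<^sub>i e\<^sub>i\<close> does not depend on \<open>i\<close>,
  so \<open>B\<close> is a positive multiple of \<open>ip\<close>.\<close>

lemma finite_type_pos_def:
  assumes cm: "coxeter_matrix L" and irr: "coxeter_irreducible L" and ft: "finite_type L"
    and fin: "finite (nodes L)" and i0: "i0 \<in> nodes L" "v i0 \<noteq> 0"
  shows "0 < (\<Sum>i\<in>nodes L. \<Sum>j\<in>nodes L. v i * v j * cox_form L i j)"
proof -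
  let ?I = "nodes L"
  \<comment> \<open>The operators by which the Coxeter group acts. A class determines its operator,
    so \<open>G\<close> inherits finiteness from the group.\<close>
  define G where "G = act L ` {u. set u \<subseteq> ?I}"
  have "finite G"
  proof -
    have "finite (coxeter_class L ` {u. set u \<subseteq> ?I})"
      using ft unfolding finite_type_def coxeter_group_def presented_carrier .
    moreover have "G \<subseteq> (\<lambda>X. act L (SOME u. u \<in> X)) ` coxeter_class L ` {u. set u \<subseteq> ?I}"
    proof
      fix g assume "g \<in> G"
      then obtain u where u: "set u \<subseteq> ?I" "g = act L u" unfolding G_def by blast
      have "u \<in> coxeter_class L u" using u by (auto simp: pres_class_def intro: pres_cong.refl)
      then have "(SOME u'. u' \<in> coxeter_class L u) \<in> coxeter_class L u" by (rule someI)
      then have "cox_eq L u (SOME u'. u' \<in> coxeter_class L u)" by (simp add: pres_class_def)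
      from act_cox_eq[OF cm fin this] show "g \<in> (\<lambda>X. act L (SOME u. u \<in> X)) ` coxeter_class L ` {u. set u \<subseteq> ?I}"
        using u by blast
    qed
    ultimately show ?thesis by (meson finite_imageI finite_subset)
  qed
  define ip where "ip x y = (\<Sum>g\<in>G. \<Sum>t\<in>?I. g x t * g y t)" for x y
  have lin: "g (\<lambda>t. x t + a * y t) = (\<lambda>t. g x t + a * g y t)" if "g \<in> G" for g a x y
    using that act_linear unfolding G_def by blast
  have sym: "ip x y = ip y x" for x y unfolding ip_def by (simp add: mult.commute)
  have ip_lin: "ip (\<lambda>t. x t + a * y t) z = ip x z + a * ip y z" for x a y z
  proof -
    have "ip (\<lambda>t. x t + a * y t) z = (\<Sum>g\<in>G. \<Sum>t\<in>?I. g x t * g z t + a * (g y t * g z t))"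
      unfolding ip_def by (intro sum.cong HOL.refl) (simp add: lin algebra_simps)
    then show ?thesis unfolding ip_def by (simp add: sum.distrib sum_distrib_left)
  qed
  have id: "(\<lambda>x. x) \<in> G"
  proof -
    have "act L [] = (\<lambda>x. x)" by (simp add: fun_eq_iff)
    then show ?thesis unfolding G_def by (metis (mono_tags) empty_set empty_subsetI image_eqI mem_Collect_eq)
  qed
  have ip_pos: "0 < ip x x" if "t \<in> ?I" "x t \<noteq> 0" for x t
  proof -
    have "0 < (\<Sum>t\<in>?I. x t * x t)"
      using that fin by (intro sum_pos2[of _ t]) (auto simp: zero_less_mult_iff)
    moreover have "(\<lambda>g. \<Sum>t\<in>?I. g x t * g x t) (\<lambda>x. x) \<le> (\<Sum>g\<in>G. \<Sum>t\<in>?I. g x t * g x t)"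
      using id \<open>finite G\<close> by (intro member_le_sum) (simp_all add: sum_nonneg)
    ultimately show ?thesis unfolding ip_def by simp
  qed
  have inv: "ip (reflect L i x) (reflect L i y) = ip x y" if i: "i \<in> ?I" for i x y
  proof -
    have m: "g \<circ> reflect L i \<in> G" if g: "g \<in> G" for g
    proof -
      obtain u where u: "set u \<subseteq> ?I" "g = act L u" using g unfolding G_def by blast
      then have "g \<circ> reflect L i = act L (u @ [i])" by (simp add: fun_eq_iff act_append)
      moreover have "set (u @ [i]) \<subseteq> ?I" using u i by simp
      ultimately show ?thesis unfolding G_def by blast
    qed
    have rr: "(g \<circ> reflect L i) \<circ> reflect L i = g" for g :: "('a \<Rightarrow> real) \<Rightarrow> 'a \<Rightarrow> real"
      by (rule ext) (simp add: reflect_reflect[OF fin i])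
    have "bij_betw (\<lambda>g. g \<circ> reflect L i) G G"
      by (rule bij_betw_byWitness[where f' = "\<lambda>g. g \<circ> reflect L i"]) (use m rr in auto)
    from sum.reindex_bij_betw[OF this, of "\<lambda>g. \<Sum>t\<in>?I. g x t * g y t"] show ?thesis
      unfolding ip_def by simp
  qed
  have key: "ip (unit_at i) w = pairing L i w * ip (unit_at i) (unit_at i)" if i: "i \<in> ?I" for i w
  proof -
    have r1: "reflect L i (unit_at i) = (\<lambda>t. unit_at i t + (- 2) * unit_at i t)"
      using pairing_unit[OF fin i, of i] by (simp add: reflect_def cox_form_def)
    have r2: "reflect L i w = (\<lambda>t. w t + (- 2 * pairing L i w) * unit_at i t)"
      by (simp add: reflect_def)
    have 1: "ip (unit_at i) w = ip (reflect L i (unit_at i)) (reflect L i w)" using inv[OF i] by simp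
    have 2: "ip (reflect L i (unit_at i)) (reflect L i w) = - ip (unit_at i) (reflect L i w)"
      unfolding r1 ip_lin by simp
    have 3: "ip (reflect L i w) (unit_at i) = ip w (unit_at i) + (- 2 * pairing L i w) * ip (unit_at i) (unit_at i)"
      unfolding r2 ip_lin ..
    show ?thesis
      using 1 2 3 sym[of w "unit_at i"] sym[of "reflect L i w" "unit_at i"] by linarith
  qed
  define c where "c = ip (unit_at i0) (unit_at i0)"
  have c: "c > 0" unfolding c_def by (rule ip_pos[OF i0(1)]) (simp add: unit_at_def)
  have "{i \<in> ?I. ip (unit_at i) (unit_at i) = c} = ?I"
  proof (rule irreducible_closed[OF irr, of _ i0])
    fix x y assume x: "x \<in> {i \<in> ?I. ip (unit_at i) (unit_at i) = c}" and y: "y \<in> ?I" "x \<noteq> y" "2 < bond L x y"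
    have xy: "x \<in> ?I" using x by simp
    have B: "cox_form L y x = cox_form L x y"
    proof -
      have "bond L x y = bond L y x" using cm xy y unfolding coxeter_matrix_def by metis
      then show ?thesis using y by (simp add: cox_form_def)
    qed
    have "cox_form L x y \<le> - cos (pi / real 3)"
      using y three_le_iff[of "bond L x y"] by (intro cox_form_le) (auto simp: numeral_eq_enat)
    then have "cox_form L x y \<noteq> 0" by (simp add: cos_60)
    moreover have "cox_form L x y * ip (unit_at x) (unit_at x) = cox_form L x y * ip (unit_at y) (unit_at y)"
      using key[OF xy, of "unit_at y"] key[OF y(1), of "unit_at x"] sym[of "unit_at x" "unit_at y"]
      unfolding pairing_unit[OF fin xy] pairing_unit[OF fin y(1)] B by linarith
    ultimately show "y \<in> {i \<in> ?I. ip (unit_at i) (unit_at i) = c}" using x y by simp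
  qed (use i0 in \<open>auto simp: c_def\<close>)
  then have cc: "ip (unit_at i) w = c * pairing L i w" if "i \<in> ?I" for i w
    using key[OF that, of w] that by auto
  \<comment> \<open>Combinations of the unit vectors vanish outside \<open>nodes L\<close>, so
    \<open>v\<close> is cut off there.\<close>
  define v' where "v' = (\<lambda>t. if t \<in> ?I then v t else 0)"
  have exp: "ip (\<lambda>t. \<Sum>i\<in>S. v i * unit_at i t) w = (\<Sum>i\<in>S. v i * ip (unit_at i) w)" if "finite S" for S w
    using that
  proof (induction S)
    case empty
    have "ip (\<lambda>t. 0) w = 0" using ip_lin[of "\<lambda>t. 0" "-1" "\<lambda>t. 0" w] by simp
    then show ?case by simp
  next
    case (insert i S)
    have "(\<lambda>t. \<Sum>i\<in>insert i S. v i * unit_at i t) = (\<lambda>t. (\<Sum>i\<in>S. v i * unit_at i t) + v i * unit_at i t)"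
      using insert by (simp add: add.commute)
    then show ?case using insert ip_lin[of "\<lambda>t. \<Sum>i\<in>S. v i * unit_at i t" "v i" "unit_at i" w] by simp
  qed
  have "v' = (\<lambda>t. \<Sum>i\<in>?I. v i * unit_at i t)"
  proof
    fix t
    have "(\<Sum>i\<in>?I. v i * unit_at i t) = (\<Sum>i\<in>?I. if t = i then v i else 0)"
      by (rule sum.cong) (auto simp: unit_at_def)
    then show "v' t = (\<Sum>i\<in>?I. v i * unit_at i t)" using fin by (simp add: v'_def)
  qed
  then have "ip v' v' = (\<Sum>i\<in>?I. v i * ip (unit_at i) v')" using exp[OF fin, of v'] by simp
  also have "\<dots> = (\<Sum>i\<in>?I. v i * (c * pairing L i v'))" by (intro sum.cong) (simp_all add: cc)
  also have "\<dots> = c * (\<Sum>i\<in>?I. \<Sum>j\<in>?I. v i * v j * cox_form L i j)"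
    unfolding pairing_def sum_distrib_left v'_def by (intro sum.cong) (simp_all add: mult_ac)
  finally have "ip v' v' = c * (\<Sum>i\<in>?I. \<Sum>j\<in>?I. v i * v j * cox_form L i j)" .
  moreover have "0 < ip v' v'" using i0 by (intro ip_pos[of i0]) (simp_all add: v'_def)
  ultimately show ?thesis using c by (simp add: zero_less_mult_iff)
qed

section \<open>Consequences of positive definiteness for the Coxeter graph\<close>

locale finite_irreducible =
  fixes L :: "'a coxeter"
  assumes cm: "coxeter_matrix L" and irr: "coxeter_irreducible L" and ft: "finite_type L"
    and fin: "finite (nodes L)"
begin

abbreviation (input) B :: "'a \<Rightarrow> 'a \<Rightarrow> real" where "B \<equiv> cox_form L"

lemma bond_sym: "i \<in> nodes L \<Longrightarrow> j \<in> nodes L \<Longrightarrow> bond L i j = bond L j i"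
  using cm unfolding coxeter_matrix_def by metis

lemma B_sym: "i \<in> nodes L \<Longrightarrow> j \<in> nodes L \<Longrightarrow> B i j = B j i"
  using bond_sym[of i j] by (auto simp: cox_form_def)

lemma B_le:
  assumes "i \<in> nodes L" "j \<in> nodes L" "i \<noteq> j"
  shows "B i j \<le> 0"
    and "3 \<le> bond L i j \<Longrightarrow> B i j \<le> - 1 / 2"
    and "4 \<le> bond L i j \<Longrightarrow> B i j \<le> - sqrt 2 / 2"
    and "6 \<le> bond L i j \<Longrightarrow> B i j \<le> - sqrt 3 / 2"
proof -
  have "enat 2 \<le> bond L i j" using cm assms unfolding coxeter_matrix_def by (metis numeral_eq_enat)
  from cox_form_le[OF assms(3) this] show "B i j \<le> 0" by simp
  show "B i j \<le> - 1 / 2" if "3 \<le> bond L i j"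
    using cox_form_le[of i j 3 L] assms that by (simp add: numeral_eq_enat cos_60)
  show "B i j \<le> - sqrt 2 / 2" if "4 \<le> bond L i j"
    using cox_form_le[of i j 4 L] assms that by (simp add: numeral_eq_enat cos_45)
  show "B i j \<le> - sqrt 3 / 2" if "6 \<le> bond L i j"
    using cox_form_le[of i j 6 L] assms that by (simp add: numeral_eq_enat cos_30)
qed

lemma form_pos:
  assumes S: "S \<subseteq> nodes L" and i: "i \<in> S" "v i \<noteq> 0"
  shows "0 < (\<Sum>i\<in>S. \<Sum>j\<in>S. v i * v j * B i j)"
proof -
  define w where "w = (\<lambda>t. if t \<in> S then v t else 0)"
  have "0 < (\<Sum>i\<in>nodes L. \<Sum>j\<in>nodes L. w i * w j * B i j)"
    using i S by (intro finite_type_pos_def[OF cm irr ft fin, of i]) (auto simp: w_def)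
  also have "(\<Sum>i\<in>nodes L. \<Sum>j\<in>nodes L. w i * w j * B i j) = (\<Sum>i\<in>S. \<Sum>j\<in>nodes L. w i * w j * B i j)"
    by (rule sum.mono_neutral_right[OF fin S]) (auto simp: w_def)
  also have "\<dots> = (\<Sum>i\<in>S. \<Sum>j\<in>S. w i * w j * B i j)"
    by (rule sum.cong[OF HOL.refl], rule sum.mono_neutral_right[OF fin S]) (auto simp: w_def)
  also have "\<dots> = (\<Sum>i\<in>S. \<Sum>j\<in>S. v i * v j * B i j)"
    by (intro sum.cong) (auto simp: w_def)
  finally show ?thesis .
qed

text \<open>The vector \<open>(sqrt 3, 2, 1)\<close> on \<open>i, j, l\<close> is the null vector of
  the affine diagram of type \<open>G_2\<close>; larger bonds, or an edge between \<open>i\<close>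
  and \<open>l\<close>, only lower its norm.\<close>

lemma bond_ge_6:
  assumes "i \<in> nodes L" "j \<in> nodes L" "l \<in> nodes L" "i \<noteq> j" "l \<noteq> j" "l \<noteq> i"
    and "6 \<le> bond L i j" "3 \<le> bond L j l"
  shows False
proof -
  define v where "v = (\<lambda>t. if t = i then sqrt 3 else if t = j then 2 else 1 :: real)"
  have v: "v i = sqrt 3" "v j = 2" "v l = 1" using assms by (auto simp: v_def)
  have s: "sqrt 3 * sqrt 3 = (3::real)" by simp
  have b: "B i j \<le> - sqrt 3 / 2" "B j l \<le> - 1 / 2" "B i l \<le> 0"
    using B_le(4)[of i j] B_le(2)[of j l] B_le(1)[of i l] assms by auto
  have "sqrt 3 * B i j \<le> sqrt 3 * (- sqrt 3 / 2)" by (rule mult_left_mono[OF b(1)]) simp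
  moreover have "sqrt 3 * B i l \<le> 0" using b(3) by (simp add: mult_le_0_iff)
  moreover note b(2)
  moreover have "B i i = 1" "B j j = 1" "B l l = 1" by (simp_all add: cox_form_def)
  moreover have "B j i = B i j" "B l i = B i l" "B l j = B j l" using assms B_sym by metis+
  moreover have "0 < (\<Sum>x\<in>{i, j, l}. \<Sum>y\<in>{i, j, l}. v x * v y * B x y)"
    using assms v by (intro form_pos[of _ l]) auto
  ultimately show False using assms v s by (simp add: algebra_simps)
qed

definition form_of :: "'a set \<Rightarrow> real" where
  "form_of S = (\<Sum>i\<in>S. \<Sum>j\<in>S. B i j)"

text \<open>Connected sets of vertices, built by adding one neighbour at a time, which is the form
  needed for the estimate \<open>chained_form\<close>.\<close>

inductive chained :: "'a set \<Rightarrow> bool" where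
  chained_single: "x \<in> nodes L \<Longrightarrow> chained {x}"
| chained_insert: "chained S \<Longrightarrow> y \<in> nodes L \<Longrightarrow> y \<notin> S \<Longrightarrow> z \<in> S \<Longrightarrow> 3 \<le> bond L y z \<Longrightarrow> chained (insert y S)"

lemma chained_nodes: "chained S \<Longrightarrow> S \<subseteq> nodes L"
  by (induction rule: chained.induct) auto

lemma chained_finite: "chained S \<Longrightarrow> finite S"
  using chained_nodes fin finite_subset by blast

lemma sum_B_le:
  assumes "S \<subseteq> nodes L" "y \<in> nodes L" "y \<notin> S" "T \<subseteq> S"
  shows "(\<Sum>s\<in>S. B y s) \<le> (\<Sum>s\<in>T. B y s)"
proof -
  have fS: "finite S" using assms(1) fin finite_subset by blast
  have "(\<Sum>s\<in>S. B y s) = (\<Sum>s\<in>S - T. B y s) + (\<Sum>s\<in>T. B y s)"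
    by (rule sum.subset_diff[OF assms(4) fS])
  moreover have "(\<Sum>s\<in>S - T. B y s) \<le> 0"
    using assms by (intro sum_nonpos B_le(1)) auto
  ultimately show ?thesis by simp
qed

lemma form_of_insert:
  assumes "S \<subseteq> nodes L" "y \<in> nodes L" "y \<notin> S"
  shows "form_of (insert y S) = form_of S + 1 + 2 * (\<Sum>s\<in>S. B y s)"
proof -
  have fS: "finite S" using assms(1) fin finite_subset by blast
  have "(\<Sum>s\<in>S. B s y) = (\<Sum>s\<in>S. B y s)" using assms by (intro sum.cong B_sym) auto
  moreover have "B y y = 1" by (simp add: cox_form_def)
  ultimately show ?thesis using fS assms(3) by (simp add: form_of_def sum.distrib)
qed

text \<open>A new vertex adds 1 on the diagonal and at most -1 through an edge to the set.\<close>

lemma chained_form: "chained S \<Longrightarrow> form_of S \<le> 1"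
proof (induction rule: chained.induct)
  case (chained_single x)
  then show ?case by (simp add: form_of_def cox_form_def)
next
  case (chained_insert S y z)
  have S: "S \<subseteq> nodes L" by (rule chained_nodes[OF chained_insert(1)])
  have "(\<Sum>s\<in>S. B y s) \<le> (\<Sum>s\<in>{z}. B y s)"
    using S chained_insert by (intro sum_B_le) auto
  moreover have "B y z \<le> - 1 / 2" using S chained_insert by (intro B_le) auto
  ultimately show ?case using form_of_insert[OF S] chained_insert by simp
qed

text \<open>The vector with entry \<open>sqrt 2\<close> on \<open>S\<close> and \<open>1\<close> at \<open>u\<close> and \<open>u'\<close> has nonpositive norm.\<close>

lemma two_heavy_outside:
  assumes S: "chained S" and u: "u \<in> nodes L" "u' \<in> nodes L" "u \<notin> S" "u' \<notin> S" "u \<noteq> u'"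
    and p: "p \<in> S" "p' \<in> S" "4 \<le> bond L u p" "4 \<le> bond L u' p'"
  shows False
proof -
  have SL: "S \<subseteq> nodes L" by (rule chained_nodes[OF S])
  define v where "v = (\<lambda>t. if t \<in> S then sqrt 2 else 1 :: real)"
  let ?A = "\<Sum>s\<in>S. B u s"
  let ?A' = "\<Sum>s\<in>S. B u' s"
  have A: "?A \<le> - sqrt 2 / 2"
  proof -
    have "?A \<le> (\<Sum>s\<in>{p}. B u s)" using SL u p by (intro sum_B_le) auto
    moreover have "B u p \<le> - sqrt 2 / 2" using SL u p by (intro B_le) auto
    ultimately show ?thesis by simp
  qed
  have A': "?A' \<le> - sqrt 2 / 2"
  proof -
    have "?A' \<le> (\<Sum>s\<in>{p'}. B u' s)" using SL u p by (intro sum_B_le) auto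
    moreover have "B u' p' \<le> - sqrt 2 / 2" using SL u p by (intro B_le) auto
    ultimately show ?thesis by simp
  qed
  have f: "finite S" by (rule chained_finite[OF S])
  have sym: "(\<Sum>s\<in>S. B s u) = ?A" "(\<Sum>s\<in>S. B s u') = ?A'" using SL u by (auto intro!: sum.cong B_sym)
  have in1: "(\<Sum>j\<in>insert u (insert u' S). v i * v j * B i j) = v i * B i u + (v i * B i u' + sqrt 2 * v i * (\<Sum>j\<in>S. B i j))" for i
  proof -
    have "(\<Sum>j\<in>S. v i * v j * B i j) = sqrt 2 * v i * (\<Sum>j\<in>S. B i j)"
      unfolding sum_distrib_left by (rule sum.cong[OF HOL.refl]) (simp add: v_def)
    then show ?thesis using f u by (simp add: v_def)
  qed
  have "(\<Sum>i\<in>S. v i * B i u + (v i * B i u' + sqrt 2 * v i * (\<Sum>j\<in>S. B i j))) =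
     sqrt 2 * ?A + (sqrt 2 * ?A' + 2 * form_of S)"
  proof -
    have "(\<Sum>i\<in>S. v i * B i u) = sqrt 2 * ?A" unfolding sym(1)[symmetric] sum_distrib_left
      by (rule sum.cong[OF HOL.refl]) (simp add: v_def)
    moreover have "(\<Sum>i\<in>S. v i * B i u') = sqrt 2 * ?A'" unfolding sym(2)[symmetric] sum_distrib_left
      by (rule sum.cong[OF HOL.refl]) (simp add: v_def)
    moreover have "(\<Sum>i\<in>S. sqrt 2 * v i * (\<Sum>j\<in>S. B i j)) = 2 * form_of S"
      unfolding form_of_def sum_distrib_left[of 2] by (rule sum.cong[OF HOL.refl]) (simp add: v_def sum_distrib_left)
    ultimately show ?thesis by (simp add: sum.distrib)
  qed
  moreover have "B u u = 1" "B u' u' = 1" by (simp_all add: cox_form_def)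
  moreover have "B u' u = B u u'" using u B_sym by metis
  ultimately have "(\<Sum>i\<in>insert u (insert u' S). \<Sum>j\<in>insert u (insert u' S). v i * v j * B i j) =
     2 + 2 * B u u' + 2 * (sqrt 2 * ?A) + 2 * (sqrt 2 * ?A') + 2 * form_of S"
    unfolding in1 using f u by (simp add: v_def)
  moreover have "0 < (\<Sum>i\<in>insert u (insert u' S). \<Sum>j\<in>insert u (insert u' S). v i * v j * B i j)"
    using SL u by (intro form_pos[of _ u]) (auto simp: v_def)
  moreover have "B u u' \<le> 0" using u by (intro B_le) auto
  moreover have "sqrt 2 * ?A \<le> sqrt 2 * (- sqrt 2 / 2)" "sqrt 2 * ?A' \<le> sqrt 2 * (- sqrt 2 / 2)"
    by (rule mult_left_mono[OF A], simp, rule mult_left_mono[OF A'], simp)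
  moreover have "sqrt 2 * (- sqrt 2 / 2) = (- 1 :: real)" by simp
  ultimately show False using chained_form[OF S] by linarith
qed

text \<open>The vector with all entries 1 on \<open>insert q S\<close> has norm at most
  \<open>2 - 2 * sqrt 2\<close>, which is negative: both heavy edges at \<open>q\<close> end in
  \<open>S\<close>.\<close>

lemma one_heavy_outside:
  assumes S: "chained S" and q: "q \<in> nodes L" "q \<notin> S"
    and p: "p \<in> S" "p' \<in> S" "p \<noteq> p'" "4 \<le> bond L q p" "4 \<le> bond L q p'"
  shows False
proof -
  have SL: "S \<subseteq> nodes L" by (rule chained_nodes[OF S])
  have "(\<Sum>s\<in>S. B q s) \<le> (\<Sum>s\<in>{p, p'}. B q s)" using SL q p by (intro sum_B_le) auto
  moreover have "B q p \<le> - sqrt 2 / 2" "B q p' \<le> - sqrt 2 / 2"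
    using B_le(3)[of q p] B_le(3)[of q p'] SL q p by auto
  ultimately have "(\<Sum>s\<in>S. B q s) \<le> - sqrt 2" using p(3) by simp
  moreover have "1 < sqrt (2::real)" by simp
  ultimately have "form_of (insert q S) \<le> 0"
    unfolding form_of_insert[OF SL q] using chained_form[OF S] by linarith
  moreover have "0 < (\<Sum>i\<in>insert q S. \<Sum>j\<in>insert q S. 1 * 1 * B i j)"
    using SL q by (intro form_pos[of "insert q S" q "\<lambda>_. 1"]) auto
  ultimately show False by (simp add: form_of_def)
qed

text \<open>Take \<open>S\<close> as large as possible among the connected sets containing
  \<open>p\<close> but neither \<open>q\<close> nor both ends of the second edge. If it contained
  one end of the second edge, two heavy edges would leave \<open>S\<close>, against
  \<open>two_heavy_outside\<close> or \<open>one_heavy_outside\<close>. So it contains neither end,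
  and a neighbour other than \<open>q\<close> could still be added.\<close>

lemma heavy_separated:
  assumes pq: "p \<in> nodes L" "q \<in> nodes L" "p \<noteq> q" "4 \<le> bond L p q"
    and pq': "p' \<in> nodes L" "q' \<in> nodes L" "p' \<noteq> q'" "4 \<le> bond L p' q'"
    and ne: "{p, q} \<noteq> {p', q'}"
  obtains S where "S \<subseteq> nodes L" "p \<in> S" "p' \<notin> S" "q' \<notin> S"
    "\<And>y z. y \<in> nodes L \<Longrightarrow> y \<notin> S \<Longrightarrow> z \<in> S \<Longrightarrow> 2 < bond L y z \<Longrightarrow> y = q"
proof -
  define good where "good S \<longleftrightarrow> chained S \<and> p \<in> S \<and> q \<notin> S \<and> \<not> (p' \<in> S \<and> q' \<in> S)" for S
  have "good {p}" using pq pq' by (auto simp: good_def intro: chained.intros)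
  moreover have "\<forall>S. good S \<longrightarrow> card S < Suc (card (nodes L))"
    using chained_nodes fin by (auto simp: good_def less_Suc_eq_le intro: card_mono)
  ultimately obtain S where S: "good S" and max: "\<And>T. good T \<Longrightarrow> card T \<le> card S"
    using ex_has_greatest_nat[of good "{p}" card "Suc (card (nodes L))"] by (metis less_imp_le)
  have ch: "chained S" "p \<in> S" "q \<notin> S" using S by (auto simp: good_def)
  have bs: "4 \<le> bond L q p" "4 \<le> bond L q' p'" using pq pq' bond_sym by metis+
  have out: False if c: "c \<in> S" "d \<notin> S" "d \<in> nodes L" "{c, d} = {p', q'}" for c d
  proof -
    have b: "4 \<le> bond L d c" using c(4) bs(2) pq'(4) by (auto simp: doubleton_eq_iff)
    show False
    proof (cases "d = q")
      case True
      then have "c \<noteq> p" using c(4) ne by (auto simp: insert_commute)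
      then show False using one_heavy_outside[OF ch(1) pq(2) ch(3), of p c] ch c(1) bs(1) b True by simp
    next
      case False
      then show False using two_heavy_outside[OF ch(1) c(3) pq(2) c(2) ch(3) False c(1) ch(2) b bs(1)] by simp
    qed
  qed
  have no: "p' \<notin> S" "q' \<notin> S"
    using out[of p' q'] out[of q' p'] S pq' by (auto simp: good_def insert_commute)
  have "y = q" if y: "y \<in> nodes L" "y \<notin> S" "z \<in> S" "2 < bond L y z" for y z
  proof (rule ccontr)
    assume "y \<noteq> q"
    have "chained (insert y S)" using ch y three_le_iff by (intro chained_insert) auto
    moreover have "\<not> (p' \<in> insert y S \<and> q' \<in> insert y S)" using no pq' by auto
    ultimately have "good (insert y S)" using ch \<open>y \<noteq> q\<close> by (auto simp: good_def)
    then show False using max[of "insert y S"] y chained_finite[OF ch(1)] by simp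
  qed
  then show ?thesis using that chained_nodes[OF ch(1)] ch no by blast
qed

text \<open>The separating sets around \<open>p\<close> and around \<open>q\<close> can each be left
  only through the other end of the edge. Their union is closed under neighbours, hence everything,
  although neither contains \<open>p'\<close>.\<close>

lemma heavy_unique:
  assumes pq: "p \<in> nodes L" "q \<in> nodes L" "p \<noteq> q" "4 \<le> bond L p q"
    and pq': "p' \<in> nodes L" "q' \<in> nodes L" "p' \<noteq> q'" "4 \<le> bond L p' q'"
  shows "{p, q} = {p', q'}"
proof (rule ccontr)
  assume ne: "{p, q} \<noteq> {p', q'}"
  obtain S where S: "S \<subseteq> nodes L" "p \<in> S" "p' \<notin> S" "q' \<notin> S"
    "\<And>y z. y \<in> nodes L \<Longrightarrow> y \<notin> S \<Longrightarrow> z \<in> S \<Longrightarrow> 2 < bond L y z \<Longrightarrow> y = q"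
    using heavy_separated[OF pq pq' ne] by blast
  have "4 \<le> bond L q p" "{q, p} \<noteq> {p', q'}" using pq bond_sym[of p q] ne by (auto simp: insert_commute)
  then obtain T where T: "T \<subseteq> nodes L" "q \<in> T" "p' \<notin> T" "q' \<notin> T"
    "\<And>y z. y \<in> nodes L \<Longrightarrow> y \<notin> T \<Longrightarrow> z \<in> T \<Longrightarrow> 2 < bond L y z \<Longrightarrow> y = p"
    using heavy_separated[OF pq(2,1) _ _ pq'] pq(3) by metis
  have "S \<union> T = nodes L"
  proof (rule irreducible_closed[OF irr, of _ p])
    fix x y assume xy: "x \<in> S \<union> T" "y \<in> nodes L" "x \<noteq> y" "2 < bond L x y"
    then have "x \<in> nodes L" using S(1) T(1) by blast
    then have b: "2 < bond L y x" using xy bond_sym by metis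
    show "y \<in> S \<union> T"
    proof (rule ccontr)
      assume n: "y \<notin> S \<union> T"
      then have "y = q \<or> y = p" using xy(1,2) S(5)[of y x] T(5)[of y x] b by blast
      then show False using n S(2) T(2) by blast
    qed
  qed (use S T in auto)
  then show False using S(3) T(3) pq'(1) by blast
qed

end

section \<open>Braid relations between longest elements\<close>

abbreviation delta_A :: "nat \<Rightarrow> nat set \<Rightarrow> nat list" where
  "delta_A n J \<equiv> delta False n J 1"

text \<open>The block of strand \<open>y\<close> consists of the strands \<open>p..q\<close>,
  between the walls \<open>p - 1\<close> and \<open>q\<close>.\<close>

lemma block_exists:
  assumes "J \<subseteq> {1..n}" "1 \<le> y" "y \<le> Suc n"
  obtains p q where "1 \<le> p" "p \<le> y" "y \<le> q" "q \<le> Suc n" "{p..<q} \<subseteq> J" "p - 1 \<notin> J" "q \<notin> J"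
proof -
  have f: "finite J" using assms(1) finite_subset by blast
  define q where "q = hi J y"
  have q: "y \<le> q" "q \<notin> J" "{y..<q} \<subseteq> J" unfolding q_def using hi_props[OF f] by auto
  have qn: "q \<le> Suc n"
  proof (rule ccontr)
    assume "\<not> q \<le> Suc n"
    then have "Suc n \<in> {y..<q}" using assms(3) by simp
    then have "Suc n \<in> J" using q(3) by blast
    then show False using assms(1) by auto
  qed
  define p where "p = (LEAST p. {p..<y} \<subseteq> J)"
  have pJ: "{p..<y} \<subseteq> J" unfolding p_def by (rule LeastI[of _ y]) simp
  have py: "p \<le> y" unfolding p_def by (rule Least_le) simp
  have p1: "1 \<le> p"
  proof (rule ccontr)
    assume "\<not> 1 \<le> p"
    then have "0 \<in> {p..<y}" using assms(2) by simp
    then have "0 \<in> J" using pJ by blast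
    then show False using assms(1) by auto
  qed
  have "p - 1 \<notin> J"
  proof
    assume "p - 1 \<in> J"
    moreover have "{p - 1..<y} \<subseteq> insert (p - 1) {p..<y}" by auto
    ultimately have "{p - 1..<y} \<subseteq> J" using pJ by blast
    then have "p \<le> p - 1" unfolding p_def by (rule Least_le)
    then show False using p1 by simp
  qed
  moreover have "{p..<q} \<subseteq> J"
  proof
    fix i assume "i \<in> {p..<q}"
    then have "i \<in> {p..<y} \<or> i \<in> {y..<q}" by auto
    then show "i \<in> J" using pJ q(3) by blast
  qed
  ultimately show thesis using that p1 py q(1,2) qn by blast
qed

context
  fixes n :: nat and J :: "nat set"
  assumes J: "J \<subseteq> {1..n}"
begin

lemma set_delta_A: "set (delta_A n J) \<subseteq> {1..n}"
  using set_delta[of False n J 1] by auto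

lemma cross_delta_sim:
  assumes "y \<noteq> z"
  shows "cross (delta_A n J) y z = (if sim J y z then 1 else 0)"
proof -
  have "J \<inter> {1..} = J" using J by auto
  then show ?thesis using cross_delta_A[OF J assms, of 1] by simp
qed

text \<open>A half twist reverses the order of the strands in its block.\<close>

lemma pos_delta_block:
  assumes "1 \<le> p" "p \<le> y" "y \<le> q" "{p..<q} \<subseteq> J" "p - 1 \<notin> J" "q \<notin> J" "q \<le> Suc n"
  shows "pos (delta_A n J) y = p + q - y"
  using cross_eq_sim_pos[OF set_delta_A J cross_delta_sim assms] .

lemma pos_delta_fix:
  assumes "y - 1 \<notin> J" "y \<notin> J"
  shows "pos (delta_A n J) y = y"
proof (cases "y \<in> {1..Suc n}")
  case True
  then show ?thesis using pos_delta_block[of y y y] assms by simp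
next
  case False
  then show ?thesis by (rule cross_outside(1)[OF set_delta_A])
qed

lemma pos_delta_wall: "i \<notin> J \<Longrightarrow> pos (delta_A n J) w \<le> i \<longleftrightarrow> w \<le> i"
  using set_delta[of False n J 1] by (intro pos_le_iff) auto

lemma pos_delta_top:
  assumes "x \<in> J" "Suc x \<notin> J"
  shows "pos (delta_A n J) (Suc x) \<le> x"
proof -
  have x: "1 \<le> x" "x \<le> n" using assms(1) J by auto
  obtain p q where pq: "1 \<le> p" "p \<le> Suc x" "Suc x \<le> q" "q \<le> Suc n" "{p..<q} \<subseteq> J" "p - 1 \<notin> J" "q \<notin> J"
    using block_exists[OF J, of "Suc x"] x by auto
  have "p \<noteq> Suc x" using pq(6) assms(1) by auto
  moreover have "q = Suc x"
  proof (rule ccontr)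
    assume "q \<noteq> Suc x"
    then have "Suc x \<in> {p..<q}" using pq by simp
    then show False using pq(5) assms(2) by blast
  qed
  ultimately show ?thesis using pos_delta_block[OF pq(1-3,5-7,4)] pq(2) by simp
qed

lemma pos_delta_bottom:
  assumes "x \<in> J" "x - 1 \<notin> J"
  shows "x < pos (delta_A n J) x"
proof -
  have x: "1 \<le> x" "x \<le> n" using assms(1) J by auto
  obtain p q where pq: "1 \<le> p" "p \<le> x" "x \<le> q" "q \<le> Suc n" "{p..<q} \<subseteq> J" "p - 1 \<notin> J" "q \<notin> J"
    using block_exists[OF J, of x] x by auto
  have "q \<noteq> x" using pq(7) assms(1) by auto
  moreover have "p = x"
  proof (rule ccontr)
    assume "p \<noteq> x"
    then have "x - 1 \<in> {p..<q}" using pq by auto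
    then show False using pq(5) assms(2) by blast
  qed
  ultimately show ?thesis using pos_delta_block[OF pq(1-3,5-7,4)] pq(3) by simp
qed

lemma pos_delta_single:
  assumes "x \<in> J" "x - 1 \<notin> J" "Suc x \<notin> J"
  shows "pos (delta_A n J) x = Suc x" "pos (delta_A n J) (Suc x) = x"
  using pos_delta_block[of x x "Suc x"] pos_delta_block[of x "Suc x" "Suc x"] assms J by auto

end

lemma alt_pos_cross:
  assumes "braid_eq (cox_A n) (alt_concat k u v) (alt_concat k v u)"
  shows "pos (alt_concat k u v) y = pos (alt_concat k v u) y"
    and "cross (alt_concat k u v) y z = cross (alt_concat k v u) y z"
  using pos_cross_braid_A[OF assms] by simp_all

context
  fixes n :: nat and J K :: "nat set" and k :: nat
  assumes J: "J \<subseteq> {1..n}" and K: "K \<subseteq> {1..n}" and JK: "J \<inter> K = {}"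
    and rel: "braid_eq (cox_A n) (alt_concat k (delta_A n J) (delta_A n K)) (alt_concat k (delta_A n K) (delta_A n J))"
begin

abbreviation "ra \<equiv> pos (delta_A n J)"
abbreviation "rb \<equiv> pos (delta_A n K)"

text \<open>Follow strand \<open>x + 1\<close>. With \<open>J\<close> first it moves down to at most
  \<open>x\<close>, where the wall \<open>x\<close> of \<open>K\<close> holds it; with
  \<open>K\<close> first it moves above \<open>x + 1\<close>, where the wall \<open>x + 1\<close> of
  \<open>J\<close> holds it.\<close>

lemma adjacent_not_2:
  assumes "x \<in> J" "Suc x \<in> K"
  shows "k \<noteq> 2"
proof
  assume k: "k = 2"
  have nJ: "Suc x \<notin> J" and nK: "x \<notin> K" using assms JK by auto
  have "rb (ra (Suc x)) = ra (rb (Suc x))"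
    using alt_pos_cross(1)[OF rel, of "Suc x"] k by (simp add: numeral_eq_Suc)
  moreover have "rb (ra (Suc x)) \<le> x"
    using pos_delta_top[OF J assms(1) nJ] pos_delta_wall[OF K nK] by blast
  moreover have "\<not> ra (rb (Suc x)) \<le> Suc x"
    using pos_delta_bottom[OF K assms(2)] nK pos_delta_wall[OF J nJ] by (simp add: not_le)
  ultimately show False by simp
qed

text \<open>Let \<open>x\<close> lie in the block \<open>{p..<q}\<close> of \<open>J\<close>. The images of \<open>p\<close> under the permutations of both sides
  show that \<open>K\<close> touches the block at exactly one end. If the block were longer than one letter, an inner strand
  and the strand at that end would cross twice in one of the two words and never in the other.\<close>

lemma bond_3_rule:
  assumes k: "k = 3" and x: "x \<in> J"
  shows "x - 1 \<notin> J \<and> Suc x \<notin> J \<and> (x - 1 \<in> K \<longleftrightarrow> Suc x \<notin> K)"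
proof -
  have xn: "1 \<le> x" "x \<le> n" using x J by auto
  obtain p q where pq: "1 \<le> p" "p \<le> x" "x \<le> q" "q \<le> Suc n" "{p..<q} \<subseteq> J" "p - 1 \<notin> J" "q \<notin> J"
    using block_exists[OF J, of x] xn by auto
  have xq: "x < q" using pq x by (metis le_neq_implies_less)
  note a_block = pos_delta_block[OF J pq(1) _ _ pq(5,6,7,4)]
  have ap: "ra p = q" "ra q = p" using a_block[of p] a_block[of q] pq by simp_all
  have inJ: "i \<in> J" "i \<notin> K" if "p \<le> i" "i < q" for i
  proof -
    show "i \<in> J" using pq(5) that by auto
    then show "i \<notin> K" using JK by blast
  qed
  have P: "ra (rb (ra y)) = rb (ra (rb y))" for y
    using alt_pos_cross(1)[OF rel, of y] k by (simp add: numeral_eq_Suc)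
  have C: "cross (delta_A n J) y z + cross (delta_A n K) (ra y) (ra z) + cross (delta_A n J) (rb (ra y)) (rb (ra z)) =
      cross (delta_A n K) y z + cross (delta_A n J) (rb y) (rb z) + cross (delta_A n K) (ra (rb y)) (ra (rb z))" for y z
    using alt_pos_cross(2)[OF rel, of y z] k by (simp add: numeral_eq_Suc)
  have bp: "rb p = p" if "p - 1 \<notin> K" using that inJ[of p] pq xq by (intro pos_delta_fix[OF K]) auto
  have bq: "rb q = q" if "q \<notin> K" using that inJ[of "q - 1"] pq xq by (intro pos_delta_fix[OF K]) auto
  have bi: "rb y = y" if "p < y" "y < q" for y
    using inJ[of y] inJ[of "y - 1"] that by (intro pos_delta_fix[OF K]) auto
  have lowp: "rb p \<le> p - 1" if "p - 1 \<in> K"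
    using pos_delta_top[OF K that] inJ[of p] pq xq by auto
  have highq: "q < rb q" if "q \<in> K"
    using pos_delta_bottom[OF K that] inJ[of "q - 1"] pq xq by auto
  have hq: "q < ra w" if "q < w" for w using pos_delta_wall[OF J pq(7), of w] that by simp
  have hp: "ra w \<le> p - 1" if "w \<le> p - 1" for w using pos_delta_wall[OF J pq(6), of w] that by simp
  have c0: "cross (delta_A n M) y z = 0" if "M \<subseteq> {1..n}" "i \<notin> M" "y \<le> i" "i < z" for M y z i
    using that cross_delta_sim[OF that(1), of y z] by (auto simp: sim_le)
  have cJ: "cross (delta_A n J) y z = 1" if "p \<le> y" "y < z" "z \<le> q" for y z
    using that cross_delta_sim[OF J, of y z] inJ(1) by (auto simp: sim_le)
  have cs: "cross u y z = cross u z y" for u y z by (rule cross_commute)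
  consider (none) "p - 1 \<notin> K" "q \<notin> K" | (both) "p - 1 \<in> K" "q \<in> K" | (right) "p - 1 \<notin> K" "q \<in> K"
    | (left) "p - 1 \<in> K" "q \<notin> K" by blast
  then show ?thesis
  proof cases
    case none
    then have False using P[of p] ap bp bq pq xq by simp
    then show ?thesis ..
  next
    case both
    have "q < ra (rb (ra p))" using hq[OF highq[OF both(2)]] ap by simp
    moreover have "ra (rb p) \<le> p" using hp[OF lowp[OF both(1)]] by simp
    then have "rb (ra (rb p)) \<le> p" using pos_delta_wall[OF K, of p] inJ[of p] pq xq by auto
    ultimately have False using P[of p] pq xq by simp
    then show ?thesis ..
  next
    case right
    have q: "q = Suc p"
    proof (rule ccontr)
      assume "q \<noteq> Suc p"
      define y where "y = Suc p"
      have y: "p < y" "y < q" using \<open>q \<noteq> Suc p\<close> pq xq unfolding y_def by auto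
      define y' where "y' = p + q - y"
      have y': "p < y'" "y' < q" "ra y = y'" using y a_block[of y] unfolding y'_def by auto
      have L1: "cross (delta_A n J) y q = 1" using cJ[of y q] y by simp
      have L3: "cross (delta_A n J) (rb (ra y)) (rb (ra q)) = 1"
        using cJ[of p y'] y' bi[of y'] bp[OF right(1)] ap cs by simp
      have R1: "cross (delta_A n K) y q = 0" using c0[OF K, of y y q] inJ[of y] y by simp
      have R2: "cross (delta_A n J) (rb y) (rb q) = 0"
        using c0[OF J pq(7), of y "rb q"] y bi[of y] highq[OF right(2)] by simp
      have R3: "cross (delta_A n K) (ra (rb y)) (ra (rb q)) = 0"
        using c0[OF K, of y' y' "ra (rb q)"] inJ[of y'] y y' bi[of y] hq[OF highq[OF right(2)]] by simp
      show False using C[of y q] L1 L3 R1 R2 R3 by simp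
    qed
    then have "x = p" using pq xq by simp
    then show ?thesis using q pq right by simp
  next
    case left
    have q: "q = Suc p"
    proof (rule ccontr)
      assume "q \<noteq> Suc p"
      define y where "y = Suc p"
      have y: "p < y" "y < q" using \<open>q \<noteq> Suc p\<close> pq xq unfolding y_def by auto
      define y' where "y' = p + q - y"
      have y': "p < y'" "y' < q" "ra y = y'" using y a_block[of y] unfolding y'_def by auto
      have p1: "p - 1 < p" using pq by simp
      have L1: "cross (delta_A n J) p y = 1" using cJ[of p y] y by simp
      have L3: "cross (delta_A n J) (rb (ra p)) (rb (ra y)) = 1"
        using cJ[of y' q] y' bi[of y'] bq[OF left(2)] ap cs by simp
      have R1: "cross (delta_A n K) p y = 0" using c0[OF K, of p p y] inJ[of p] y by simp
      have R2: "cross (delta_A n J) (rb p) (rb y) = 0"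
        using c0[OF J pq(6), of "rb p" y] y p1 bi[of y] lowp[OF left(1)] by simp
      have R3: "cross (delta_A n K) (ra (rb p)) (ra (rb y)) = 0"
        using c0[OF K, of p "ra (rb p)" y'] inJ[of p] y y' bi[of y] hp[OF lowp[OF left(1)]] p1 by simp
      show False using C[of p y] L1 L3 R1 R2 R3 by simp
    qed
    then have "x = p" using pq xq by simp
    then show ?thesis using q pq left by simp
  qed
qed

text \<open>The letter \<open>x\<close> is a block of \<open>J\<close> and
  \<open>{x + 1..<z}\<close> a block of \<open>K\<close>. If a claim failed, strand \<open>x\<close>
  could be followed through all factors, and the two words would carry it to different positions. So
  the block of \<open>K\<close> is closed off by \<open>J\<close> on its other side too; the extra
  claim for length 5 later excludes that length.\<close>

lemma heavy_right:
  assumes k: "k = 4 \<or> k = 5"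
    and x: "x \<in> J" "x - 1 \<notin> J" "x - 1 \<notin> K" "Suc x < z" "{Suc x..<z} \<subseteq> K" "z \<notin> K"
  shows "z \<in> J \<and> (k = 5 \<longrightarrow> Suc z \<in> J \<union> K)"
proof -
  have Kx: "Suc x \<in> K" "z - 1 \<in> K" using x(4,5) by auto
  have d: "Suc x \<notin> J" "x \<notin> K" "z - 1 \<notin> J" using Kx x(1) JK by auto
  have zn: "z \<le> Suc n" using subsetD[OF K Kx(2)] by auto
  have a: "ra x = Suc x" "ra (Suc x) = x" using pos_delta_single[OF J x(1,2) d(1)] by auto
  have b: "rb (Suc x) = z" "rb z = Suc x" "rb x = x"
    using pos_delta_block[OF K, of "Suc x" "Suc x" z] pos_delta_block[OF K, of "Suc x" z z] pos_delta_fix[OF K, of x] x d zn by auto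
  have P: "pos (alt_concat k (delta_A n J) (delta_A n K)) x = pos (alt_concat k (delta_A n K) (delta_A n J)) x"
    by (rule alt_pos_cross(1)[OF rel])
  have zJ: "z \<in> J"
  proof (rule ccontr)
    assume "z \<notin> J"
    then have "ra z = z" using d by (intro pos_delta_fix[OF J]) auto
    then show False using P k a b x(4) by (auto simp: numeral_eq_Suc)
  qed
  moreover have "Suc z \<in> J \<union> K" if "k = 5"
  proof (rule ccontr)
    assume nz: "Suc z \<notin> J \<union> K"
    then have "ra z = Suc z" "ra (Suc z) = z" using pos_delta_single[OF J zJ d(3)] by auto
    moreover have "rb (Suc z) = Suc z" using nz x(6) by (intro pos_delta_fix[OF K]) auto
    ultimately show False using P that a b by (simp add: numeral_eq_Suc)
  qed
  ultimately show ?thesis by blast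
qed

text \<open>The mirror image of \<open>heavy_right\<close>, following strand
  \<open>x + 1\<close>.\<close>

lemma heavy_left:
  assumes k: "k = 4 \<or> k = 5"
    and x: "x \<in> J" "Suc x \<notin> J" "Suc x \<notin> K" "1 \<le> z" "z < x" "{z..<x} \<subseteq> K" "z - 1 \<notin> K"
  shows "z - 1 \<in> J \<and> (k = 5 \<longrightarrow> z - 2 \<in> J \<union> K)"
proof -
  have Kx: "x - 1 \<in> K" "z \<in> K" using x(5,6) by auto
  have d: "x - 1 \<notin> J" "x \<notin> K" "z \<notin> J" using Kx x(1) JK by auto
  have xn: "x \<le> Suc n" using x(1) J by auto
  have a: "ra x = Suc x" "ra (Suc x) = x" using pos_delta_single[OF J x(1) d(1) x(2)] by auto
  have b: "rb x = z" "rb z = x" "rb (Suc x) = Suc x"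
    using pos_delta_block[OF K, of z x x] pos_delta_block[OF K, of z z x] pos_delta_fix[OF K, of "Suc x"] x d xn by auto
  have P: "pos (alt_concat k (delta_A n J) (delta_A n K)) (Suc x) = pos (alt_concat k (delta_A n K) (delta_A n J)) (Suc x)"
    by (rule alt_pos_cross(1)[OF rel])
  have zJ: "z - 1 \<in> J"
  proof (rule ccontr)
    assume "z - 1 \<notin> J"
    then have "ra z = z" using d by (intro pos_delta_fix[OF J]) auto
    then show False using P k a b x(5) by (auto simp: numeral_eq_Suc)
  qed
  moreover have "z - 2 \<in> J \<union> K" if "k = 5"
  proof (rule ccontr)
    assume nz: "z - 2 \<notin> J \<union> K"
    have z1: "Suc (z - 1) = z" "z - 1 - 1 = z - 2" using x(4) by simp_all
    have "ra (z - 1) = z" "ra z = z - 1"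
      using pos_delta_single[OF J zJ] nz d(3) unfolding z1 by auto
    moreover have "rb (z - 1) = z - 1" using nz x(7) z1 by (intro pos_delta_fix[OF K]) auto
    ultimately show False using P that a b x(4,5) by (simp add: numeral_eq_Suc)
  qed
  ultimately show ?thesis by blast
qed

end

section \<open>Colourings of a path\<close>

text \<open>A repetition \<open>f u = f v\<close> at minimal distance propagates to the right, because the colour
  \<open>f (u + 1)\<close> must also occur next to \<open>v\<close> and cannot occur at \<open>v - 1\<close>.\<close>

lemma segment_inj:
  fixes f :: "nat \<Rightarrow> 'a"
  assumes sym: "\<And>i j. light i j \<Longrightarrow> light j i"
    and rule: "\<And>x j. s \<le> x \<Longrightarrow> x \<le> e \<Longrightarrow> light (f x) j \<Longrightarrow>
      (1 < x \<and> f (x - 1) = j) \<noteq> (x < n \<and> f (Suc x) = j)"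
    and step: "\<And>x. s \<le> x \<Longrightarrow> x < e \<Longrightarrow> light (f x) (f (Suc x)) \<and> f x \<noteq> f (Suc x)"
    and stop: "e < n \<Longrightarrow> \<not> light (f e) (f (Suc e))"
    and s: "1 \<le> s" and e: "e \<le> n"
  shows "inj_on f {s..e}"
proof (rule ccontr)
  assume "\<not> inj_on f {s..e}"
  then obtain a b where "a \<in> {s..e}" "b \<in> {s..e}" "a \<noteq> b" "f a = f b" by (auto simp: inj_on_def)
  define D where "D d \<longleftrightarrow> (\<exists>u. s \<le> u \<and> 0 < d \<and> u + d \<le> e \<and> f u = f (u + d))" for d
  have "\<exists>u v. s \<le> u \<and> u < v \<and> v \<le> e \<and> f u = f v"
    using \<open>a \<in> {s..e}\<close> \<open>b \<in> {s..e}\<close> \<open>a \<noteq> b\<close> \<open>f a = f b\<close>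
    by (cases "a < b") (force, metis atLeastAtMost_iff linorder_neqE_nat)
  then obtain u v where uv: "s \<le> u" "u < v" "v \<le> e" "f u = f v" by blast
  have "D (v - u)" unfolding D_def using uv by (intro exI[of _ u]) auto
  define d where "d = (LEAST d. D d)"
  have d: "D d" unfolding d_def by (rule LeastI[of D, OF \<open>D (v - u)\<close>])
  have min: "d \<le> d'" if "D d'" for d' unfolding d_def using that by (rule Least_le)
  define W where "W = {u. s \<le> u \<and> u + d \<le> e \<and> f u = f (u + d)}"
  have "finite W" by (rule finite_subset[of _ "{..e}"]) (auto simp: W_def)
  moreover have "W \<noteq> {}" using d by (auto simp: D_def W_def)
  ultimately have M: "Max W \<in> W" "\<And>u. u \<in> W \<Longrightarrow> u \<le> Max W" by auto
  define u where "u = Max W"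
  have u: "s \<le> u" "u + d \<le> e" "f u = f (u + d)" using M(1) unfolding u_def W_def by auto
  have d0: "0 < d" using d by (auto simp: D_def)
  have l: "light (f u) (f (Suc u))" "f u \<noteq> f (Suc u)" using step[of u] u d0 by auto
  have d1: "d \<noteq> 1" using l(2) u(3) by auto
  have d2: "d \<noteq> 2"
  proof
    assume "d = 2"
    then have "f (Suc (Suc u)) = f u" using u(3) by (simp add: numeral_eq_Suc)
    moreover have "(1 < Suc u \<and> f (Suc u - 1) = f u) \<noteq> (Suc u < n \<and> f (Suc (Suc u)) = f u)"
      using u \<open>d = 2\<close> by (intro rule sym[OF l(1)]) auto
    ultimately show False using u \<open>d = 2\<close> s e by simp
  qed
  have ne: "f (u + d - 1) \<noteq> f (Suc u)"
  proof
    assume "f (u + d - 1) = f (Suc u)"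
    moreover have a: "Suc u + (d - 2) = u + d - 1" "0 < d - 2" using d0 d1 d2 by auto
    ultimately have "s \<le> Suc u \<and> 0 < d - 2 \<and> Suc u + (d - 2) \<le> e \<and> f (Suc u) = f (Suc u + (d - 2))"
      unfolding a(1) using u by simp
    then have "D (d - 2)" unfolding D_def by blast
    then show False using min[of "d - 2"] d0 by simp
  qed
  have "(1 < u + d \<and> f (u + d - 1) = f (Suc u)) \<noteq> (u + d < n \<and> f (Suc (u + d)) = f (Suc u))"
    using u l by (intro rule) auto
  then have nx: "u + d < n" "f (Suc (u + d)) = f (Suc u)" using ne by auto
  show False
  proof (cases "u + d = e")
    case True
    then show False using stop nx l u by simp
  next
    case False
    then have "Suc u \<in> W" using u nx by (auto simp: W_def)
    then show False using M(2) unfolding u_def by fastforce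
  qed
qed

text \<open>Beyond a run of \<open>q\<close> the colour \<open>q\<close> could be entered again only
  from \<open>p\<close>. Up to its first return no colour is repeated, so that \<open>p\<close>
  would be the one at \<open>y + 1\<close>, with \<open>q\<close> on both sides, whereas its light
  neighbour \<open>p2\<close> must occur next to it.\<close>

lemma right_of_heavy:
  fixes f :: "nat \<Rightarrow> 'a"
  assumes sym: "\<And>i j. light i j \<Longrightarrow> light j i"
    and rule: "\<And>x j. 1 \<le> x \<Longrightarrow> x \<le> n \<Longrightarrow> light (f x) j \<Longrightarrow>
      (1 < x \<and> f (x - 1) = j) \<noteq> (x < n \<and> f (Suc x) = j)"
    and single: "\<And>x. 1 \<le> x \<Longrightarrow> x < n \<Longrightarrow> f x \<noteq> q \<Longrightarrow> f x \<noteq> f (Suc x)"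
    and adj: "\<And>x. 1 \<le> x \<Longrightarrow> x < n \<Longrightarrow> f x = f (Suc x) \<or> light (f x) (f (Suc x)) \<or> {f x, f (Suc x)} = {p, q}"
    and nl: "\<And>j. \<not> light q j" and p2: "light p p2" and pq: "p \<noteq> q"
    and y: "1 \<le> y" "y < n" "f y = q" "f (Suc y) = p"
  shows "\<forall>z. y < z \<and> z \<le> n \<longrightarrow> f z \<noteq> q" and "inj_on f {Suc y..n}"
proof -
  have p2q: "p2 \<noteq> q" using nl sym p2 by blast
  have inj: "inj_on f {Suc y..e}" if e: "e \<le> n" "\<And>x. Suc y \<le> x \<Longrightarrow> x \<le> e \<Longrightarrow> f x \<noteq> q"
    and stop: "e < n \<Longrightarrow> \<not> light (f e) (f (Suc e))" for e
  proof (rule segment_inj[of light "Suc y" e f n, OF sym])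
    fix x assume x: "Suc y \<le> x" "x < e"
    have nq: "f x \<noteq> q" "f (Suc x) \<noteq> q" using e(2)[of x] e(2)[of "Suc x"] x by auto
    have "f x \<noteq> f (Suc x)" using single[of x] x e nq by auto
    moreover have "{f x, f (Suc x)} \<noteq> {p, q}" using nq by (auto simp: doubleton_eq_iff)
    ultimately show "light (f x) (f (Suc x)) \<and> f x \<noteq> f (Suc x)" using adj[of x] x e by auto
  qed (use rule stop e in auto)
  show *: "\<forall>z. y < z \<and> z \<le> n \<longrightarrow> f z \<noteq> q"
  proof (rule ccontr)
    assume "\<not> ?thesis"
    then have ex: "\<exists>z. y < z \<and> z \<le> n \<and> f z = q" by blast
    define z where "z = (LEAST z. y < z \<and> z \<le> n \<and> f z = q)"
    have z: "y < z" "z \<le> n" "f z = q" using LeastI_ex[OF ex] unfolding z_def by auto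
    have before: "f x \<noteq> q" if "y < x" "x < z" for x
      using not_less_Least[of x "\<lambda>z. y < z \<and> z \<le> n \<and> f z = q"] that z unfolding z_def by auto
    have z1: "Suc y < z" using z y pq by (metis Suc_lessI)
    define e where "e = z - 1"
    have e: "z = Suc e" "Suc y \<le> e" "e < n" using z1 z unfolding e_def by auto
    have "f e \<noteq> q" using before[of e] e by simp
    have "\<not> light (f e) q" using nl sym by blast
    then have "{f e, q} = {p, q}" using adj[of e] e z y \<open>f e \<noteq> q\<close> by auto
    then have fe: "f e = p" using \<open>f e \<noteq> q\<close> by (auto simp: doubleton_eq_iff)
    have "inj_on f {Suc y..e}"
      using before e \<open>\<not> light (f e) q\<close> z by (intro inj) auto
    then have "e = Suc y" using inj_onD[of f "{Suc y..e}" e "Suc y"] fe y e by simp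
    then have "(1 < e \<and> q = p2) \<noteq> (e < n \<and> q = p2)"
      using rule[of e p2] p2 fe e y z by simp
    then show False using p2q by simp
  qed
  show "inj_on f {Suc y..n}" using * by (intro inj) auto
qed

text \<open>Move outwards from the run of \<open>q\<close> on both sides at once. A position and its
  mirror have the same colour and the same colour on the inner side; every light neighbour occurs on
  exactly one side, so the colours on the outer sides agree as well, or both are absent.\<close>

lemma mirror_match:
  fixes f :: "nat \<Rightarrow> 'a"
  assumes sym: "\<And>i j. light i j \<Longrightarrow> light j i"
    and rule: "\<And>x j. 1 \<le> x \<Longrightarrow> x \<le> n \<Longrightarrow> light (f x) j \<Longrightarrow>
      (1 < x \<and> f (x - 1) = j) \<noteq> (x < n \<and> f (Suc x) = j)"
    and single: "\<And>x. 1 \<le> x \<Longrightarrow> x < n \<Longrightarrow> f x \<noteq> q \<Longrightarrow> f x \<noteq> f (Suc x)"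
    and adj: "\<And>x. 1 \<le> x \<Longrightarrow> x < n \<Longrightarrow> f x = f (Suc x) \<or> light (f x) (f (Suc x)) \<or> {f x, f (Suc x)} = {p, q}"
    and xy: "1 \<le> x" "x < y" "y < n" "f x = p" "f (Suc x) = q" "f y = q" "f (Suc y) = p"
    and noq: "\<And>z. 1 \<le> z \<Longrightarrow> z \<le> x \<Longrightarrow> f z \<noteq> q" "\<And>z. y < z \<Longrightarrow> z \<le> n \<Longrightarrow> f z \<noteq> q"
  shows "(d < x \<longleftrightarrow> y + d < n) \<and> (d < x \<longrightarrow> f (x - d) = f (Suc y + d))"
proof (induction d rule: less_induct)
  case (less d)
  show ?case
  proof (cases d)
    case 0
    then show ?thesis using xy by simp
  next
    case (Suc e)
    have IH: "e < x \<longleftrightarrow> y + e < n" "e < x \<Longrightarrow> f (x - e) = f (Suc y + e)" using less[of e] Suc by auto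
    show ?thesis
    proof (cases "e < x")
      case False
      then show ?thesis using IH Suc by simp
    next
      case True
      define u where "u = x - e"
      define v where "v = Suc y + e"
      have u: "1 \<le> u" "u \<le> x" "x = u + e" and v: "y < v" "v \<le> n" using True IH unfolding u_def v_def by auto
      have r: "f u = f v" using IH(2)[OF True] unfolding u_def v_def .
      have c: "f (Suc u) = f (v - 1)"
      proof (cases e)
        case 0
        then show ?thesis using xy by (simp add: u_def v_def)
      next
        case (Suc g)
        then have "f (x - g) = f (Suc y + g)" using less[of g] \<open>d = Suc e\<close> True by auto
        moreover have "Suc u = x - g" "v - 1 = Suc y + g" using True Suc by (auto simp: u_def v_def)
        ultimately show ?thesis by simp
      qed
      have un: "u < n" using u xy by linarith
      have to: "v < n \<and> f (u - 1) = f (Suc v)" if "1 < u"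
      proof -
        define w where "w = f (u - 1)"
        have nq: "f (u - 1) \<noteq> q" "f u \<noteq> q" using noq(1)[of "u - 1"] noq(1)[of u] u that by auto
        have "f (u - 1) \<noteq> f u" using single[of "u - 1"] that un nq by simp
        moreover have "{f (u - 1), f u} \<noteq> {p, q}" using nq by (auto simp: doubleton_eq_iff)
        ultimately have "light w (f u)" using adj[of "u - 1"] that un by (simp add: w_def)
        then have l: "light (f u) w" by (rule sym)
        have "f (v - 1) \<noteq> w" using rule[of u w] u un that l c by (simp add: w_def)
        then show ?thesis using rule[of v w] v l r xy by (simp add: w_def)
      qed
      have from': "1 < u" if "v < n"
      proof -
        define w where "w = f (Suc v)"
        have nq: "f v \<noteq> q" "f (Suc v) \<noteq> q" using noq(2)[of v] noq(2)[of "Suc v"] v that by auto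
        have "f v \<noteq> f (Suc v)" using single[of v] v that nq xy by simp
        moreover have "{f v, f (Suc v)} \<noteq> {p, q}" using nq by (auto simp: doubleton_eq_iff)
        ultimately have l: "light (f v) w" using adj[of v] v that by (simp add: w_def)
        have "f (v - 1) \<noteq> w" using rule[of v w] v that l xy by (simp add: w_def)
        then show ?thesis using rule[of u w] u un l r c by simp
      qed
      have "Suc e < x \<longleftrightarrow> 1 < u" "y + Suc e < n \<longleftrightarrow> v < n" "x - Suc e = u - 1" "Suc y + Suc e = Suc v"
        using True unfolding u_def v_def by auto
      then show ?thesis using to from' Suc by (cases "1 < u") auto
    qed
  qed
qed

text \<open>The properties of the sets \<open>J i\<close> that the classification uses, detached
  from braids: touching sets are joined by an edge and conversely, and \<open>three\<close>,
  \<open>right\<close> and \<open>left\<close> record what the relations of length 3, 4 and 5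
  enforce. A target of type B enters through its folded supports.\<close>

locale colouring = finite_irreducible L for L :: "'a coxeter" +
  fixes n :: nat and J :: "'a \<Rightarrow> nat set"
  assumes rank: "3 \<le> card (nodes L)"
    and J_sub: "\<And>i. i \<in> nodes L \<Longrightarrow> J i \<subseteq> {1..n}"
    and J_disj: "\<And>i j. i \<in> nodes L \<Longrightarrow> j \<in> nodes L \<Longrightarrow> i \<noteq> j \<Longrightarrow> J i \<inter> J j = {}"
    and J_cover: "{1..n} \<subseteq> (\<Union>i\<in>nodes L. J i)"
    and near: "\<And>i j x. i \<in> nodes L \<Longrightarrow> j \<in> nodes L \<Longrightarrow> i \<noteq> j \<Longrightarrow> x \<in> J i \<Longrightarrow> Suc x \<in> J j \<Longrightarrow> bond L i j \<noteq> 2"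
    and far: "\<And>i j. i \<in> nodes L \<Longrightarrow> j \<in> nodes L \<Longrightarrow> i \<noteq> j \<Longrightarrow> bond L i j \<noteq> 2 \<Longrightarrow>
      \<exists>x. x \<in> J i \<and> Suc x \<in> J j \<or> x \<in> J j \<and> Suc x \<in> J i"
    and three: "\<And>i j x. i \<in> nodes L \<Longrightarrow> j \<in> nodes L \<Longrightarrow> i \<noteq> j \<Longrightarrow> bond L i j = 3 \<Longrightarrow> x \<in> J i \<Longrightarrow>
      x - 1 \<notin> J i \<and> Suc x \<notin> J i \<and> (x - 1 \<in> J j \<longleftrightarrow> Suc x \<notin> J j)"
    and right: "\<And>i j x z k. i \<in> nodes L \<Longrightarrow> j \<in> nodes L \<Longrightarrow> i \<noteq> j \<Longrightarrow> bond L i j = enat k \<Longrightarrow> k = 4 \<or> k = 5 \<Longrightarrow>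
      x \<in> J i \<Longrightarrow> x - 1 \<notin> J i \<Longrightarrow> x - 1 \<notin> J j \<Longrightarrow> Suc x < z \<Longrightarrow> {Suc x..<z} \<subseteq> J j \<Longrightarrow> z \<notin> J j \<Longrightarrow>
      z \<in> J i \<and> (k = 5 \<longrightarrow> Suc z \<in> J i \<union> J j)"
    and left: "\<And>i j x z k. i \<in> nodes L \<Longrightarrow> j \<in> nodes L \<Longrightarrow> i \<noteq> j \<Longrightarrow> bond L i j = enat k \<Longrightarrow> k = 4 \<or> k = 5 \<Longrightarrow>
      x \<in> J i \<Longrightarrow> Suc x \<notin> J i \<Longrightarrow> Suc x \<notin> J j \<Longrightarrow> 1 \<le> z \<Longrightarrow> z < x \<Longrightarrow> {z..<x} \<subseteq> J j \<Longrightarrow> z - 1 \<notin> J j \<Longrightarrow>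
      z - 1 \<in> J i \<and> (k = 5 \<longrightarrow> z - 2 \<in> J i \<union> J j)"
begin

definition col :: "nat \<Rightarrow> 'a" where
  "col x = (THE i. i \<in> nodes L \<and> x \<in> J i)"

lemma col_eq: "i \<in> nodes L \<Longrightarrow> x \<in> J i \<Longrightarrow> col x = i"
  unfolding col_def using J_disj by (intro the_equality) blast+

lemma col_props:
  assumes "x \<in> {1..n}"
  shows "col x \<in> nodes L" "x \<in> J (col x)"
proof -
  obtain i where "i \<in> nodes L" "x \<in> J i" using assms J_cover by blast
  then show "col x \<in> nodes L" "x \<in> J (col x)" using col_eq by auto
qed

lemma J_iff: "i \<in> nodes L \<Longrightarrow> x \<in> J i \<longleftrightarrow> 1 \<le> x \<and> x \<le> n \<and> col x = i"
  using J_sub col_eq col_props by fastforce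

definition light :: "'a \<Rightarrow> 'a \<Rightarrow> bool" where
  "light i j \<longleftrightarrow> i \<in> nodes L \<and> j \<in> nodes L \<and> i \<noteq> j \<and> bond L i j = 3"

lemma light_sym: "light i j \<Longrightarrow> light j i"
  unfolding light_def using bond_sym by metis

lemma light_rule:
  assumes "1 \<le> x" "x \<le> n" "light (col x) j"
  shows "(1 < x \<and> col (x - 1) = j) \<noteq> (x < n \<and> col (Suc x) = j)" "x < n \<Longrightarrow> col x \<noteq> col (Suc x)"
proof -
  have x: "x \<in> {1..n}" using assms by simp
  have j: "j \<in> nodes L" using assms(3) by (simp add: light_def)
  note t = three[of "col x" j x, OF col_props(1)[OF x] j _ _ col_props(2)[OF x]]
  have t': "x - 1 \<notin> J (col x) \<and> Suc x \<notin> J (col x) \<and> (x - 1 \<in> J j \<longleftrightarrow> Suc x \<notin> J j)"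
    using t assms(3) by (simp add: light_def)
  have "x - 1 \<in> J j \<longleftrightarrow> 1 < x \<and> col (x - 1) = j" using J_iff[OF j, of "x - 1"] assms by auto
  moreover have "Suc x \<in> J j \<longleftrightarrow> x < n \<and> col (Suc x) = j" using J_iff[OF j, of "Suc x"] by auto
  ultimately show "(1 < x \<and> col (x - 1) = j) \<noteq> (x < n \<and> col (Suc x) = j)" using t' by blast
  show "col x \<noteq> col (Suc x)" if "x < n"
    using t' J_iff[OF col_props(1)[OF x], of "Suc x"] that by auto
qed

lemma neighbour_ex:
  assumes A: "A \<subseteq> nodes L" "x \<in> A" "A \<noteq> nodes L"
  shows "\<exists>i\<in>A. \<exists>j\<in>nodes L - A. 2 < bond L i j"
  using irreducible_closed[OF irr A(1,2)] A(3) by blast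

lemma third_ex:
  assumes "i \<in> nodes L" "j \<in> nodes L" "i \<noteq> j"
  shows "\<exists>l\<in>nodes L. l \<noteq> i \<and> l \<noteq> j \<and> (2 < bond L i l \<or> 2 < bond L j l)"
proof -
  have "card {i, j} = 2" using assms by simp
  then have "{i, j} \<noteq> nodes L" using rank by auto
  then show ?thesis using neighbour_ex[of "{i, j}" i] assms by blast
qed

text \<open>Rank at least 3 and irreducibility attach a third vertex to one end of the edge, which
  is what \<open>bond_ge_6\<close> needs.\<close>

lemma bond_cases:
  assumes "i \<in> nodes L" "j \<in> nodes L" "i \<noteq> j"
  shows "bond L i j = 2 \<or> bond L i j = 3 \<or> bond L i j = 4 \<or> bond L i j = 5"
proof -
  obtain l where l: "l \<in> nodes L" "l \<noteq> i" "l \<noteq> j" "3 \<le> bond L i l \<or> 3 \<le> bond L j l"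
    using third_ex[OF assms] three_le_iff by blast
  have "\<not> 6 \<le> bond L i j"
    using bond_ge_6[of i j l] bond_ge_6[of j i l] l assms bond_sym[of i j] by metis
  moreover have "2 \<le> bond L i j" using cm assms unfolding coxeter_matrix_def by metis
  ultimately obtain k where k: "bond L i j = enat k" "2 \<le> k" "\<not> 6 \<le> k"
    by (cases "bond L i j") (auto simp: numeral_eq_enat)
  then have "k = 2 \<or> k = 3 \<or> k = 4 \<or> k = 5" by linarith
  then show ?thesis using k(1) by (auto simp: numeral_eq_enat)
qed

text \<open>Every vertex has a light neighbour, so consecutive letters have different colours joined
  by a light edge, and \<open>segment_inj\<close> applies to the whole path. Colours that are not
  consecutive on the path have bond 2 by \<open>far\<close>.\<close>

lemma classification_light:
  assumes "\<And>i j. i \<in> nodes L \<Longrightarrow> j \<in> nodes L \<Longrightarrow> i \<noteq> j \<Longrightarrow> bond L i j = 2 \<or> bond L i j = 3"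
  shows "coxeter_iso col (cox_A n) L" "\<forall>x\<in>{1..n}. J (col x) = {x}"
proof -
  have lt: "light i j" if "i \<in> nodes L" "j \<in> nodes L" "i \<noteq> j" "bond L i j \<noteq> 2" for i j
    using assms that by (auto simp: light_def)
  have nb: "\<exists>j. light i j" if i: "i \<in> nodes L" for i
  proof -
    have "card {i} \<noteq> card (nodes L)" using rank by simp
    then have "{i} \<noteq> nodes L" by metis
    then obtain j where "j \<in> nodes L" "j \<noteq> i" "2 < bond L i j" using neighbour_ex[of "{i}" i] i by blast
    moreover from this have "bond L i j \<noteq> 2" by (metis less_irrefl)
    ultimately show ?thesis using lt[of i j] i by blast
  qed
  have ne: "col x \<noteq> col (Suc x)" if "1 \<le> x" "x < n" for x
  proof -
    have "col x \<in> nodes L" using col_props that by simp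
    then obtain j where "light (col x) j" using nb by blast
    then show ?thesis using light_rule(2)[of x j] that by simp
  qed
  have adj: "light (col x) (col (Suc x))" if "1 \<le> x" "x < n" for x
    using near[of "col x" "col (Suc x)" x] col_props[of x] col_props[of "Suc x"] ne[OF that] that
    by (intro lt) auto
  have inj: "inj_on col {1..n}"
    by (rule segment_inj[of light 1 n col n, OF light_sym]) (use light_rule adj ne in auto)
  show J1: "\<forall>x\<in>{1..n}. J (col x) = {x}"
  proof
    fix x assume x: "x \<in> {1..n}"
    have "y = x" if "y \<in> J (col x)" for y
      using that J_iff[OF col_props(1)[OF x], of y] inj_onD[OF inj, of y x] x by auto
    then show "J (col x) = {x}" using col_props(2)[OF x] by blast
  qed
  have img: "col ` {1..n} = nodes L"
  proof
    show "col ` {1..n} \<subseteq> nodes L" using col_props by blast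
    show "nodes L \<subseteq> col ` {1..n}"
    proof
      fix i assume i: "i \<in> nodes L"
      then obtain j where "light i j" using nb by blast
      then obtain x where "x \<in> J i" using far[of i j] by (auto simp: light_def)
      then show "i \<in> col ` {1..n}" using J_iff[OF i, of x] by force
    qed
  qed
  show "coxeter_iso col (cox_A n) L"
    unfolding coxeter_iso_def
  proof (intro conjI ballI)
    show "bij_betw col (nodes (cox_A n)) (nodes L)" using inj img by (simp add: bij_betw_def)
    fix x y assume xy: "x \<in> nodes (cox_A n)" "y \<in> nodes (cox_A n)"
    then have x: "x \<in> {1..n}" and y: "y \<in> {1..n}" by simp_all
    have cl: "col x \<in> nodes L" "col y \<in> nodes L" using x y col_props by auto
    consider "x = y" | "y = Suc x" | "x = Suc y" | "x \<noteq> y" "y \<noteq> Suc x" "x \<noteq> Suc y" by blast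
    then show "bond L (col x) (col y) = bond (cox_A n) x y"
    proof cases
      case 1
      then show ?thesis using cm cl by (simp add: coxeter_matrix_def cox_A_def)
    next
      case 2
      then show ?thesis using adj[of x] x y by (simp add: light_def cox_A_def)
    next
      case 3
      then show ?thesis using light_sym[OF adj[of y]] x y by (simp add: light_def cox_A_def)
    next
      case 4
      have "col x \<noteq> col y" using inj_onD[OF inj _ x y] 4 by blast
      moreover have "\<not> (\<exists>w. w \<in> J (col x) \<and> Suc w \<in> J (col y) \<or> w \<in> J (col y) \<and> Suc w \<in> J (col x))"
        using bspec[OF J1 x] bspec[OF J1 y] 4 by auto
      ultimately have "bond L (col x) (col y) = 2" using far cl by blast
      then show ?thesis using 4 by (simp add: cox_A_def)
    qed
  qed
qed

end

context colouring
begin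

text \<open>\<open>p\<close> is the end of the heavy edge with a further neighbour
  \<open>p2\<close>. A run of \<open>q\<close> is found with \<open>p\<close> on both sides; it is
  the only one, the path is a palindrome around it, and its left half together with \<open>q\<close>
  shows every colour once.\<close>

lemma classification_heavy_aux:
  assumes pI: "p \<in> nodes L" and qI: "q \<in> nodes L" and pq: "p \<noteq> q"
    and k: "bond L p q = enat k" "k = 4 \<or> k = 5" and p2: "light p p2"
    and lt: "\<And>i j. i \<in> nodes L \<Longrightarrow> j \<in> nodes L \<Longrightarrow> i \<noteq> j \<Longrightarrow> bond L i j \<noteq> 2 \<Longrightarrow> {i, j} \<noteq> {p, q} \<Longrightarrow> light i j"
  shows "2 * card (nodes L) \<le> n + 1 \<and> coxeter_iso col (cox_B (card (nodes L))) L \<and>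
    (\<forall>i\<in>{1..card (nodes L) - 1}. J (col i) = {i, n + 1 - i}) \<and>
    J (col (card (nodes L))) = {card (nodes L)..n + 1 - card (nodes L)}"
proof -
  have p2I: "p2 \<in> nodes L" "p2 \<noteq> p" "bond L p p2 = 3" using p2 by (auto simp: light_def)
  have p2q: "p2 \<noteq> q" using p2I(3) k by (auto simp: numeral_eq_enat)
  have dis: "w \<in> J i \<Longrightarrow> w \<in> J j \<Longrightarrow> i \<in> nodes L \<Longrightarrow> j \<in> nodes L \<Longrightarrow> i = j" for w i j
    using J_disj by blast
  have tp: "w - 1 \<notin> J p \<and> Suc w \<notin> J p \<and> (w - 1 \<in> J p2 \<longleftrightarrow> Suc w \<notin> J p2)" if "w \<in> J p" for w
    using three[OF pI p2I(1) _ p2I(3) that] p2I(2) by metis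
  have "\<exists>x y. x \<in> J p \<and> {Suc x..y} \<subseteq> J q \<and> x < y \<and> Suc y \<in> J p \<and> k = 4"
  proof -
    have "bond L p q \<noteq> 2" using k by (auto simp: numeral_eq_enat)
    then obtain x0 where "x0 \<in> J p \<and> Suc x0 \<in> J q \<or> x0 \<in> J q \<and> Suc x0 \<in> J p"
      using far[OF pI qI pq] by blast
    then show ?thesis
    proof
      assume x0: "x0 \<in> J p \<and> Suc x0 \<in> J q"
      have f: "finite (J q)" using J_sub[OF qI] finite_subset by blast
      \<comment> \<open>\<open>z\<close> is the first letter after the run of \<open>q\<close> that
        starts at \<open>x0 + 1\<close>.\<close>
      define z where "z = hi (J q) (Suc x0)"
      have z: "Suc x0 \<le> z" "z \<notin> J q" "{Suc x0..<z} \<subseteq> J q" unfolding z_def using hi_props[OF f] by auto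
      have zx: "Suc x0 < z" using z x0 by (metis le_neq_implies_less)
      have "Suc x0 \<notin> J p2" using dis[of "Suc x0" p2 q] x0 p2I qI p2q by blast
      then have "x0 - 1 \<in> J p2" using tp x0 by blast
      then have "x0 - 1 \<notin> J q" using dis[of _ p2 q] p2I qI p2q by blast
      then have r: "z \<in> J p \<and> (k = 5 \<longrightarrow> Suc z \<in> J p \<union> J q)"
        using right[OF pI qI pq k, of x0 z] x0 tp z zx by blast
      \<comment> \<open>The letter before \<open>z\<close> has colour \<open>q\<close>, so the
        neighbour \<open>p2\<close> of \<open>p\<close> must occupy \<open>z + 1\<close>. Length 5
        would demand colour \<open>p\<close> or \<open>q\<close> there.\<close>
      have "z - 1 \<in> J q" using z(3) zx by auto
      then have "z - 1 \<notin> J p2" using dis[of _ p2 q] p2I qI p2q by blast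
      then have "Suc z \<in> J p2" using tp r by blast
      then have "Suc z \<notin> J p \<union> J q" using dis[of _ p2 q] dis[of _ p2 p] p2I qI pI p2q by blast
      then have "k = 4" using r k(2) by blast
      moreover have "{Suc x0..z - 1} \<subseteq> {Suc x0..<z}" using zx by auto
      ultimately show ?thesis using x0 r z zx by (intro exI[of _ x0] exI[of _ "z - 1"]) auto
    next
      assume x0: "x0 \<in> J q \<and> Suc x0 \<in> J p"
      have xr: "1 \<le> x0" "x0 \<le> Suc n" using J_sub[OF qI] x0 by auto
      obtain z e where z: "1 \<le> z" "z \<le> x0" "x0 \<le> e" "{z..<e} \<subseteq> J q" "z - 1 \<notin> J q" "e \<notin> J q"
        using block_exists[OF J_sub[OF qI] xr] by metis
      have "x0 < e" using z x0 by (metis le_neq_implies_less)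
      then have zs: "{z..x0} \<subseteq> J q" using z(4) by auto
      have x0p2: "x0 \<notin> J p2" using dis[of x0 p2 q] x0 p2I qI p2q by blast
      have t: "Suc x0 - 1 = x0" by simp
      have "Suc (Suc x0) \<in> J p2" using tp[of "Suc x0"] x0 x0p2 unfolding t by blast
      then have "Suc (Suc x0) \<notin> J q" using dis[of _ p2 q] p2I qI p2q by blast
      moreover have "{z..<Suc x0} \<subseteq> J q" using zs by (simp add: atLeastLessThanSuc_atLeastAtMost)
      ultimately have r: "z - 1 \<in> J p \<and> (k = 5 \<longrightarrow> z - 2 \<in> J p \<union> J q)"
        using left[OF pI qI pq k, of "Suc x0" z] x0 tp z by (metis le_imp_less_Suc)
      have z1: "Suc (z - 1) = z" "z - 1 - 1 = z - 2" using z(1) by simp_all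
      have "z \<in> J q" using zs z by auto
      then have "z \<notin> J p2" using dis[of z p2 q] p2I qI p2q by blast
      then have "z - 2 \<in> J p2" using tp[of "z - 1"] r unfolding z1 by blast
      then have "z - 2 \<notin> J p \<union> J q" using dis[of _ p2 q] dis[of _ p2 p] p2I qI pI p2q by blast
      then have "k = 4" using r k(2) by blast
      moreover have "z - 1 < x0" using z by linarith
      ultimately show ?thesis using x0 r zs z1 by (intro exI[of _ "z - 1"] exI[of _ x0]) auto
    qed
  qed
  then obtain x y where xy: "x \<in> J p" "{Suc x..y} \<subseteq> J q" "x < y" "Suc y \<in> J p" and k4: "k = 4" by blast
  have cx: "1 \<le> x" "col x = p" "y < n" "col (Suc y) = p"
    using xy J_iff[OF pI, of x] J_iff[OF pI, of "Suc y"] by auto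
  have cq: "col w = q" if "x < w" "w \<le> y" for w
  proof -
    have "w \<in> J q" using xy(2) that by auto
    then show ?thesis using J_iff[OF qI] by blast
  qed
  have nl: "\<not> light q j" for j
  proof
    assume l: "light q j"
    then have j: "j \<in> nodes L" "q \<noteq> j" "bond L q j = 3" by (auto simp: light_def)
    have "j \<noteq> p" using j(3) k bond_sym[OF pI qI] by (auto simp: numeral_eq_enat)
    have "Suc x \<in> J q" using xy by auto
    from three[OF qI j this] have t: "Suc (Suc x) \<notin> J q" "x \<in> J j \<longleftrightarrow> Suc (Suc x) \<notin> J j" by simp_all
    have "y = Suc x"
    proof (rule ccontr)
      assume "y \<noteq> Suc x"
      then have "Suc (Suc x) \<in> {Suc x..y}" using xy(3) by simp
      then show False using xy(2) t(1) by blast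
    qed
    then have "x \<in> J j \<or> Suc y \<in> J j" using t(2) by blast
    then show False using dis[of _ j p] xy j pI \<open>j \<noteq> p\<close> by blast
  qed
  have adj: "col w = col (Suc w) \<or> light (col w) (col (Suc w)) \<or> {col w, col (Suc w)} = {p, q}"
    if "1 \<le> w" "w < n" for w
  proof -
    have "w \<in> {1..n}" "Suc w \<in> {1..n}" using that by auto
    note c = col_props[OF this(1)] col_props[OF this(2)]
    show ?thesis using near[OF c(1,3) _ c(2,4)] lt[OF c(1,3)] by blast
  qed
  have lex: "\<exists>j. light i j" if i: "i \<in> nodes L" "i \<noteq> q" for i
  proof (cases "i = p")
    case False
    have "card {i} \<noteq> card (nodes L)" using rank by simp
    then have "{i} \<noteq> nodes L" by metis
    then obtain j where j: "j \<in> nodes L" "j \<noteq> i" "2 < bond L i j" using neighbour_ex[of "{i}" i] i by blast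
    moreover from j(3) have "bond L i j \<noteq> 2" by (metis less_irrefl)
    ultimately show ?thesis using lt[of i j] i False by (auto simp: doubleton_eq_iff)
  qed (use p2 in blast)
  have single: "col w \<noteq> col (Suc w)" if w: "1 \<le> w" "w < n" "col w \<noteq> q" for w
  proof -
    have "col w \<in> nodes L" using col_props w by simp
    then obtain j where "light (col w) j" using lex w(3) by blast
    then show ?thesis using light_rule(2)[of w j] w by simp
  qed
  have R: "\<forall>z. y < z \<and> z \<le> n \<longrightarrow> col z \<noteq> q" "inj_on col {Suc y..n}"
    using right_of_heavy[of light n col q p p2 y, OF light_sym light_rule(1) single adj nl p2 pq _ cx(3) _ cx(4)]
      cq[of y] xy(3) cx(1) by auto
  \<comment> \<open>The path read backwards: \<open>right_of_heavy\<close> then excludes further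
    \<open>q\<close> to the left of the run.\<close>
  let ?f = "\<lambda>w. col (n + 1 - w)"
  have Lf: "\<forall>z. n - x < z \<and> z \<le> n \<longrightarrow> ?f z \<noteq> q"
  proof (rule right_of_heavy(1)[of light n ?f q p p2 "n - x", OF light_sym])
    fix w j assume w: "1 \<le> w" "w \<le> n" "light (?f w) j"
    define w' where "w' = n + 1 - w"
    have w': "1 \<le> w'" "w' \<le> n" "w' + w = n + 1" using w unfolding w'_def by auto
    have "1 < w' \<longleftrightarrow> w < n" "w' < n \<longleftrightarrow> 1 < w" "n + 1 - Suc w = w' - 1" "1 < w \<Longrightarrow> n + 1 - (w - 1) = Suc w'"
      using w' by auto
    then show "(1 < w \<and> ?f (w - 1) = j) \<noteq> (w < n \<and> ?f (Suc w) = j)"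
      using light_rule(1)[OF w'(1,2), of j] w(3) unfolding w'_def[symmetric] by auto
  next
    fix w assume w: "1 \<le> w" "w < n" "?f w \<noteq> q"
    have e: "n + 1 - w = Suc (n - w)" "n + 1 - Suc w = n - w" using w by auto
    have r: "1 \<le> n - w" "n - w < n" using w by auto
    show "?f w \<noteq> ?f (Suc w)" using single[OF r] w(3) unfolding e by metis
  next
    fix w assume w: "1 \<le> w" "w < n"
    have e: "n + 1 - w = Suc (n - w)" "n + 1 - Suc w = n - w" using w by auto
    show "?f w = ?f (Suc w) \<or> light (?f w) (?f (Suc w)) \<or> {?f w, ?f (Suc w)} = {p, q}"
    proof -
      have r: "1 \<le> n - w" "n - w < n" using w by auto
      show ?thesis unfolding e using adj[OF r] light_sym by (metis insert_commute)
    qed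
  next
    have e: "n + 1 - (n - x) = Suc x" "n + 1 - Suc (n - x) = x" using xy cx by auto
    show "?f (n - x) = q" "?f (Suc (n - x)) = p" unfolding e using cq[of "Suc x"] xy cx by auto
  qed (use nl p2 pq cx xy in auto)
  have noq: "col z \<noteq> q" if "1 \<le> z" "z \<le> x" for z
  proof -
    have "n - x < n + 1 - z" "n + 1 - z \<le> n" "n + 1 - (n + 1 - z) = z" using that xy cx by auto
    then show ?thesis using Lf by metis
  qed
  have match: "(d < x \<longleftrightarrow> y + d < n) \<and> (d < x \<longrightarrow> col (x - d) = col (Suc y + d))" for d
    by (rule mirror_match[of light n col q p, OF light_sym light_rule(1) single adj cx(1) xy(3) cx(3,2) _ _ cx(4) noq])
      (use cq xy R(1) in auto)
  \<comment> \<open>Both ends of the path are reached at the same distance from the run of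
    \<open>q\<close>.\<close>
  have n: "n = x + y" using match[of x] match[of "n - y"] cx(3) by auto
  have mirror: "col (n + 1 - w) = col w" if "1 \<le> w" "w \<le> x" for w
  proof -
    have "n + 1 - w = Suc y + (x - w)" "x - (x - w) = w" "x - w < x" using that n by auto
    then show ?thesis using match[of "x - w"] by metis
  qed
  have inj: "v = w" if "1 \<le> v" "v \<le> x" "1 \<le> w" "w \<le> x" "col v = col w" for v w
  proof -
    have "n + 1 - v = n + 1 - w"
      using mirror[of v] mirror[of w] that n by (intro inj_onD[OF R(2)]) auto
    then show ?thesis using that n by auto
  qed
  have colI: "col w \<in> nodes L" if "1 \<le> w" "w \<le> n" for w using col_props that by simp
  have Ji: "J (col i) = {i, n + 1 - i}" if i: "1 \<le> i" "i \<le> x" for i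
  proof
    show "J (col i) \<subseteq> {i, n + 1 - i}"
    proof
      fix w assume "w \<in> J (col i)"
      then have w: "1 \<le> w" "w \<le> n" "col w = col i" using J_iff[of "col i" w] colI[of i] i n by auto
      consider "w \<le> x" | "x < w" "w \<le> y" | "y < w" by linarith
      then show "w \<in> {i, n + 1 - i}"
      proof cases
        case 1
        then show ?thesis using inj[of w i] w i by simp
      next
        case 2
        then show ?thesis using cq[of w] noq[of i] w i by simp
      next
        case 3
        then have "n + 1 - w = i" using inj[of "n + 1 - w" i] mirror[of "n + 1 - w"] w i n by simp
        then show ?thesis using w by auto
      qed
    qed
    have "i \<in> J (col i)" "n + 1 - i \<in> J (col i)"
      using J_iff[of "col i" i] J_iff[of "col i" "n + 1 - i"] colI[of i] mirror[of i] i n by auto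
    then show "{i, n + 1 - i} \<subseteq> J (col i)" by simp
  qed
  have qx: "col (Suc x) = q" using cq[of "Suc x"] xy(3) by simp
  have Jq: "J q = {Suc x..y}"
  proof
    show "J q \<subseteq> {Suc x..y}"
    proof
      fix w assume "w \<in> J q"
      then have w: "1 \<le> w" "w \<le> n" "col w = q" using J_iff[OF qI] by auto
      then have "\<not> w \<le> x" "\<not> y < w" using noq[of w] R(1) by auto
      then show "w \<in> {Suc x..y}" by simp
    qed
  qed (rule xy(2))
  have img: "col ` {1..Suc x} = nodes L"
  proof
    show "col ` {1..Suc x} \<subseteq> nodes L" using colI n xy(3) by auto
    show "nodes L \<subseteq> col ` {1..Suc x}"
    proof
      fix i assume i: "i \<in> nodes L"
      show "i \<in> col ` {1..Suc x}"
      proof (cases "i = q")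
        case True
        then show ?thesis using qx by (intro image_eqI[of _ _ "Suc x"]) auto
      next
        case False
        then obtain j where j: "light i j" using lex i by blast
        then obtain w where "w \<in> J i" using far[of i j] by (auto simp: light_def numeral_eq_enat)
        then have w: "1 \<le> w" "w \<le> n" "col w = i" using J_iff[OF i] by auto
        show ?thesis
        proof (cases "w \<le> x")
          case True
          then show ?thesis using w by (intro image_eqI[of _ _ w]) auto
        next
          case F: False
          then have "y < w" using cq[of w] w(3) False by (metis not_le)
          then have "1 \<le> n + 1 - w" "n + 1 - w \<le> x" "n + 1 - (n + 1 - w) = w" using n w by auto
          then show ?thesis using mirror[of "n + 1 - w"] w by (intro image_eqI[of _ _ "n + 1 - w"]) auto
        qed
      qed
    qed
  qed
  have injm: "inj_on col {1..Suc x}"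
  proof (rule inj_onI)
    fix v w assume vw: "v \<in> {1..Suc x}" "w \<in> {1..Suc x}" "col v = col w"
    then show "v = w" using inj[of v w] noq[of v] noq[of w] qx by (cases "v = Suc x"; cases "w = Suc x") auto
  qed
  have m: "card (nodes L) = Suc x" using card_image[OF injm] img by simp
  have bond_lt: "bond L (col a) (col b) = bond (cox_B (Suc x)) a b" if ab: "1 \<le> a" "a < b" "b \<le> Suc x" for a b
  proof -
    have ne: "col a \<noteq> col b" using inj_onD[OF injm, of a b] ab by auto
    have I: "col a \<in> nodes L" "col b \<in> nodes L" using colI[of a] colI[of b] ab n xy(3) by auto
    consider "b = Suc a" "b \<le> x" | "a = x" "b = Suc x" | "a + 2 \<le> b" using ab by linarith
    then show ?thesis
    proof cases
      case 1
      have "{col a, col b} \<noteq> {p, q}" using noq[of a] noq[of b] 1 ab by (auto simp: doubleton_eq_iff)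
      then have "light (col a) (col b)" using adj[of a] 1 ab ne n xy(3) by auto
      moreover have "{a, b} \<noteq> {Suc x - 1, Suc x}" using 1 by (auto simp: doubleton_eq_iff)
      ultimately show ?thesis using 1 by (simp add: light_def cox_B_def)
    next
      case 2
      then show ?thesis using k(1) k4 cx qx by (simp add: cox_B_def numeral_eq_enat)
    next
      case 3
      have "bond L (col a) (col b) = 2"
      proof (rule ccontr)
        assume "bond L (col a) (col b) \<noteq> 2"
        then obtain w where w: "w \<in> J (col a) \<and> Suc w \<in> J (col b) \<or> w \<in> J (col b) \<and> Suc w \<in> J (col a)"
          using far[OF I ne] by blast
        have Ja: "J (col a) = {a, n + 1 - a}" using Ji[of a] ab by simp
        show False
        proof (cases "b = Suc x")
          case True
          then have "J (col b) = {Suc x..y}" using Jq qx by simp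
          then show False using w 3 True n xy(3) ab unfolding Ja by auto
        next
          case False
          then have "J (col b) = {b, n + 1 - b}" using Ji[of b] ab by simp
          then show False using w 3 False n xy(3) ab unfolding Ja by auto
        qed
      qed
      moreover have "{a, b} \<noteq> {Suc x - 1, Suc x}" using 3 by (auto simp: doubleton_eq_iff)
      ultimately show ?thesis using 3 by (simp add: cox_B_def)
    qed
  qed
  have "coxeter_iso col (cox_B (Suc x)) L"
    unfolding coxeter_iso_def
  proof (intro conjI ballI)
    show "bij_betw col (nodes (cox_B (Suc x))) (nodes L)" using injm img by (simp add: bij_betw_def)
    fix a b assume "a \<in> nodes (cox_B (Suc x))" "b \<in> nodes (cox_B (Suc x))"
    then have ab: "1 \<le> a" "a \<le> Suc x" "1 \<le> b" "b \<le> Suc x" by auto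
    have I: "col a \<in> nodes L" "col b \<in> nodes L" using colI[of a] colI[of b] ab n xy(3) by auto
    have sym: "bond (cox_B (Suc x)) b a = bond (cox_B (Suc x)) a b"
      by (auto simp: cox_B_def insert_commute)
    consider "a < b" | "b < a" | "a = b" by linarith
    then show "bond L (col a) (col b) = bond (cox_B (Suc x)) a b"
    proof cases
      case 1
      then show ?thesis using bond_lt ab by simp
    next
      case 2
      then show ?thesis using bond_lt[of b a] ab bond_sym[OF I] sym by simp
    next
      case 3
      then show ?thesis using cm I by (simp add: coxeter_matrix_def cox_B_def)
    qed
  qed
  then show ?thesis unfolding m using Ji Jq qx n xy(3) by auto
qed

lemma classification:
  "coxeter_iso col (cox_A n) L \<and> (\<forall>x\<in>{1..n}. J (col x) = {x}) \<or>
   2 * card (nodes L) \<le> n + 1 \<and> coxeter_iso col (cox_B (card (nodes L))) L \<and>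
    (\<forall>i\<in>{1..card (nodes L) - 1}. J (col i) = {i, n + 1 - i}) \<and>
    J (col (card (nodes L))) = {card (nodes L)..n + 1 - card (nodes L)}"
proof (cases "\<forall>i\<in>nodes L. \<forall>j\<in>nodes L. i \<noteq> j \<longrightarrow> bond L i j = 2 \<or> bond L i j = 3")
  case True
  then show ?thesis using classification_light by blast
next
  case False
  then obtain p q where pq: "p \<in> nodes L" "q \<in> nodes L" "p \<noteq> q" "bond L p q \<noteq> 2" "bond L p q \<noteq> 3" by blast
  then have b: "bond L p q = 4 \<or> bond L p q = 5" using bond_cases by blast
  then have h: "4 \<le> bond L p q" by (auto simp: numeral_eq_enat)
  obtain k where k: "bond L p q = enat k" "k = 4 \<or> k = 5" using b by (auto simp: numeral_eq_enat)
  have lt: "light i j" if ij: "i \<in> nodes L" "j \<in> nodes L" "i \<noteq> j" "bond L i j \<noteq> 2" "{i, j} \<noteq> {p, q}" for i j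
  proof -
    have "bond L i j \<noteq> 4 \<and> bond L i j \<noteq> 5"
      using heavy_unique[OF ij(1-3) _ pq(1-3) h] ij(5) by (auto simp: numeral_eq_enat)
    then show ?thesis using bond_cases[OF ij(1-3)] ij by (simp add: light_def)
  qed
  \<comment> \<open>The third vertex is joined to one end of the heavy edge, by a light edge since
    the heavy one is unique. That end takes the role of \<open>p\<close>.\<close>
  obtain l where l: "l \<in> nodes L" "l \<noteq> p" "l \<noteq> q" "2 < bond L p l \<or> 2 < bond L q l"
    using third_ex[OF pq(1-3)] by blast
  have "bond L p l \<noteq> 2 \<or> bond L q l \<noteq> 2" using l(4) by (metis less_irrefl)
  then have "light p l \<or> light q l"
    using l lt[of p l] lt[of q l] pq by (auto simp: doubleton_eq_iff)
  then show ?thesis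
  proof
    assume "light p l"
    then show ?thesis using classification_heavy_aux[OF pq(1-3) k _ lt] by blast
  next
    assume "light q l"
    moreover have "bond L q p = enat k" using k bond_sym pq by metis
    moreover have "{q, p} = {p, q}" by blast
    ultimately show ?thesis using classification_heavy_aux[OF pq(2,1) _ _ k(2), of l] lt pq(3) by metis
  qed
qed

end

section \<open>Words for special longest elements\<close>

lemma path_not_mem: "x \<notin> J \<Longrightarrow> path b n J x = []"
  by (subst path.simps) simp

lemma delta_skip:
  assumes "x \<le> y" "y \<le> Suc n" "\<And>w. x \<le> w \<Longrightarrow> w < y \<Longrightarrow> w \<notin> J"
  shows "delta b n J x = delta b n J y"
  using assms
proof (induction "y - x" arbitrary: x)
  case (Suc d)
  have "x \<le> n" "x < y" using Suc(2) Suc.prems by auto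
  then have "delta b n J x = delta b n J (Suc x) @ path b n J x" by (subst delta.simps) simp
  also have "path b n J x = []" using Suc.prems \<open>x < y\<close> by (intro path_not_mem) simp
  also have "delta b n J (Suc x) = delta b n J y" using Suc(2) Suc.prems by (intro Suc(1)) auto
  finally show ?case by simp
qed simp

lemma delta_single:
  assumes "1 \<le> x" "x \<le> n"
  shows "delta b n {x} 1 = [x]"
proof -
  have "delta b n {x} 1 = delta b n {x} x" using assms by (intro delta_skip) auto
  also have "\<dots> = delta b n {x} (Suc x) @ path b n {x} x" using assms by (subst delta.simps) simp
  also have "delta b n {x} (Suc x) = delta b n {x} (Suc n)" using assms by (intro delta_skip) auto
  also have "\<dots> = []" by (subst delta.simps) simp
  also have "path b n {x} x = [x]"
  proof -
    have "\<not> (x < n \<and> {x..n} \<subseteq> {x})"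
    proof
      assume a: "x < n \<and> {x..n} \<subseteq> {x}"
      then have "Suc x \<in> {x..n}" by simp
      then have "Suc x \<in> {x}" using a by blast
      then show False by simp
    qed
    then show ?thesis using assms path_not_mem[of "Suc x" "{x}" b n] by (subst path.simps) auto
  qed
  finally show ?thesis by simp
qed

lemma path_cong:
  assumes "J \<inter> {x..} = K \<inter> {x..}"
  shows "path b n J x = path b n K x"
  using assms
proof (induction b n J x rule: path.induct)
  case (1 b n J x)
  have m: "w \<in> J \<longleftrightarrow> w \<in> K" if "x \<le> w" for w using 1(2) that by (auto simp: set_eq_iff)
  then have "{x..n} \<subseteq> J \<longleftrightarrow> {x..n} \<subseteq> K" by (auto simp: subset_eq)
  moreover have "J \<inter> {Suc x..} = K \<inter> {Suc x..}" using m by auto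
  then have "x \<in> J \<and> x \<le> n \<Longrightarrow> path b n J (Suc x) = path b n K (Suc x)" using 1(1) by blast
  ultimately show ?case using m[of x] by (subst (1 2) path.simps) auto
qed

lemma delta_cong:
  assumes "J \<inter> {x..} = K \<inter> {x..}"
  shows "delta b n J x = delta b n K x"
  using assms
proof (induction b n J x rule: delta.induct)
  case (1 b n J x)
  have "J \<inter> {Suc x..} = K \<inter> {Suc x..}"
  proof -
    have "A \<inter> {Suc x..} = (A \<inter> {x..}) \<inter> {Suc x..}" for A by auto
    then show ?thesis using 1(2) by metis
  qed
  then have "x \<le> n \<Longrightarrow> delta b n J (Suc x) = delta b n K (Suc x)" using 1(1) by blast
  then show ?case using path_cong[OF 1(2), of b n] by (subst (1 2) delta.simps) auto
qed

abbreviation full_path :: "nat \<Rightarrow> nat \<Rightarrow> nat list" where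
  "full_path k y \<equiv> path True k {1..k} y"

abbreviation full_delta :: "nat \<Rightarrow> nat \<Rightarrow> nat list" where
  "full_delta k y \<equiv> delta True k {1..k} y"

lemma delta_interval:
  assumes "1 \<le> m" "m \<le> k"
  shows "delta True k {m..k} 1 = full_delta k m"
proof -
  have "delta True k {m..k} 1 = delta True k {m..k} m" using assms by (intro delta_skip) auto
  also have "\<dots> = full_delta k m" using assms by (intro delta_cong) auto
  finally show ?thesis .
qed

lemma commute_words:
  assumes "\<And>i. i \<in> set w \<Longrightarrow> braid_eq M (Q @ [i]) (i # Q)" "set Q \<subseteq> nodes M" "set w \<subseteq> nodes M"
  shows "braid_eq M (Q @ w) (w @ Q)"
  using assms(1,3)
proof (induction w)
  case Nil
  then show ?case using assms(2) by (auto intro: pres_cong.refl)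
next
  case (Cons i w)
  have "braid_eq M ((Q @ [i]) @ w) ((i # Q) @ w)" using Cons by (intro pres_cong_right) auto
  also have "(i # Q) @ w = [i] @ (Q @ w)" by simp
  also have "braid_eq M ([i] @ (Q @ w)) ([i] @ (w @ Q))" using Cons by (intro pres_cong_left) auto
  finally show ?case by simp
qed

lemma set_full:
  assumes "1 \<le> y"
  shows "set (full_path k y) \<subseteq> {y..k}" "set (full_delta k y) \<subseteq> {y..k}" "set (full_path k y) \<subseteq> {1..k}" "set (full_delta k y) \<subseteq> {1..k}"
  using set_path[of True k "{1..k}" y] set_delta[of True k "{1..k}" y] assms by auto

lemma full_path_Cons: "1 \<le> y \<Longrightarrow> y < k \<Longrightarrow> full_path k y = y # full_path k (Suc y) @ [y]"
  by (rule path_full_Cons) auto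

lemma full_delta_Cons: "y \<le> k \<Longrightarrow> full_delta k y = full_delta k (Suc y) @ full_path k y"
  by (subst delta.simps) simp

lemma full_path_commute:
  assumes "1 \<le> y" "y < i" "i \<le> k"
  shows "braid_eq (cox True k) (full_path k y @ [i]) (i # full_path k y)"
  using assms by (intro path_commute) auto

text \<open>With \<open>q = full_path k (y + 1)\<close> one has
  \<open>full_path k y = y q y\<close>, and this commutes with every letter of
  \<open>q\<close>.\<close>

lemma full_path_four:
  assumes "1 \<le> y" "y < k"
  shows "braid_eq (cox True k) ([y] @ full_path k (Suc y) @ [y] @ full_path k (Suc y))
    (full_path k (Suc y) @ [y] @ full_path k (Suc y) @ [y])"
proof -
  have "braid_eq (cox True k) (full_path k y @ full_path k (Suc y)) (full_path k (Suc y) @ full_path k y)"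
    using assms set_full[of "Suc y" k] set_full[of y k] by (intro commute_words full_path_commute) auto
  then show ?thesis unfolding full_path_Cons[OF assms] by simp
qed

text \<open>In type B the longest element acts as -1. For \<open>i > y\<close> both factors of the
  word commute with \<open>i\<close>; for \<open>i = y\<close> the relation
  \<open>full_path_four\<close> moves \<open>y\<close> through.\<close>

lemma full_delta_central:
  assumes "1 \<le> y" "y \<le> i" "i \<le> k"
  shows "braid_eq (cox True k) (full_delta k y @ [i]) (i # full_delta k y)"
  using assms
proof (induction "k - y" arbitrary: y)
  case 0
  then have "y = k" "i = k" by auto
  moreover have "full_delta k (Suc k) = []" by (subst delta.simps) simp
  moreover have "full_path k k = [k]" using 0 by (intro path_top) auto
  ultimately have "full_delta k y = [k]" using full_delta_Cons[of k k] by simp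
  then show ?case using \<open>i = k\<close> 0 by (auto intro: pres_cong.refl)
next
  case (Suc d)
  let ?c = "braid_eq (cox True k)"
  have yk: "y < k" using Suc(2) by simp
  let ?D = "full_delta k (Suc y)"
  let ?P = "full_path k y"
  have sets: "set ?D \<subseteq> {1..k}" "set ?P \<subseteq> {1..k}" using set_full Suc.prems by auto
  have e: "full_delta k y = ?D @ ?P" using yk by (intro full_delta_Cons) simp
  show ?case
  proof (cases "i = y")
    case False
    have "?c (?D @ (?P @ [i])) (?D @ (i # ?P))"
      using False Suc.prems sets by (intro pres_cong_left full_path_commute) auto
    also have "?D @ (i # ?P) = (?D @ [i]) @ ?P" by simp
    also have "?c ((?D @ [i]) @ ?P) ((i # ?D) @ ?P)"
      using False Suc.prems Suc(2) sets by (intro pres_cong_right Suc(1)) auto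
    finally show ?thesis unfolding e by simp
  next
    case True
    let ?p = "full_path k (Suc y)"
    let ?D2 = "full_delta k (Suc (Suc y))"
    have s2: "set ?p \<subseteq> {1..k}" "set ?D2 \<subseteq> {1..k}" "set ?D2 \<subseteq> {Suc (Suc y)..k}"
      using set_full[of "Suc y" k] set_full[of "Suc (Suc y)" k] by auto
    have eP: "?P = [y] @ ?p @ [y]" using full_path_Cons[OF Suc.prems(1) yk] by simp
    have eD: "?D = ?D2 @ ?p" using yk by (intro full_delta_Cons) simp
    have y: "set [y] \<subseteq> {1..k}" using Suc.prems yk by simp
    have "?c (y # ?D2) (?D2 @ [y])"
      using s2 y by (intro braid_commute_word) auto
    then have "?c ((y # ?D2) @ (?p @ [y] @ ?p @ [y])) ((?D2 @ [y]) @ (?p @ [y] @ ?p @ [y]))"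
      using s2 y by (intro pres_cong_right) auto
    also have "(?D2 @ [y]) @ (?p @ [y] @ ?p @ [y]) = ?D2 @ ([y] @ ?p @ [y] @ ?p) @ [y]" by simp
    also have "?c (?D2 @ ([y] @ ?p @ [y] @ ?p) @ [y]) (?D2 @ (?p @ [y] @ ?p @ [y]) @ [y])"
      using s2 y yk Suc.prems by (intro pres_cong_ctxt full_path_four) auto
    finally have "?c (y # full_delta k y) (full_delta k y @ [y])"
      unfolding e eP eD by simp
    then show ?thesis unfolding True by (rule pres_cong.sym)
  qed
qed

text \<open>With \<open>b = full_delta k (a + 1)\<close> one has \<open>a b a = full_delta k (a + 2) \<cdot> full_path k a\<close>, and both factors
  commute with \<open>b\<close>.\<close>

lemma full_delta_four:
  assumes "1 \<le> a" "a < k"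
  shows "braid_eq (cox True k) ([a] @ full_delta k (Suc a) @ [a] @ full_delta k (Suc a))
    (full_delta k (Suc a) @ [a] @ full_delta k (Suc a) @ [a])"
proof -
  let ?c = "braid_eq (cox True k)"
  let ?b = "full_delta k (Suc a)"
  let ?P = "full_path k (Suc a)"
  let ?D = "full_delta k (Suc (Suc a))"
  let ?Q = "full_path k a"
  have sets: "set ?b \<subseteq> {1..k}" "set ?b \<subseteq> {Suc a..k}" "set ?P \<subseteq> {1..k}" "set ?D \<subseteq> {1..k}" "set ?D \<subseteq> {Suc (Suc a)..k}"
    "set ?Q \<subseteq> {1..k}" "set [a] \<subseteq> {1..k}"
    using set_full[of "Suc a" k] set_full[of "Suc (Suc a)" k] set_full[of a k] assms by auto
  have b: "?b = ?D @ ?P" using assms by (intro full_delta_Cons) simp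
  have Q: "?Q = [a] @ ?P @ [a]" using full_path_Cons[OF assms] by simp
  have aD: "?c (a # ?D) (?D @ [a])" using sets by (intro braid_commute_word) auto
  have aba: "?c ([a] @ ?b @ [a]) (?D @ ?Q)"
  proof -
    have "?c ((a # ?D) @ (?P @ [a])) ((?D @ [a]) @ (?P @ [a]))" using aD sets by (intro pres_cong_right) auto
    then show ?thesis unfolding b Q by simp
  qed
  have "?c (([a] @ ?b @ [a]) @ ?b) ((?D @ ?Q) @ ?b)" using aba sets by (intro pres_cong_right) auto
  also have "(?D @ ?Q) @ ?b = ?D @ (?Q @ ?b)" by simp
  also have "?c (?D @ (?Q @ ?b)) (?D @ (?b @ ?Q))"
  proof -
    have "?c (?Q @ ?b) (?b @ ?Q)"
      using sets assms by (intro commute_words full_path_commute) auto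
    then show ?thesis using sets by (intro pres_cong_left) auto
  qed
  also have "?D @ (?b @ ?Q) = (?D @ ?b) @ ?Q" by simp
  also have "?c ((?D @ ?b) @ ?Q) ((?b @ ?D) @ ?Q)"
  proof -
    have "?c (?b @ ?D) (?D @ ?b)"
      using sets assms by (intro commute_words full_delta_central) auto
    then show ?thesis using sets by (intro pres_cong_right pres_cong.sym[of _ _ "?b @ ?D"]) auto
  qed
  also have "(?b @ ?D) @ ?Q = ?b @ (?D @ ?Q)" by simp
  also have "?c (?b @ (?D @ ?Q)) (?b @ ([a] @ ?b @ [a]))"
    using sets by (intro pres_cong_left pres_cong.sym[OF aba]) auto
  finally show ?thesis by simp
qed

text \<open>Both words have the crossing numbers of the half twists for \<open>folded n J\<close>,
  so no braid moves between them have to be exhibited.\<close>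

lemma unfold_delta:
  assumes k: "k = (n + 1) div 2" "1 \<le> n" and J: "J \<subseteq> {1..k}"
  shows "braid_eq (cox_A n) (unfold n (delta True k J 1)) (delta_A n (folded n J))"
proof (rule braid_eq_delta_A[OF k(2)])
  have J': "J \<subseteq> {1..(n + 1) div 2}" using J k by simp
  show "folded n J \<subseteq> {1..n}" by (rule folded_subset[OF J'])
  have d: "set (delta True k J 1) \<subseteq> J" using set_delta[of True k J 1] by auto
  then have "set (delta True k J 1) \<subseteq> {1..(n + 1) div 2}" using J' by blast
  from set_unfold[OF this] have "set (unfold n (delta True k J 1)) \<subseteq> folded n J"
    using folded_mono[OF d] by simp
  then show "set (unfold n (delta True k J 1)) \<subseteq> {1..n}" using folded_subset[OF J'] by blast
  have "J \<inter> {1..} = J" using J by auto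
  then show "cross (unfold n (delta True k J 1)) y z = (if sim (folded n J) y z then 1 else 0)"
    if "y \<in> {1..Suc n}" "z \<in> {1..Suc n}" "y \<noteq> z" for y z
    using cross_delta_B[OF k(1) J, of y z 1] that by simp
qed

lemma alt_concat_cong:
  assumes "pres_cong I R u u'" "pres_cong I R v v'"
  shows "pres_cong I R (alt_concat k u v) (alt_concat k u' v')"
  using assms
proof (induction k arbitrary: u v u' v')
  case 0
  then show ?case by (auto intro: pres_cong.refl)
next
  case (Suc k)
  then show ?case by (simp add: pres_cong.append)
qed

lemma alt_concat_singleton: "alt_concat k [i] [j] = alt_word k i j"
  by (induction k arbitrary: i j) auto

lemma concat_map_alt_concat: "concat (map h (alt_concat k u v)) = alt_concat k (concat (map h u)) (concat (map h v))"
  by (induction k arbitrary: u v) auto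

text \<open>The relations between the half twists supply the conditions \<open>near\<close>,
  \<open>three\<close>, \<open>right\<close> and \<open>left\<close>.\<close>

lemma (in finite_irreducible) colouringI:
  assumes rank: "3 \<le> card (nodes L)"
    and sub: "\<And>i. i \<in> nodes L \<Longrightarrow> J i \<subseteq> {1..n}"
    and disj: "\<And>i j. i \<in> nodes L \<Longrightarrow> j \<in> nodes L \<Longrightarrow> i \<noteq> j \<Longrightarrow> J i \<inter> J j = {}"
    and cover: "{1..n} \<subseteq> (\<Union>i\<in>nodes L. J i)"
    and far: "\<And>i j. i \<in> nodes L \<Longrightarrow> j \<in> nodes L \<Longrightarrow> i \<noteq> j \<Longrightarrow> bond L i j \<noteq> 2 \<Longrightarrow>
      \<exists>x. x \<in> J i \<and> Suc x \<in> J j \<or> x \<in> J j \<and> Suc x \<in> J i"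
    and rel: "\<And>i j k. i \<in> nodes L \<Longrightarrow> j \<in> nodes L \<Longrightarrow> i \<noteq> j \<Longrightarrow> bond L i j = enat k \<Longrightarrow>
      braid_eq (cox_A n) (alt_concat k (delta_A n (J i)) (delta_A n (J j))) (alt_concat k (delta_A n (J j)) (delta_A n (J i)))"
  shows "colouring L n J"
proof (unfold_locales)
  fix i j x assume ij: "i \<in> nodes L" "j \<in> nodes L" "i \<noteq> j"
  note c = sub[OF ij(1)] sub[OF ij(2)] disj[OF ij]
  show "x \<in> J i \<Longrightarrow> Suc x \<in> J j \<Longrightarrow> bond L i j \<noteq> 2"
    using adjacent_not_2[OF c rel[OF ij]] by (auto simp: numeral_eq_enat)
  show "bond L i j = 3 \<Longrightarrow> x \<in> J i \<Longrightarrow> x - 1 \<notin> J i \<and> Suc x \<notin> J i \<and> (x - 1 \<in> J j \<longleftrightarrow> Suc x \<notin> J j)"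
    using bond_3_rule[OF c rel[OF ij, of 3]] by (simp add: numeral_eq_enat)
  fix z k
  show "bond L i j = enat k \<Longrightarrow> k = 4 \<or> k = 5 \<Longrightarrow>
      x \<in> J i \<Longrightarrow> x - 1 \<notin> J i \<Longrightarrow> x - 1 \<notin> J j \<Longrightarrow> Suc x < z \<Longrightarrow> {Suc x..<z} \<subseteq> J j \<Longrightarrow> z \<notin> J j \<Longrightarrow>
      z \<in> J i \<and> (k = 5 \<longrightarrow> Suc z \<in> J i \<union> J j)"
    using heavy_right[OF c rel[OF ij, of k]] by blast
  show "bond L i j = enat k \<Longrightarrow> k = 4 \<or> k = 5 \<Longrightarrow>
      x \<in> J i \<Longrightarrow> Suc x \<notin> J i \<Longrightarrow> Suc x \<notin> J j \<Longrightarrow> 1 \<le> z \<Longrightarrow> z < x \<Longrightarrow> {z..<x} \<subseteq> J j \<Longrightarrow> z - 1 \<notin> J j \<Longrightarrow>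
      z - 1 \<in> J i \<and> (k = 5 \<longrightarrow> z - 2 \<in> J i \<union> J j)"
    using heavy_left[OF c rel[OF ij, of k]] by blast
qed (use rank sub disj cover far in blast)+

section \<open>Automorphisms of type B\<close>

text \<open>The bond 4 fixes the pair \<open>m - 1, m\<close>. As \<open>m \<ge> 3\<close>, only
  \<open>m - 1\<close> has a further neighbour, which tells the two apart, and the remaining
  vertices follow one after the other down the path.\<close>

lemma cox_B_automorphism:
  assumes m: "3 \<le> m" and \<rho>: "coxeter_iso \<rho> (cox_B m) (cox_B m)" and i: "i \<in> {1..m}"
  shows "\<rho> i = i"
proof -
  have bij: "bij_betw \<rho> {1..m} {1..m}"
    and bd: "\<And>x y. x \<in> {1..m} \<Longrightarrow> y \<in> {1..m} \<Longrightarrow> bond (cox_B m) (\<rho> x) (\<rho> y) = bond (cox_B m) x y"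
    using \<rho> by (auto simp: coxeter_iso_def)
  have r: "\<rho> x \<in> {1..m}" if "x \<in> {1..m}" for x using bij that by (metis bij_betwE)
  have inj: "\<rho> x \<noteq> \<rho> y" if "x \<in> {1..m}" "y \<in> {1..m}" "x \<noteq> y" for x y
    using bij that by (meson bij_betw_imp_inj_on inj_onD)
  have four: "bond (cox_B m) x y = 4 \<Longrightarrow> {x, y} = {m - 1, m}" for x y
    by (auto simp: cox_B_def split: if_splits)
  have threeB: "bond (cox_B m) x y = 3 \<Longrightarrow> (y = Suc x \<or> x = Suc y) \<and> {x, y} \<noteq> {m - 1, m}" for x y
    by (auto simp: cox_B_def split: if_splits)
  have mm: "m \<in> {1..m}" "m - 1 \<in> {1..m}" "m - 2 \<in> {1..m}" using m by auto
  have "bond (cox_B m) (m - 1) m = 4" using m by (simp add: cox_B_def)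
  then have s: "{\<rho> (m - 1), \<rho> m} = {m - 1, m}" using bd[OF mm(2,1)] four by metis
  have b3: "bond (cox_B m) (m - 2) (m - 1) = 3" using m by (auto simp: cox_B_def doubleton_eq_iff)
  have top: "\<rho> (m - 1) = m - 1 \<and> \<rho> m = m"
  proof (rule ccontr)
    assume "\<not> ?thesis"
    then have "\<rho> (m - 1) = m" using s by (auto simp: doubleton_eq_iff)
    then have t: "bond (cox_B m) (\<rho> (m - 2)) m = 3" using bd[OF mm(3,2)] b3 by simp
    have "\<rho> (m - 2) \<le> m" using r[OF mm(3)] by simp
    then have "\<rho> (m - 2) = m - 1" using threeB[OF t] by auto
    then show False using threeB[OF t] by simp
  qed
  have "d < m \<longrightarrow> \<rho> (m - d) = m - d" for d
  proof (induction d rule: less_induct)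
    case (less d)
    show ?case
    proof (intro impI)
      assume dm: "d < m"
      consider "d = 0" | "d = 1" | "2 \<le> d" by linarith
      then show "\<rho> (m - d) = m - d"
      proof cases
        case 3
        define x where "x = m - d"
        have x: "1 \<le> x" "x + 2 \<le> m" "x \<in> {1..m}" "Suc x \<in> {1..m}" "Suc (Suc x) \<in> {1..m}"
          using dm 3 unfolding x_def by auto
        have IH: "\<rho> (Suc x) = Suc x" "\<rho> (Suc (Suc x)) = Suc (Suc x)"
        proof -
          have "Suc x = m - (d - 1)" "Suc (Suc x) = m - (d - 2)" using dm 3 unfolding x_def by auto
          then show "\<rho> (Suc x) = Suc x" "\<rho> (Suc (Suc x)) = Suc (Suc x)"
            using less[of "d - 1"] less[of "d - 2"] dm 3 by auto
        qed
        have "bond (cox_B m) x (Suc x) = 3" using x by (auto simp: cox_B_def doubleton_eq_iff)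
        then have "bond (cox_B m) (\<rho> x) (Suc x) = 3" using bd[OF x(3,4)] IH(1) by simp
        then have "\<rho> x = x \<or> \<rho> x = Suc (Suc x)" using threeB by fastforce
        moreover have "\<rho> x \<noteq> Suc (Suc x)" using inj[OF x(3,5)] IH(2) by simp
        ultimately show ?thesis unfolding x_def by simp
      qed (use top in auto)
    qed
  qed
  from this[of "m - i"] show ?thesis using i by auto
qed

text \<open>This identifies an arbitrary numbering of the source with the one read off from the
  path.\<close>

lemma cox_B_iso_unique:
  assumes m: "3 \<le> m" and \<sigma>: "coxeter_iso \<sigma> (cox_B m) L" and \<tau>: "coxeter_iso \<tau> (cox_B m) L"
    and i: "i \<in> {1..m}"
  shows "\<sigma> i = \<tau> i"
proof -
  have bs: "bij_betw \<sigma> {1..m} (nodes L)" and bt: "bij_betw \<tau> {1..m} (nodes L)"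
    using \<sigma> \<tau> by (simp_all add: coxeter_iso_def)
  define \<rho> where "\<rho> = inv_into {1..m} \<tau> \<circ> \<sigma>"
  have br: "bij_betw \<rho> {1..m} {1..m}"
    unfolding \<rho>_def by (rule bij_betw_trans[OF bs bij_betw_inv_into[OF bt]])
  have tr: "\<tau> (\<rho> x) = \<sigma> x" "\<rho> x \<in> {1..m}" if "x \<in> {1..m}" for x
  proof -
    have "\<sigma> x \<in> nodes L" using bs that by (metis bij_betwE)
    then show "\<tau> (\<rho> x) = \<sigma> x" unfolding \<rho>_def using bt by (simp add: bij_betw_inv_into_right)
    show "\<rho> x \<in> {1..m}" using br that by (metis bij_betwE)
  qed
  have "coxeter_iso \<rho> (cox_B m) (cox_B m)"
    unfolding coxeter_iso_def nodes_cox
  proof (intro conjI ballI)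
    fix x y assume xy: "x \<in> {1..m}" "y \<in> {1..m}"
    have "bond (cox_B m) (\<rho> x) (\<rho> y) = bond L (\<tau> (\<rho> x)) (\<tau> (\<rho> y))"
      using \<tau> tr(2)[OF xy(1)] tr(2)[OF xy(2)] by (simp add: coxeter_iso_def)
    also have "\<dots> = bond (cox_B m) x y"
      using \<sigma> xy by (simp add: tr(1) coxeter_iso_def)
    finally show "bond (cox_B m) (\<rho> x) (\<rho> y) = bond (cox_B m) x y" .
  qed (rule br)
  then have "\<rho> i = i" using m i by (intro cox_B_automorphism) auto
  then show ?thesis using tr(1)[OF i] by simp
qed

section \<open>Disjoint standard homomorphisms\<close>

text \<open>The records differ even for \<open>n = 1\<close>, by the entry at \<open>(0, 1)\<close>
  outside the index set.\<close>

lemma cox_A_neq_cox_B: "1 \<le> n \<Longrightarrow> cox_A n \<noteq> cox_B n"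
proof
  assume n: "1 \<le> n" and eq: "cox_A n = cox_B n"
  have "bond (cox_A n) (n - 1) n = 3" "bond (cox_B n) (n - 1) n = 4"
    using n by (auto simp: cox_A_def cox_B_def)
  then show False unfolding eq by simp
qed

lemma cox_A_iso_bond_neq_4:
  assumes "coxeter_iso \<sigma> (cox_A n) L" "i \<in> nodes L" "j \<in> nodes L"
  shows "bond L i j \<noteq> 4"
proof -
  have b: "bij_betw \<sigma> (nodes (cox_A n)) (nodes L)"
    and e: "\<And>x y. x \<in> nodes (cox_A n) \<Longrightarrow> y \<in> nodes (cox_A n) \<Longrightarrow> bond L (\<sigma> x) (\<sigma> y) = bond (cox_A n) x y"
    using assms(1) by (simp_all add: coxeter_iso_def)
  obtain x where x: "x \<in> nodes (cox_A n)" "i = \<sigma> x" using b assms(2) unfolding bij_betw_def by blast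
  obtain y where y: "y \<in> nodes (cox_A n)" "j = \<sigma> y" using b assms(3) unfolding bij_betw_def by blast
  have "bond L i j = bond (cox_A n) x y" unfolding x(2) y(2) by (rule e[OF x(1) y(1)])
  then show ?thesis by (auto simp: cox_A_def one_enat_def numeral_eq_enat)
qed

text \<open>On words \<open>\<Phi>\<close> is the relabelling by the inverse of
  \<open>\<sigma>\<close>. Relabelling back by \<open>\<sigma>\<close> respects the relations, which
  gives injectivity.\<close>

lemma artin_iso:
  fixes g :: "'a \<Rightarrow> 'b"
  assumes \<Phi>: "\<Phi> \<in> artin_hom L M" and \<sigma>: "coxeter_iso \<sigma> M L"
    and gen: "\<And>x. x \<in> nodes M \<Longrightarrow> \<Phi> (artin_gen L (\<sigma> x)) = artin_gen M x"
  shows "\<Phi> \<in> iso (artin_monoid L) (artin_monoid M)"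
proof -
  let ?g = "inv_into (nodes M) \<sigma>"
  have bij: "bij_betw \<sigma> (nodes M) (nodes L)" using \<sigma> by (simp add: coxeter_iso_def)
  have g: "?g i \<in> nodes M" "\<sigma> (?g i) = i" if "i \<in> nodes L" for i
    using bij_betw_inv_into[OF bij] bij_betw_inv_into_right[OF bij] that by (auto dest: bij_betwE)
  have g': "?g (\<sigma> x) = x" "\<sigma> x \<in> nodes L" if "x \<in> nodes M" for x
    using bij that by (auto simp: bij_betw_inv_into_left dest: bij_betwE)
  have word: "\<Phi> (artin_class L u) = artin_class M (map ?g u)" if u: "set u \<subseteq> nodes L" for u
  proof -
    have "\<Phi> (artin_class L u) = artin_class M (concat (map (\<lambda>i. [?g i]) u))"
    proof (rule hom_on_words[OF _ _ _ u])
      show "\<Phi> \<in> monoid_hom (presented_monoid (nodes L) (braid_relations L)) (presented_monoid (nodes M) (braid_relations M))"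
        using \<Phi> by (simp add: artin_monoid_def)
      fix i assume i: "i \<in> nodes L"
      show "set [?g i] \<subseteq> nodes M" using g i by simp
      show "\<Phi> (artin_class L [i]) = artin_class M [?g i]"
        using gen[OF g(1)[OF i]] g(2)[OF i] by (simp add: artin_gen_def)
    qed
    then show ?thesis by simp
  qed
  have lift: "braid_eq L (map \<sigma> u) (map \<sigma> v)" if "braid_eq M u v" for u v
  proof -
    have "braid_eq L (concat (map (\<lambda>x. [\<sigma> x]) u)) (concat (map (\<lambda>x. [\<sigma> x]) v))"
      using that
    proof (rule pres_cong_concat_map)
      fix x assume "x \<in> nodes M"
      then show "set [\<sigma> x] \<subseteq> nodes L" using g' by simp
    next
      fix u v assume "(u, v) \<in> braid_relations M"
      then obtain k i j where *: "u = alt_word k i j" "v = alt_word k j i" "i \<in> nodes M" "j \<in> nodes M" "i \<noteq> j"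
        "bond M i j = enat k" by (auto simp: braid_relations_def)
      have "bond L (\<sigma> i) (\<sigma> j) = enat k" using \<sigma> * by (simp add: coxeter_iso_def)
      moreover have "\<sigma> i \<noteq> \<sigma> j" using g'(1) * by metis
      ultimately show "braid_eq L (concat (map (\<lambda>x. [\<sigma> x]) u)) (concat (map (\<lambda>x. [\<sigma> x]) v))"
        unfolding * concat_map_alt_word alt_concat_singleton using g'(2) * by (intro braid_eq_alt) auto
    qed
    then show ?thesis by simp
  qed
  have gs: "map \<sigma> (map ?g u) = u" if "set u \<subseteq> nodes L" for u
    using that g(2) by (auto simp: subset_iff intro: map_idI)
  have carr: "carrier (artin_monoid L) = artin_class L ` {u. set u \<subseteq> nodes L}"
    "carrier (artin_monoid M) = artin_class M ` {u. set u \<subseteq> nodes M}"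
    by (simp_all add: artin_monoid_def presented_carrier)
  have gsub: "set (map ?g u) \<subseteq> nodes M" if "set u \<subseteq> nodes L" for u using that g(1) by auto
  have "inj_on \<Phi> (carrier (artin_monoid L))"
  proof (rule inj_onI)
    fix a b assume "a \<in> carrier (artin_monoid L)" "b \<in> carrier (artin_monoid L)" and eq: "\<Phi> a = \<Phi> b"
    then obtain u v where uv: "set u \<subseteq> nodes L" "a = artin_class L u" "set v \<subseteq> nodes L" "b = artin_class L v"
      unfolding carr by blast
    have "artin_class M (map ?g u) = artin_class M (map ?g v)" using eq word uv by simp
    moreover have "map ?g u \<in> lists (nodes M)" using gsub[OF uv(1)] by auto
    ultimately have "braid_eq M (map ?g u) (map ?g v)" by (simp add: pres_class_eq_iff)
    from lift[OF this] have "braid_eq L u v" unfolding gs[OF uv(1)] gs[OF uv(3)] .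
    then show "a = b" unfolding uv by (rule pres_class_eqI)
  qed
  moreover have "\<Phi> ` carrier (artin_monoid L) = carrier (artin_monoid M)"
  proof
    show "\<Phi> ` carrier (artin_monoid L) \<subseteq> carrier (artin_monoid M)"
      using \<Phi> by (auto simp: monoid_hom_def hom_def)
    show "carrier (artin_monoid M) \<subseteq> \<Phi> ` carrier (artin_monoid L)"
    proof
      fix b assume "b \<in> carrier (artin_monoid M)"
      then obtain v where v: "set v \<subseteq> nodes M" "b = artin_class M v" unfolding carr by blast
      have s: "set (map \<sigma> v) \<subseteq> nodes L" using v g'(2) by auto
      have "map ?g (map \<sigma> v) = v" using v g'(1) by (auto simp: subset_iff intro: map_idI)
      then have "b = \<Phi> (artin_class L (map \<sigma> v))" using word[OF s] v by simp
      then show "b \<in> \<Phi> ` carrier (artin_monoid L)" unfolding carr using s by blast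
    qed
  qed
  ultimately show ?thesis using \<Phi> by (simp add: iso_def bij_betw_def monoid_hom_def)
qed

section \<open>The supports of an optimal disjoint standard homomorphism\<close>

locale standard_disjoint = finite_irreducible L for L :: "'a coxeter" +
  fixes b :: bool and n :: nat and \<Phi> :: "'a list set \<Rightarrow> nat list set"
  assumes rank: "3 \<le> card (nodes L)" and n: "1 \<le> n"
    and hom: "\<Phi> \<in> artin_hom L (cox b n)" and optimal: "optimal_hom L (cox b n) \<Phi>"
    and full: "fully_supported_hom L (cox b n) \<Phi>" and disjoint: "disjoint_hom L \<Phi>"
    and standard: "standard_hom L (cox b n) \<Phi>"
begin

abbreviation "M \<equiv> cox b n"

definition supp :: "'a \<Rightarrow> nat set" where
  "supp i = hom_support L \<Phi> i"

abbreviation "dl i \<equiv> delta b n (supp i) 1"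

lemma supp_sub: "i \<in> nodes L \<Longrightarrow> supp i \<subseteq> {1..n}"
proof -
  assume "i \<in> nodes L"
  then have "\<Phi> (artin_gen L i) = artin_elt M (longest_elt M (supp i))"
    using standard by (simp add: standard_hom_def supp_def)
  then have "supp i = (\<Union>u\<in>artin_elt M (longest_elt M (supp i)). set u)"
    by (simp add: supp_def hom_support_def artin_support_def)
  moreover have "set u \<subseteq> {1..n}" if "u \<in> artin_elt M w" for u w
    using that pres_cong_lists[of "{1..n}" "braid_relations M" _ u] by (auto simp: artin_elt_def pres_class_def)
  ultimately show ?thesis by blast
qed

lemma gen_image:
  assumes "i \<in> nodes L"
  shows "\<Phi> (artin_gen L i) = artin_elt M (longest_elt M (supp i))"
    and "\<Phi> (artin_gen L i) = artin_class M (dl i)"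
proof -
  show 1: "\<Phi> (artin_gen L i) = artin_elt M (longest_elt M (supp i))"
    using standard assms by (simp add: standard_hom_def supp_def)
  show "\<Phi> (artin_gen L i) = artin_class M (dl i)"
    unfolding 1 by (rule artin_elt_longest[OF n supp_sub[OF assms]])
qed

lemma set_dl: "i \<in> nodes L \<Longrightarrow> set (dl i) \<subseteq> supp i" "i \<in> nodes L \<Longrightarrow> set (dl i) \<subseteq> {1..n}"
  using set_delta[of b n "supp i" 1] by auto

lemma word_image:
  assumes "set u \<subseteq> nodes L"
  shows "\<Phi> (artin_class L u) = artin_class M (concat (map dl u))"
proof (rule hom_on_words[OF _ _ _ assms])
  show "\<Phi> \<in> monoid_hom (presented_monoid (nodes L) (braid_relations L)) (presented_monoid (nodes M) (braid_relations M))"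
    using hom by (simp add: artin_monoid_def)
  fix i assume "i \<in> nodes L"
  then show "set (dl i) \<subseteq> nodes M" "\<Phi> (artin_class L [i]) = artin_class M (dl i)"
    using gen_image(2)[of i] set_dl(2)[of i] by (simp_all add: artin_gen_def)
qed

lemma rel_image:
  assumes "i \<in> nodes L" "j \<in> nodes L" "i \<noteq> j" "bond L i j = enat k"
  shows "braid_eq M (alt_concat k (dl i) (dl j)) (alt_concat k (dl j) (dl i))"
proof -
  have s: "set (alt_word k i j) \<subseteq> nodes L" "set (alt_word k j i) \<subseteq> nodes L"
    using set_alt_word[of k i j] set_alt_word[of k j i] assms by auto
  have "artin_class L (alt_word k i j) = artin_class L (alt_word k j i)"
    by (rule pres_class_eqI[OF braid_eq_alt[OF assms]])
  then have "artin_class M (alt_concat k (dl i) (dl j)) = artin_class M (alt_concat k (dl j) (dl i))"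
    using word_image[OF s(1)] word_image[OF s(2)] by (simp add: concat_map_alt_word)
  moreover have "set (alt_concat k (dl i) (dl j)) \<subseteq> nodes M"
    using set_alt_concat[of k "dl i" "dl j"] set_dl(2)[OF assms(1)] set_dl(2)[OF assms(2)] by auto
  then have "alt_concat k (dl i) (dl j) \<in> lists (nodes M)" by auto
  ultimately show ?thesis using pres_class_eq_iff by metis
qed

text \<open>Length 1 would mean equal images, which different supports exclude, so 2 is the least
  braid length of the images and optimality applies.\<close>

lemma commuting_bond:
  assumes ij: "i \<in> nodes L" "j \<in> nodes L" "i \<noteq> j" and ne: "supp i \<noteq> supp j"
    and c: "braid_eq M (dl i @ dl j) (dl j @ dl i)"
  shows "bond L i j = 2"
proof -
  let ?x = "\<Phi> (artin_gen L i)"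
  let ?y = "\<Phi> (artin_gen L j)"
  let ?B = "braid_lengths (artin_monoid M) ?x ?y"
  have xy: "?x \<noteq> ?y" using ne by (auto simp: supp_def hom_support_def)
  have s: "set (dl i) \<subseteq> nodes M" "set (dl j) \<subseteq> nodes M" using set_dl(2)[OF ij(1)] set_dl(2)[OF ij(2)] by simp_all
  have alt: "alt_prod (artin_monoid M) k ?x ?y = artin_class M (alt_concat k (dl i) (dl j))"
    "alt_prod (artin_monoid M) k ?y ?x = artin_class M (alt_concat k (dl j) (dl i))" for k
    unfolding artin_monoid_def gen_image(2)[OF ij(1)] gen_image(2)[OF ij(2)]
    by (rule alt_prod_class[OF s], rule alt_prod_class[OF s(2,1)])
  have "artin_class M (alt_concat 2 (dl i) (dl j)) = artin_class M (alt_concat 2 (dl j) (dl i))"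
    using c by (intro pres_class_eqI) (simp add: numeral_eq_Suc)
  then have two: "2 \<in> ?B" by (simp only: braid_lengths_def alt mem_Collect_eq) simp
  have "1 \<notin> ?B"
  proof
    assume "1 \<in> ?B"
    then have "artin_class M (alt_concat 1 (dl i) (dl j)) = artin_class M (alt_concat 1 (dl j) (dl i))"
      by (simp only: braid_lengths_def alt mem_Collect_eq)
    then show False using xy gen_image(2) ij by simp
  qed
  moreover have "0 \<notin> ?B" by (simp add: braid_lengths_def)
  ultimately have "2 \<le> k" if "k \<in> ?B" for k using that by (metis One_nat_def Suc_1 less_2_cases not_le)
  then have "(LEAST k. k \<in> ?B) = 2" using two by (intro Least_equality)
  moreover have "bond L i j = enat (LEAST k. k \<in> ?B)"
    using optimal ij xy two unfolding optimal_hom_def Let_def by blast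
  ultimately show ?thesis by (simp add: numeral_eq_enat)
qed

lemma supp_disjoint: "i \<in> nodes L \<Longrightarrow> j \<in> nodes L \<Longrightarrow> i \<noteq> j \<Longrightarrow> supp i \<inter> supp j = {}"
  using disjoint by (simp add: disjoint_hom_def supp_def)

lemma supp_cover: "(\<Union>i\<in>nodes L. supp i) = {1..n}"
  using full by (simp add: fully_supported_hom_def supp_def)

text \<open>A generator with empty support maps to 1, which commutes with everything. By
  \<open>commuting_bond\<close> its neighbours in the graph have empty support too, and by
  irreducibility this spreads to all generators, against full support.\<close>

lemma supp_nonempty:
  assumes "i \<in> nodes L"
  shows "supp i \<noteq> {}"
proof
  assume e: "supp i = {}"
  let ?A = "{i \<in> nodes L. supp i = {}}"
  have "?A = nodes L"
  proof (rule irreducible_closed[OF irr, of _ i])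
    fix x y assume x: "x \<in> ?A" and y: "y \<in> nodes L" "x \<noteq> y" "2 < bond L x y"
    show "y \<in> ?A"
    proof (rule ccontr)
      assume "y \<notin> ?A"
      then have "supp x \<noteq> supp y" using x y by auto
      moreover have "dl x = []" using set_dl(1)[of x] x by auto
      then have "braid_eq M (dl x @ dl y) (dl y @ dl x)"
        using set_dl(2)[OF y(1)] by (auto intro!: pres_cong.refl)
      ultimately have "bond L x y = 2" using commuting_bond x y by blast
      then show False using y(3) by simp
    qed
  qed (use assms e in auto)
  then have "(\<Union>i\<in>nodes L. supp i) = {}" by blast
  then show False using supp_cover n by simp
qed

text \<open>Disjoint supports that do not touch give commuting images.\<close>

lemma supp_far:
  assumes ij: "i \<in> nodes L" "j \<in> nodes L" "i \<noteq> j" and bd: "bond L i j \<noteq> 2"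
  shows "\<exists>x. x \<in> supp i \<and> Suc x \<in> supp j \<or> x \<in> supp j \<and> Suc x \<in> supp i"
proof (rule ccontr)
  assume no: "\<not> ?thesis"
  have "supp i \<noteq> supp j" using supp_disjoint[OF ij] supp_nonempty[OF ij(1)] by auto
  moreover have "braid_eq M (dl i @ dl j) (dl j @ dl i)"
  proof (rule braid_commute_words[OF set_dl(2)[OF ij(1)] set_dl(2)[OF ij(2)]])
    fix x y assume "x \<in> set (dl i)" "y \<in> set (dl j)"
    then have m: "x \<in> supp i" "y \<in> supp j" using set_dl(1) ij by blast+
    then have "x \<noteq> y" using supp_disjoint[OF ij] by blast
    moreover have "y \<noteq> Suc x" "x \<noteq> Suc y" using no m by blast+
    ultimately show "x + 2 \<le> y \<or> y + 2 \<le> x" by linarith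
  qed
  ultimately show False using commuting_bond[OF ij] bd by blast
qed

text \<open>For a target of type B the relations between the images are transported by
  \<open>unfold_braid\<close>, and the unfolded longest elements are recognised as half twists by
  \<open>unfold_delta\<close>.\<close>

lemma strand_colouring: "colouring L (strands b n) (\<lambda>i. strand_set b n (supp i))"
proof (rule colouringI[OF rank])
  fix i assume i: "i \<in> nodes L"
  show "strand_set b n (supp i) \<subseteq> {1..strands b n}" by (rule strand_set_subset[OF n supp_sub[OF i]])
next
  show "{1..strands b n} \<subseteq> (\<Union>i\<in>nodes L. strand_set b n (supp i))"
  proof
    fix x assume x: "x \<in> {1..strands b n}"
    have cov: "\<exists>i\<in>nodes L. y \<in> supp i" if "y \<in> {1..n}" for y using supp_cover that by blast
    show "x \<in> (\<Union>i\<in>nodes L. strand_set b n (supp i))"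
    proof (cases "x \<le> n")
      case True
      then have xn: "x \<in> {1..n}" using x by simp
      then show ?thesis using cov[OF xn] strand_set_mem_iff[OF n supp_sub xn] by blast
    next
      case False
      then have B: b and xl: "2 * n - x \<in> {1..n}" using x by (auto simp: strands_def split: if_splits)
      obtain i where i: "i \<in> nodes L" "2 * n - x \<in> supp i" using cov[OF xl] by blast
      have "2 * n - 1 + 1 - (2 * n - x) = x" using x B n by (auto simp: strands_def)
      then have "x \<in> folded (2 * n - 1) (supp i)" unfolding folded_def using i(2) by (intro UN_I[OF i(2)]) simp
      then show ?thesis using i(1) B by (auto simp: strand_set_def)
    qed
  qed
next
  fix i j assume ij: "i \<in> nodes L" "j \<in> nodes L" "i \<noteq> j"
  have disj: "y \<notin> supp j" if "y \<in> supp i" for y using supp_disjoint[OF ij] that by blast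
  show "strand_set b n (supp i) \<inter> strand_set b n (supp j) = {}"
  proof (cases b)
    case True
    have h: "(2 * n - 1 + 1) div 2 = n" by (rule half_odd[OF n])
    show ?thesis
    proof (rule ccontr)
      assume "\<not> ?thesis"
      then obtain x where x: "x \<in> folded (2 * n - 1) (supp i)" "x \<in> folded (2 * n - 1) (supp j)"
        using True by (auto simp: strand_set_def)
      obtain y where y: "y \<in> supp i" "x = y \<or> x = 2 * n - 1 + 1 - y" using x(1) unfolding folded_def by blast
      have "1 \<le> y" "y \<le> n" using y(1) supp_sub[OF ij(1)] by auto
      then have "y \<in> supp j"
        using folded_mem_iff[of "supp j" "2 * n - 1" y] supp_sub[OF ij(2)] x(2) y(2) unfolding h by metis
      then show False using disj y(1) by blast
    qed
  qed (use supp_disjoint[OF ij] in \<open>simp add: strand_set_def\<close>)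
  show "\<exists>x. x \<in> strand_set b n (supp i) \<and> Suc x \<in> strand_set b n (supp j) \<or>
        x \<in> strand_set b n (supp j) \<and> Suc x \<in> strand_set b n (supp i)" if "bond L i j \<noteq> 2"
  proof -
    have "y \<in> strand_set b n (supp l)" if "y \<in> supp l" for l y
      using that by (auto simp: strand_set_def folded_def)
    then show ?thesis using supp_far[OF ij that] by blast
  qed
  fix k assume k: "bond L i j = enat k"
  note r = rel_image[OF ij k]
  show "braid_eq (cox_A (strands b n))
      (alt_concat k (delta_A (strands b n) (strand_set b n (supp i))) (delta_A (strands b n) (strand_set b n (supp j))))
      (alt_concat k (delta_A (strands b n) (strand_set b n (supp j))) (delta_A (strands b n) (strand_set b n (supp i))))"
  proof (cases b)
    case True
    let ?n = "2 * n - 1"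
    have h: "n = (?n + 1) div 2" using half_odd[OF n] by simp
    have U: "braid_eq (cox_A ?n) (unfold ?n (dl l)) (delta_A ?n (folded ?n (supp l)))" if "l \<in> nodes L" for l
      using unfold_delta[OF h _ supp_sub[OF that]] True n by simp
    have "braid_eq (cox_B n) (alt_concat k (dl i) (dl j)) (alt_concat k (dl j) (dl i))"
      using r True by (simp add: cox_def)
    from unfold_braid[OF h this]
    have "braid_eq (cox_A ?n) (alt_concat k (unfold ?n (dl i)) (unfold ?n (dl j))) (alt_concat k (unfold ?n (dl j)) (unfold ?n (dl i)))"
      by (simp only: concat_map_alt_concat)
    note Ur = this
    have "braid_eq (cox_A ?n) (alt_concat k (delta_A ?n (folded ?n (supp i))) (delta_A ?n (folded ?n (supp j))))
       (alt_concat k (delta_A ?n (folded ?n (supp j))) (delta_A ?n (folded ?n (supp i))))"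
      by (rule pres_cong.trans[OF pres_cong.sym[OF alt_concat_cong[OF U[OF ij(1)] U[OF ij(2)]]]
            pres_cong.trans[OF Ur alt_concat_cong[OF U[OF ij(2)] U[OF ij(1)]]]])
    then show ?thesis using True by (simp add: strands_def strand_set_def)
  next
    case False
    then show ?thesis using r by (simp add: strands_def strand_set_def cox_def)
  qed
qed

lemma supp_classification:
  obtains f where "coxeter_iso f (cox_A (strands b n)) L" "\<And>x. x \<in> {1..strands b n} \<Longrightarrow> strand_set b n (supp (f x)) = {x}"
  | f m where "m = card (nodes L)" "2 * m \<le> strands b n + 1" "coxeter_iso f (cox_B m) L"
    "\<And>i. i \<in> {1..m - 1} \<Longrightarrow> strand_set b n (supp (f i)) = {i, strands b n + 1 - i}"
    "strand_set b n (supp (f m)) = {m..strands b n + 1 - m}"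
proof -
  let ?c = "colouring.col L (\<lambda>i. strand_set b n (supp i))"
  let ?m = "card (nodes L)"
  from colouring.classification[OF strand_colouring] show thesis
  proof (elim disjE conjE)
    assume *: "coxeter_iso ?c (cox_A (strands b n)) L" "\<forall>x\<in>{1..strands b n}. strand_set b n (supp (?c x)) = {x}"
    show thesis by (rule that(1)[OF *(1) bspec[OF *(2)]])
  next
    assume *: "2 * ?m \<le> strands b n + 1" "coxeter_iso ?c (cox_B ?m) L"
      "\<forall>i\<in>{1..?m - 1}. strand_set b n (supp (?c i)) = {i, strands b n + 1 - i}"
      "strand_set b n (supp (?c ?m)) = {?m..strands b n + 1 - ?m}"
    show thesis by (rule that(2)[OF HOL.refl *(1,2) bspec[OF *(3)] *(4)])
  qed
qed

text \<open>In the remaining case all strand sets are single letters. For a target of type B they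
  would also be closed under the mirror, but the letter 1 is not its own mirror in rank at least
  3.\<close>

lemma not_type_B:
  assumes "\<not> type_B L"
  shows "type_A L" "\<not> b" "\<Phi> \<in> iso (artin_monoid L) (artin_monoid M)"
proof -
  obtain f where f: "coxeter_iso f (cox_A (strands b n)) L"
    "\<And>x. x \<in> {1..strands b n} \<Longrightarrow> strand_set b n (supp (f x)) = {x}"
  proof (cases rule: supp_classification)
    case (2 f m)
    then have "type_B L" using rank unfolding type_B_def by (intro exI[of _ m]) auto
    then show ?thesis using assms by blast
  qed (rule that)
  have "1 \<le> 2 * n - 1" using n by linarith
  then have sn: "1 \<le> strands b n" using n by (simp add: strands_def)
  show nb: "\<not> b"
  proof
    assume B: b
    have "card (nodes L) = strands b n"
      using bij_betw_same_card[of f "{1..strands b n}" "nodes L"] f(1) by (simp add: coxeter_iso_def)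
    then have s: "strands b n = 2 * n - 1" "3 \<le> 2 * n - 1" using B rank by (simp_all add: strands_def)
    then have F: "folded (2 * n - 1) (supp (f 1)) = {1}" using f(2)[of 1] B by (simp add: strand_set_def)
    then obtain i where i: "i \<in> supp (f 1)" unfolding folded_def by blast
    then have "i \<in> {1}" "2 * n - 1 + 1 - i \<in> {1}" unfolding F[symmetric] folded_def by blast+
    then show False using s by simp
  qed
  then have M: "M = cox_A n" "strands b n = n" by (simp_all add: cox_def strands_def)
  show "type_A L" unfolding type_A_def using f(1) sn by blast
  show "\<Phi> \<in> iso (artin_monoid L) (artin_monoid M)"
    unfolding M(1)
  proof (rule artin_iso)
    show "\<Phi> \<in> artin_hom L (cox_A n)" using hom M by simp
    show fi: "coxeter_iso f (cox_A n) L" using f(1) M by simp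
    fix x assume x: "x \<in> nodes (cox_A n)"
    then have fx: "f x \<in> nodes L" using fi by (auto simp: coxeter_iso_def dest: bij_betwE)
    have "supp (f x) = {x}" using f(2)[of x] x nb M by (simp add: strand_set_def)
    then show "\<Phi> (artin_gen L (f x)) = artin_gen (cox_A n) x"
      using gen_image(2)[OF fx] delta_single[of x n b] x by (simp add: artin_gen_def M)
  qed
qed

text \<open>The bond 4 excludes the first alternative of \<open>supp_classification\<close>, and by
  uniqueness of the numbering the given \<open>\<sigma>\<close> is the one of the second.\<close>

lemma type_B_supports:
  assumes \<sigma>: "coxeter_iso \<sigma> (cox_B m) L" and m: "m = card (nodes L)"
  shows "2 * m \<le> strands b n + 1"
    and "\<And>i. i \<in> {1..m - 1} \<Longrightarrow> strand_set b n (supp (\<sigma> i)) = {i, strands b n + 1 - i}"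
    and "strand_set b n (supp (\<sigma> m)) = {m..strands b n + 1 - m}"
proof -
  have m3: "3 \<le> m" using rank m by simp
  have I: "\<sigma> i \<in> nodes L" if "i \<in> {1..m}" for i
    using \<sigma> that by (auto simp: coxeter_iso_def dest: bij_betwE)
  have "bond L (\<sigma> (m - 1)) (\<sigma> m) = bond (cox_B m) (m - 1) m"
    using \<sigma> m3 by (simp add: coxeter_iso_def)
  also have "\<dots> = 4" using m3 by (simp add: cox_B_def)
  finally have b4: "bond L (\<sigma> (m - 1)) (\<sigma> m) = 4" .
  obtain f where f: "2 * m \<le> strands b n + 1" "coxeter_iso f (cox_B m) L"
    "\<And>i. i \<in> {1..m - 1} \<Longrightarrow> strand_set b n (supp (f i)) = {i, strands b n + 1 - i}"
    "strand_set b n (supp (f m)) = {m..strands b n + 1 - m}"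
  proof (cases rule: supp_classification)
    case (1 f)
    then have "bond L (\<sigma> (m - 1)) (\<sigma> m) \<noteq> 4" using I[of "m - 1"] I[of m] m3 by (intro cox_A_iso_bond_neq_4) auto
    then show ?thesis using b4 by blast
  next
    case (2 f m')
    then show ?thesis using that m by blast
  qed
  have eq: "\<sigma> i = f i" if "i \<in> {1..m}" for i by (rule cox_B_iso_unique[OF m3 \<sigma> f(2) that])
  show "2 * m \<le> strands b n + 1" by (rule f(1))
  show "strand_set b n (supp (\<sigma> i)) = {i, strands b n + 1 - i}" if "i \<in> {1..m - 1}" for i
  proof -
    have "\<sigma> i = f i" using that by (intro eq) auto
    then show ?thesis using f(3)[OF that] by (simp only:)
  qed
  show "strand_set b n (supp (\<sigma> m)) = {m..strands b n + 1 - m}"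
  proof -
    have "\<sigma> m = f m" using m3 by (intro eq) simp
    then show ?thesis using f(4) by (simp only:)
  qed
qed

text \<open>The support of a generator is the part of its mirror symmetric strand set within
  \<open>[1, n]\<close>.\<close>

lemma type_B_to_B:
  assumes \<sigma>: "coxeter_iso \<sigma> (cox_B m) L" and m: "m = card (nodes L)" and b: b
  shows "m \<le> n" "\<And>i. i \<in> {1..m - 1} \<Longrightarrow> \<Phi> (artin_gen L (\<sigma> i)) = artin_gen (cox_B n) i"
    "\<Phi> (artin_gen L (\<sigma> m)) = artin_elt (cox_B n) (longest_elt (cox_B n) {m..n})"
proof -
  have m3: "3 \<le> m" using rank m by simp
  have I: "\<sigma> i \<in> nodes L" if "i \<in> {1..m}" for i
    using \<sigma> that by (auto simp: coxeter_iso_def dest: bij_betwE)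
  have s: "strands b n + 1 = 2 * n" using b n by (simp add: strands_def)
  have M: "M = cox_B n" using b by (simp add: cox_def)
  note ts = type_B_supports[OF \<sigma> m, unfolded s]
  show mn: "m \<le> n" using ts(1) by simp
  have supp: "x \<in> supp (\<sigma> i) \<longleftrightarrow> x \<in> {1..n} \<and> x \<in> strand_set b n (supp (\<sigma> i))" if "i \<in> {1..m}" for i x
    using strand_set_mem_iff[OF n supp_sub[OF I[OF that]], of x] supp_sub[OF I[OF that]] by blast
  show "\<Phi> (artin_gen L (\<sigma> i)) = artin_gen (cox_B n) i" if i: "i \<in> {1..m - 1}" for i
  proof -
    have im: "i \<in> {1..m}" "1 \<le> i" "i < n" using i mn m3 by auto
    have "x \<in> supp (\<sigma> i) \<longleftrightarrow> x \<in> {i}" for x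
      unfolding supp[OF im(1)] ts(2)[OF i] using im by auto
    then have "supp (\<sigma> i) = {i}" by blast
    then show ?thesis
      using gen_image(2)[OF I[OF im(1)]] delta_single[of i n b] im by (simp add: artin_gen_def M)
  qed
  have mm: "m \<in> {1..m}" using m3 by simp
  have "x \<in> supp (\<sigma> m) \<longleftrightarrow> x \<in> {m..n}" for x
    unfolding supp[OF mm] ts(3) using mn m3 by auto
  then have "supp (\<sigma> m) = {m..n}" by blast
  then show "\<Phi> (artin_gen L (\<sigma> m)) = artin_elt (cox_B n) (longest_elt (cox_B n) {m..n})"
    using gen_image(1)[OF I[OF mm]] by (simp add: M)
qed

end

section \<open>Factorisation through the standard unfolding\<close>

lemma standard_unfolding_ex:
  assumes n: "1 \<le> n" and k: "k = (n + 1) div 2"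
  defines "\<Upsilon> \<equiv> word_hom (nodes (cox_A n)) (braid_relations (cox_A n)) (unf n)"
  shows "standard_unfolding n \<Upsilon>" "\<And>u. set u \<subseteq> {1..k} \<Longrightarrow> \<Upsilon> (artin_class (cox_B k) u) = artin_class (cox_A n) (unfold n u)"
proof -
  have sub: "set (unf n i) \<subseteq> nodes (cox_A n)" if i: "i \<in> nodes (cox_B k)" for i
  proof -
    have "1 \<le> i" "2 * i \<le> Suc n" using i k by (simp_all add: half_le_iff)
    then show ?thesis by (subst set_unf) auto
  qed
  have rel: "braid_eq (cox_A n) (unfold n u) (unfold n v)"
    if "(u, v) \<in> braid_relations (cox_B k)" "set u \<subseteq> nodes (cox_B k)" "set v \<subseteq> nodes (cox_B k)" for u v
    using that by (intro unfold_braid[OF k] pres_cong.rel) auto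
  have cls: "\<Upsilon> (artin_class (cox_B k) u) = artin_class (cox_A n) (unfold n u)" if "set u \<subseteq> nodes (cox_B k)" for u
    unfolding \<Upsilon>_def by (rule word_hom_class[OF sub rel that])
  then show "\<Upsilon> (artin_class (cox_B k) u) = artin_class (cox_A n) (unfold n u)" if "set u \<subseteq> {1..k}" for u
    using that by simp
  have hom: "\<Upsilon> \<in> artin_hom (cox_B k) (cox_A n)"
    unfolding \<Upsilon>_def artin_monoid_def by (rule word_hom_in_monoid_hom[OF sub rel])
  have k1: "1 \<le> k" using n k by simp
  have gen: "\<Upsilon> (artin_gen (cox_B k) i) = artin_class (cox_A n) (unf n i)" if "i \<in> {1..k}" for i
    using cls[of "[i]"] that by (simp add: artin_gen_def)
  have mult: "artin_class (cox_A n) u \<otimes>\<^bsub>artin_monoid (cox_A n)\<^esub> artin_class (cox_A n) v = artin_class (cox_A n) (u @ v)"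
    if "set u \<subseteq> {1..n}" "set v \<subseteq> {1..n}" for u v
    unfolding artin_monoid_def using that by (intro presented_monoid_mult) auto
  have two: "artin_gen (cox_A n) i \<otimes>\<^bsub>artin_monoid (cox_A n)\<^esub> artin_gen (cox_A n) j = artin_class (cox_A n) [i, j]"
    if "i \<in> {1..n}" "j \<in> {1..n}" for i j
    using mult[of "[i]" "[j]"] that by (simp add: artin_gen_def)
  have low: "\<Upsilon> (artin_gen (cox_B k) i) = artin_gen (cox_A n) i \<otimes>\<^bsub>artin_monoid (cox_A n)\<^esub> artin_gen (cox_A n) (n + 1 - i)"
    if i: "i \<in> {1..k - 1}" for i
  proof -
    have "2 * i < n" "1 \<le> i" using i k by auto
    then have "unf n i = [i, n + 1 - i]" "i \<in> {1..n}" "n + 1 - i \<in> {1..n}" "i \<in> {1..k}" using i by (auto simp: unf_def)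
    then show ?thesis using gen two by metis
  qed
  show "standard_unfolding n \<Upsilon>"
  proof (cases "odd n")
    case True
    then have kn: "2 * k = n + 1" using k by simp
    have "unf n k = [k]" using kn by (simp add: unf_def)
    then have "\<Upsilon> (artin_gen (cox_B k) k) = artin_gen (cox_A n) k" using gen[of k] k1 by (simp add: artin_gen_def)
    then show ?thesis unfolding standard_unfolding_def Let_def k[symmetric]
      using True hom low kn by auto
  next
    case False
    then have kn: "2 * k = n" using k by auto
    then have u: "unf n k = [k, Suc k, k]" by (simp add: unf_def)
    have kk: "k \<in> {1..n}" "k + 1 \<in> {1..n}" using kn k1 by auto
    have "artin_gen (cox_A n) k \<otimes>\<^bsub>artin_monoid (cox_A n)\<^esub> artin_gen (cox_A n) (k + 1)
       \<otimes>\<^bsub>artin_monoid (cox_A n)\<^esub> artin_gen (cox_A n) k = artin_class (cox_A n) [k, Suc k, k]"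
      using two[OF kk] mult[of "[k, Suc k]" "[k]"] kk by (simp add: artin_gen_def)
    then have "\<Upsilon> (artin_gen (cox_B k) k) = artin_gen (cox_A n) k \<otimes>\<^bsub>artin_monoid (cox_A n)\<^esub> artin_gen (cox_A n) (k + 1)
       \<otimes>\<^bsub>artin_monoid (cox_A n)\<^esub> artin_gen (cox_A n) k"
      using gen[of k] k1 u by simp
    then show ?thesis unfolding standard_unfolding_def Let_def k[symmetric]
      using False hom low kn by auto
  qed
qed

lemma folded_interval:
  assumes k: "k = (n + 1) div 2" and m: "1 \<le> m" "m \<le> k"
  shows "folded n {m..k} = {m..n + 1 - m}"
proof
  show "folded n {m..k} \<subseteq> {m..n + 1 - m}"
  proof
    fix x assume "x \<in> folded n {m..k}"
    then obtain i where i: "i \<in> {m..k}" "x = i \<or> x = n + 1 - i" unfolding folded_def by blast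
    have "2 * i \<le> n + 1" using i(1) k by (simp add: half_le_iff)
    then show "x \<in> {m..n + 1 - m}" using i m by auto
  qed
  show "{m..n + 1 - m} \<subseteq> folded n {m..k}"
  proof
    fix x assume x: "x \<in> {m..n + 1 - m}"
    show "x \<in> folded n {m..k}"
    proof (cases "x \<le> k")
      case True
      then have "x \<in> {m..k}" using x by simp
      then show ?thesis unfolding folded_def by blast
    next
      case False
      have "n + 1 \<le> 2 * k + 1" using k by linarith
      then have "n + 1 - x \<in> {m..k}" "x = n + 1 - (n + 1 - x)" using x m False by auto
      then show ?thesis unfolding folded_def by blast
    qed
  qed
qed

text \<open>The first factor \<open>\<Psi>\<close> is defined on words and its relations are
  checked; the relation of length 4 at the last generator is \<open>full_delta_four\<close>. The
  composite agrees with \<open>\<Phi>\<close> on generators because the folded supports are those of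
  \<open>type_B_supports\<close>.\<close>

lemma (in standard_disjoint) type_B_to_A:
  assumes \<sigma>: "coxeter_iso \<sigma> (cox_B m) L" and m: "m = card (nodes L)" and b: "\<not> b" and k: "k = (n + 1) div 2"
  shows "m \<le> k" "\<exists>\<Psi> \<Upsilon>. \<Psi> \<in> artin_hom L (cox_B k) \<and>
           (\<forall>i\<in>{1..m - 1}. \<Psi> (artin_gen L (\<sigma> i)) = artin_gen (cox_B k) i) \<and>
           \<Psi> (artin_gen L (\<sigma> m)) = artin_elt (cox_B k) (longest_elt (cox_B k) {m..k}) \<and>
           standard_unfolding n \<Upsilon> \<and>
           (\<forall>x\<in>carrier (artin_monoid L). \<Phi> x = \<Upsilon> (\<Psi> x))"
proof -
  have m3: "3 \<le> m" using rank m by simp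
  have bij: "bij_betw \<sigma> {1..m} (nodes L)" using \<sigma> by (simp add: coxeter_iso_def)
  have I: "\<sigma> i \<in> nodes L" if "i \<in> {1..m}" for i using bij that by (metis bij_betwE)
  have s: "strands b n = n" "strand_set b n J = J" for J using b by (simp_all add: strands_def strand_set_def)
  have M: "M = cox_A n" using b by (simp add: cox_def)
  note ts = type_B_supports[OF \<sigma> m, unfolded s]
  show mk: "m \<le> k" using ts(1) k by linarith
  have k1: "1 \<le> k" using mk m3 by simp
  let ?B = "cox_B k"
  have CB: "cox True k = ?B" by (simp add: cox_def)
  let ?g = "inv_into {1..m} \<sigma>"
  let ?D = "full_delta k m"
  \<comment> \<open>The last generator goes to a reduced word of the longest element on
    \<open>[m, k]\<close>, the others to single letters.\<close>
  define h where "h j = (if ?g j = m then ?D else [?g j])" for j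
  have g: "?g j \<in> {1..m}" "\<sigma> (?g j) = j" if "j \<in> nodes L" for j
    using bij_betw_inv_into[OF bij] bij_betw_inv_into_right[OF bij] that by (auto dest: bij_betwE)
  have g': "?g (\<sigma> i) = i" if "i \<in> {1..m}" for i using bij that by (simp add: bij_betw_inv_into_left)
  have sD: "set ?D \<subseteq> {1..k}" "set ?D \<subseteq> {m..k}" using set_full[of m k] m3 by auto
  have hsub: "set (h j) \<subseteq> nodes ?B" if "j \<in> nodes L" for j
    using g(1)[OF that] sD mk by (auto simp: h_def)
  have pair: "braid_eq ?B (alt_concat l (h (\<sigma> a)) (h (\<sigma> c))) (alt_concat l (h (\<sigma> c)) (h (\<sigma> a)))"
    if ac: "1 \<le> a" "a < c" "c \<le> m" and l: "bond (cox_B m) a c = enat l" for a c l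
  proof -
    have ha: "h (\<sigma> a) = [a]" using ac g'[of a] by (simp add: h_def)
    consider "c < m" | "c = m" "Suc a = m" | "c = m" "a + 2 \<le> m" using ac by linarith
    then show ?thesis
    proof cases
      case 1
      then have hc: "h (\<sigma> c) = [c]" using ac g'[of c] by (simp add: h_def)
      have "{a, c} \<noteq> {m - 1, m}" "{a, c} \<noteq> {k - 1, k}" using 1 ac mk by (auto simp: doubleton_eq_iff)
      then have "bond ?B a c = bond (cox_B m) a c" by (simp add: cox_B_def del: One_nat_def)
      then have "bond ?B a c = enat l" using l by simp
      then show ?thesis unfolding ha hc alt_concat_singleton using ac 1 mk by (intro braid_eq_alt) auto
    next
      case 2
      then have hc: "h (\<sigma> c) = full_delta k (Suc a)" using ac g'[of c] by (simp add: h_def)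
      have "bond (cox_B m) a c = 4" unfolding 2(1) 2(2)[symmetric] by (simp add: cox_B_def)
      then have "l = 4" using l by (simp add: numeral_eq_enat)
      then show ?thesis unfolding ha hc using full_delta_four[of a k] 2 ac mk CB by (simp add: numeral_eq_Suc)
    next
      case 3
      then have hc: "h (\<sigma> c) = ?D" using ac g'[of c] by (simp add: h_def)
      have "{a, c} \<noteq> {m - 1, m}" using 3 by (auto simp: doubleton_eq_iff)
      moreover have "a \<noteq> c" "c \<noteq> Suc a" "a \<noteq> Suc c" using 3 by auto
      ultimately have "bond (cox_B m) a c = 2" by (simp add: cox_B_def del: One_nat_def)
      then have l2: "l = 2" using l by (simp add: numeral_eq_enat)
      have "braid_eq (cox True k) (a # ?D) (?D @ [a])"
      proof (rule braid_commute_word[OF _ sD(1)])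
        show "a \<in> {1..k}" using ac mk by simp
        fix j assume "j \<in> set ?D"
        then have "m \<le> j" using sD(2) by auto
        then show "a + 2 \<le> j \<or> j + 2 \<le> a" using 3 by simp
      qed
      then show ?thesis unfolding ha hc l2 CB by (simp add: numeral_eq_Suc)
    qed
  qed
  have rel: "braid_eq ?B (concat (map h u)) (concat (map h v))" if uv: "(u, v) \<in> braid_relations L" for u v
  proof -
    obtain l i j where *: "u = alt_word l i j" "v = alt_word l j i" "i \<in> nodes L" "j \<in> nodes L" "i \<noteq> j"
      "bond L i j = enat l" using uv by (auto simp: braid_relations_def)
    define a where "a = ?g i"
    define c where "c = ?g j"
    have ac: "a \<in> {1..m}" "c \<in> {1..m}" "\<sigma> a = i" "\<sigma> c = j" using g *(3,4) unfolding a_def c_def by auto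
    have ne: "a \<noteq> c" using ac(3,4) *(5) by blast
    have "bond (cox_B m) a c = bond L (\<sigma> a) (\<sigma> c)" "bond (cox_B m) c a = bond L (\<sigma> c) (\<sigma> a)"
      using \<sigma> ac(1,2) by (simp_all add: coxeter_iso_def)
    then have bd: "bond (cox_B m) a c = enat l" "bond (cox_B m) c a = enat l"
      using * ac(3,4) bond_sym[of i j] by simp_all
    have "braid_eq ?B (alt_concat l (h i) (h j)) (alt_concat l (h j) (h i))"
    proof (cases "a < c")
      case True
      then show ?thesis using pair[of a c l] bd ac by simp
    next
      case False
      then have "c < a" using ne by simp
      then show ?thesis using pair[of c a l] bd ac by (simp add: pres_cong.sym)
    qed
    then show ?thesis unfolding * concat_map_alt_word .
  qed
  define \<Psi> where "\<Psi> = word_hom (nodes ?B) (braid_relations ?B) h"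
  have \<Psi>: "\<Psi> \<in> artin_hom L ?B" "\<And>u. set u \<subseteq> nodes L \<Longrightarrow> \<Psi> (artin_class L u) = artin_class ?B (concat (map h u))"
    unfolding \<Psi>_def artin_monoid_def
    using word_hom_in_monoid_hom[OF hsub rel] word_hom_class[OF hsub rel] by blast+
  have \<Psi>g: "\<Psi> (artin_gen L (\<sigma> i)) = artin_class ?B (h (\<sigma> i))" if "i \<in> {1..m}" for i
    using \<Psi>(2)[of "[\<sigma> i]"] I[OF that] by (simp add: artin_gen_def)
  define \<Upsilon> where "\<Upsilon> = word_hom (nodes (cox_A n)) (braid_relations (cox_A n)) (unf n)"
  have \<Upsilon>: "standard_unfolding n \<Upsilon>" "\<And>u. set u \<subseteq> {1..k} \<Longrightarrow> \<Upsilon> (artin_class ?B u) = artin_class (cox_A n) (unfold n u)"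
    unfolding \<Upsilon>_def using standard_unfolding_ex[OF n k] by blast+
  have small: "\<forall>i\<in>{1..m - 1}. \<Psi> (artin_gen L (\<sigma> i)) = artin_gen ?B i"
  proof
    fix i assume i: "i \<in> {1..m - 1}"
    then have im: "i \<in> {1..m}" "i \<noteq> m" using m3 by auto
    then show "\<Psi> (artin_gen L (\<sigma> i)) = artin_gen ?B i"
      using \<Psi>g[OF im(1)] g'[OF im(1)] by (simp add: h_def artin_gen_def)
  qed
  have dm: "delta True k {m..k} 1 = ?D" using m3 mk by (intro delta_interval) auto
  have mm: "m \<in> {1..m}" using m3 by simp
  have big: "\<Psi> (artin_gen L (\<sigma> m)) = artin_elt ?B (longest_elt ?B {m..k})"
  proof -
    have "{m..k} \<subseteq> {1..k}" using m3 by auto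
    from artin_elt_longest[OF k1 this, of True]
    have e: "artin_elt ?B (longest_elt ?B {m..k}) = artin_class ?B ?D" unfolding dm CB .
    have "h (\<sigma> m) = ?D" using g'[OF mm] by (simp add: h_def)
    then show ?thesis unfolding \<Psi>g[OF mm] e by simp
  qed
  have gens: "\<Phi> (artin_class L [j]) = artin_class M (unfold n (h j))" if j: "j \<in> nodes L" for j
  proof -
    define i where "i = ?g j"
    have i: "i \<in> {1..m}" "\<sigma> i = j" using g[OF j] unfolding i_def by auto
    \<comment> \<open>The support of \<open>\<Psi>\<close> at this generator. Its closure under the
      mirror is \<open>supp j\<close>, so \<open>unfold_delta\<close> compares the two
      images.\<close>
    define K where "K = (if i = m then {m..k} else {i})"
    have K: "K \<subseteq> {1..k}" using i mk m3 unfolding K_def by auto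
    have hK: "h j = delta True k K 1"
    proof (cases "i = m")
      case True
      then show ?thesis unfolding h_def K_def i_def[symmetric] by (simp only: True if_True dm)
    next
      case False
      have "delta True k {i} 1 = [i]" using i(1) mk by (intro delta_single) auto
      then show ?thesis unfolding h_def K_def i_def[symmetric] by (simp only: False if_False)
    qed
    have "folded n K = supp j"
    proof (cases "i = m")
      case True
      then show ?thesis using folded_interval[OF k, of m] ts(3) i(2) mk m3 by (simp add: K_def)
    next
      case False
      then have "i \<in> {1..m - 1}" using i(1) by auto
      from ts(2)[OF this] show ?thesis using False i(2) by (simp add: K_def folded_def)
    qed
    then have "braid_eq (cox_A n) (unfold n (h j)) (delta_A n (supp j))"
      using unfold_delta[OF k n K] unfolding hK by simp
    then have "artin_class M (unfold n (h j)) = artin_class M (dl j)"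
      unfolding M using b by (intro pres_class_eqI) simp
    then show ?thesis using gen_image(2)[OF j] by (simp add: artin_gen_def)
  qed
  have unf_sub: "set (unfold n (h j)) \<subseteq> nodes M" if "j \<in> nodes L" for j
  proof -
    have "set (h j) \<subseteq> {1..(n + 1) div 2}" using hsub[OF that] k by simp
    then show ?thesis using set_unfold folded_subset unfolding M nodes_cox by metis
  qed
  have comp: "\<forall>x\<in>carrier (artin_monoid L). \<Phi> x = \<Upsilon> (\<Psi> x)"
  proof
    fix x assume "x \<in> carrier (artin_monoid L)"
    then obtain u where u: "set u \<subseteq> nodes L" "x = artin_class L u"
      by (auto simp: artin_monoid_def presented_carrier)
    have "\<Phi> (artin_class L u) = artin_class M (concat (map (\<lambda>j. unfold n (h j)) u))"
    proof (rule hom_on_words[OF _ _ _ u(1)])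
      show "\<Phi> \<in> monoid_hom (presented_monoid (nodes L) (braid_relations L)) (presented_monoid (nodes M) (braid_relations M))"
        using hom by (simp add: artin_monoid_def)
    qed (fact unf_sub, fact gens)
    also have "concat (map (\<lambda>j. unfold n (h j)) u) = unfold n (concat (map h u))"
      by (induction u) auto
    finally have "\<Phi> x = artin_class (cox_A n) (unfold n (concat (map h u)))" using u by (simp add: M)
    moreover have "set (concat (map h u)) \<subseteq> {1..k}" using hsub u(1) by fastforce
    ultimately show "\<Phi> x = \<Upsilon> (\<Psi> x)" using \<Upsilon>(2) \<Psi>(2)[OF u(1)] u(2) by simp
  qed
  show "\<exists>\<Psi> \<Upsilon>. \<Psi> \<in> artin_hom L (cox_B k) \<and>
           (\<forall>i\<in>{1..m - 1}. \<Psi> (artin_gen L (\<sigma> i)) = artin_gen (cox_B k) i) \<and>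
           \<Psi> (artin_gen L (\<sigma> m)) = artin_elt (cox_B k) (longest_elt (cox_B k) {m..k}) \<and>
           standard_unfolding n \<Upsilon> \<and>
           (\<forall>x\<in>carrier (artin_monoid L). \<Phi> x = \<Upsilon> (\<Psi> x))"
    using \<Psi>(1) small big \<Upsilon>(1) comp by blast
qed

theorem theorem5p49:
  fixes L :: "'a coxeter" and M :: "nat coxeter" and m n :: nat
    and \<Phi> :: "'a list set \<Rightarrow> nat list set"
  assumes "coxeter_matrix L" and "coxeter_irreducible L" and "finite_type L"
    and "m = card (nodes L)" and "m > 2"
    and "(n \<ge> 1 \<and> M = cox_A n) \<or> (n \<ge> 2 \<and> M = cox_B n)"
    and "\<Phi> \<in> artin_hom L M"
    and "optimal_hom L M \<Phi>" and "fully_supported_hom L M \<Phi>"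
    and "disjoint_hom L \<Phi>" and "standard_hom L M \<Phi>"
  shows
    "(\<not> type_B L \<longrightarrow>
        type_A L \<and> type_A M \<and> \<Phi> \<in> iso (artin_monoid L) (artin_monoid M)) \<and>
     (\<forall>\<sigma>. coxeter_iso \<sigma> (cox_B m) L \<and> M = cox_B n \<longrightarrow>
        m \<le> n \<and>
        (\<forall>i\<in>{1..m - 1}. \<Phi> (artin_gen L (\<sigma> i)) = artin_gen (cox_B n) i) \<and>
        \<Phi> (artin_gen L (\<sigma> m)) = artin_elt (cox_B n) (longest_elt (cox_B n) {m..n})) \<and>
     (\<forall>\<sigma> k. coxeter_iso \<sigma> (cox_B m) L \<and> M = cox_A n \<and> k = (n + 1) div 2 \<longrightarrow>
        m \<le> k \<and>
        (\<exists>\<Psi> \<Upsilon>. \<Psi> \<in> artin_hom L (cox_B k) \<and>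
           (\<forall>i\<in>{1..m - 1}. \<Psi> (artin_gen L (\<sigma> i)) = artin_gen (cox_B k) i) \<and>
           \<Psi> (artin_gen L (\<sigma> m)) = artin_elt (cox_B k) (longest_elt (cox_B k) {m..k}) \<and>
           standard_unfolding n \<Upsilon> \<and>
           (\<forall>x\<in>carrier (artin_monoid L). \<Phi> x = \<Upsilon> (\<Psi> x))))"
proof -
  define b where "b \<longleftrightarrow> M = cox_B n"
  have n: "1 \<le> n" using assms(6) by auto
  have M: "M = cox b n" using assms(6) cox_A_neq_cox_B[OF n] by (auto simp: b_def cox_def)
  \<comment> \<open>\<open>card\<close> is 0 on infinite sets, so \<open>m > 2\<close> implies
    finiteness.\<close>
  have fin: "finite (nodes L)" using assms(4,5) card.infinite by fastforce
  have card: "3 \<le> card (nodes L)" using assms(4,5) by simp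
  interpret standard_disjoint L b n \<Phi>
    by unfold_locales (fact assms(1-3) fin card n assms(7-11)[unfolded M])+
  have "type_A (cox_A n)"
    unfolding type_A_def coxeter_iso_def using n by (intro exI[of _ n] exI[of _ id] conjI) auto
  then have a: "\<not> type_B L \<longrightarrow> type_A L \<and> type_A M \<and> \<Phi> \<in> iso (artin_monoid L) (artin_monoid M)"
    using not_type_B by (auto simp: M cox_def)
  show ?thesis
  proof (intro conjI allI impI ballI)
    assume "\<not> type_B L"
    then show "type_A L" "type_A M" "\<Phi> \<in> iso (artin_monoid L) (artin_monoid M)" using a by auto
  next
    fix \<sigma> assume h: "coxeter_iso \<sigma> (cox_B m) L \<and> M = cox_B n"
    then have "coxeter_iso \<sigma> (cox_B m) L" b by (auto simp: b_def)
    note t = type_B_to_B[OF this(1) assms(4) this(2)]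
    show "m \<le> n" "\<Phi> (artin_gen L (\<sigma> m)) = artin_elt (cox_B n) (longest_elt (cox_B n) {m..n})" using t by auto
    show "\<Phi> (artin_gen L (\<sigma> i)) = artin_gen (cox_B n) i" if "i \<in> {1..m - 1}" for i using t(2)[OF that] .
  next
    fix \<sigma> k assume h: "coxeter_iso \<sigma> (cox_B m) L \<and> M = cox_A n \<and> k = (n + 1) div 2"
    then have nb: "\<not> b" using cox_A_neq_cox_B[OF n] by (auto simp: b_def)
    note t = type_B_to_A[OF conjunct1[OF h] assms(4) nb conjunct2[OF conjunct2[OF h]]]
    show "m \<le> k" by (rule t(1))
    show "\<exists>\<Psi> \<Upsilon>. \<Psi> \<in> artin_hom L (cox_B k) \<and>
           (\<forall>i\<in>{1..m - 1}. \<Psi> (artin_gen L (\<sigma> i)) = artin_gen (cox_B k) i) \<and>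
           \<Psi> (artin_gen L (\<sigma> m)) = artin_elt (cox_B k) (longest_elt (cox_B k) {m..k}) \<and>
           standard_unfolding n \<Upsilon> \<and>
           (\<forall>x\<in>carrier (artin_monoid L). \<Phi> x = \<Upsilon> (\<Psi> x))" by (rule t(2))
  qed
qed

end
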